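(* Let $X$ be a connected and locally simply-connected topological space, let $x\in X$, and let $R$ be a commutative ring. There is an equivalence between the category of locally constant sheaves of $R$-modules on $X$ and the category of (left) $R[\pi_1(X,x)]$-modules.
   Context: A sheaf of $R$-modules on $X$ is locally constant if its restriction to each member of some open covering of $X$ is isomorphic to the constant sheaf (of locally constant functions) with values in some $R$-module. $R[\pi_1(X,x)]$ is the group ring. Topological spaces are assumed locally path-connected. *)

theory Defs
  imports "HOL-Analysis.Analysis" "HOL-Algebra.Module"
begin

section \<open>Categories and equivalence of categories\<close>

text \<open>
  Arrows do not carry their domain and codomain; composition and the arrow part of a
  functor therefore take the objects as extra arguments.  \<open>Cmp C A B D g f\<close> is the composite
  of \<open>f : A \<rightarrow> B\<close> followed by \<open>g : B \<rightarrow> D\<close>.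
\<close>

record ('o, 'm) category =
  Obj :: "'o set"
  Hom :: "'o \<Rightarrow> 'o \<Rightarrow> 'm set"
  Idt :: "'o \<Rightarrow> 'm"
  Cmp :: "'o \<Rightarrow> 'o \<Rightarrow> 'o \<Rightarrow> 'm \<Rightarrow> 'm \<Rightarrow> 'm"

locale category =
  fixes C :: "('o, 'm) category"
  assumes Idt_in: "A \<in> Obj C \<Longrightarrow> Idt C A \<in> Hom C A A"
    and Cmp_in: "\<lbrakk>A \<in> Obj C; B \<in> Obj C; D \<in> Obj C; f \<in> Hom C A B; g \<in> Hom C B D\<rbrakk>
                  \<Longrightarrow> Cmp C A B D g f \<in> Hom C A D"
    and Idt_right: "\<lbrakk>A \<in> Obj C; B \<in> Obj C; f \<in> Hom C A B\<rbrakk> \<Longrightarrow> Cmp C A A B f (Idt C A) = f"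
    and Idt_left: "\<lbrakk>A \<in> Obj C; B \<in> Obj C; f \<in> Hom C A B\<rbrakk> \<Longrightarrow> Cmp C A B B (Idt C B) f = f"
    and Cmp_assoc: "\<lbrakk>A \<in> Obj C; B \<in> Obj C; D \<in> Obj C; E \<in> Obj C;
                     f \<in> Hom C A B; g \<in> Hom C B D; h \<in> Hom C D E\<rbrakk>
                  \<Longrightarrow> Cmp C A D E h (Cmp C A B D g f) = Cmp C A B E (Cmp C B D E h g) f"

definition is_functor ::
  "('o, 'm) category \<Rightarrow> ('p, 'n) category \<Rightarrow> ('o \<Rightarrow> 'p) \<Rightarrow> ('o \<Rightarrow> 'o \<Rightarrow> 'm \<Rightarrow> 'n) \<Rightarrow> bool" where
  "is_functor C D Fo Fm \<longleftrightarrow>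
     (\<forall>A\<in>Obj C. Fo A \<in> Obj D) \<and>
     (\<forall>A\<in>Obj C. \<forall>B\<in>Obj C. \<forall>f\<in>Hom C A B. Fm A B f \<in> Hom D (Fo A) (Fo B)) \<and>
     (\<forall>A\<in>Obj C. Fm A A (Idt C A) = Idt D (Fo A)) \<and>
     (\<forall>A\<in>Obj C. \<forall>B\<in>Obj C. \<forall>E\<in>Obj C. \<forall>f\<in>Hom C A B. \<forall>g\<in>Hom C B E.
        Fm A E (Cmp C A B E g f) = Cmp D (Fo A) (Fo B) (Fo E) (Fm B E g) (Fm A B f))"

definition is_iso :: "('o, 'm) category \<Rightarrow> 'o \<Rightarrow> 'o \<Rightarrow> 'm \<Rightarrow> bool" where
  "is_iso C A B f \<longleftrightarrow>
     f \<in> Hom C A B \<and>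
     (\<exists>g\<in>Hom C B A. Cmp C A B A g f = Idt C A \<and> Cmp C B A B f g = Idt C B)"

definition natural_iso ::
  "('o, 'm) category \<Rightarrow> ('p, 'n) category \<Rightarrow> ('o \<Rightarrow> 'p) \<Rightarrow> ('o \<Rightarrow> 'o \<Rightarrow> 'm \<Rightarrow> 'n) \<Rightarrow>
   ('o \<Rightarrow> 'p) \<Rightarrow> ('o \<Rightarrow> 'o \<Rightarrow> 'm \<Rightarrow> 'n) \<Rightarrow> ('o \<Rightarrow> 'n) \<Rightarrow> bool" where
  "natural_iso C D Fo Fm Go Gm \<eta> \<longleftrightarrow>
     (\<forall>A\<in>Obj C. is_iso D (Fo A) (Go A) (\<eta> A)) \<and>
     (\<forall>A\<in>Obj C. \<forall>B\<in>Obj C. \<forall>f\<in>Hom C A B.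
        Cmp D (Fo A) (Fo B) (Go B) (\<eta> B) (Fm A B f) =
        Cmp D (Fo A) (Go A) (Go B) (Gm A B f) (\<eta> A))"

definition equivalent_categories :: "('o, 'm) category \<Rightarrow> ('p, 'n) category \<Rightarrow> bool" where
  "equivalent_categories C D \<longleftrightarrow>
     category C \<and> category D \<and>
     (\<exists>Fo Fm Go Gm.
        is_functor C D Fo Fm \<and> is_functor D C Go Gm \<and>
        (\<exists>\<eta>. natural_iso C C (\<lambda>A. A) (\<lambda>A B f. f)
                (\<lambda>A. Go (Fo A)) (\<lambda>A B f. Gm (Fo A) (Fo B) (Fm A B f)) \<eta>) \<and>
        (\<exists>\<epsilon>. natural_iso D D (\<lambda>A. Fo (Go A)) (\<lambda>A B f. Fm (Go A) (Go B) (Gm A B f))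
                (\<lambda>A. A) (\<lambda>A B f. f) \<epsilon>))"


section \<open>Modules\<close>

text \<open>
  The library locale \<open>module\<close> requires a commutative ring of scalars.  The following locale has
  the same axioms over an arbitrary ring.  In both cases the fields \<open>mult\<close> and \<open>one\<close>
  which the record type of modules inherits from that of rings play no role.
\<close>

locale left_module = R?: ring + M?: abelian_group M for M (structure) +
  assumes smult_closed:
      "\<lbrakk>a \<in> carrier R; x \<in> carrier M\<rbrakk> \<Longrightarrow> a \<odot>\<^bsub>M\<^esub> x \<in> carrier M"
    and smult_l_distr:
      "\<lbrakk>a \<in> carrier R; b \<in> carrier R; x \<in> carrier M\<rbrakk> \<Longrightarrow>
        (a \<oplus>\<^bsub>R\<^esub> b) \<odot>\<^bsub>M\<^esub> x = a \<odot>\<^bsub>M\<^esub> x \<oplus>\<^bsub>M\<^esub> b \<odot>\<^bsub>M\<^esub> x"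
    and smult_r_distr:
      "\<lbrakk>a \<in> carrier R; x \<in> carrier M; y \<in> carrier M\<rbrakk> \<Longrightarrow>
        a \<odot>\<^bsub>M\<^esub> (x \<oplus>\<^bsub>M\<^esub> y) = a \<odot>\<^bsub>M\<^esub> x \<oplus>\<^bsub>M\<^esub> a \<odot>\<^bsub>M\<^esub> y"
    and smult_assoc:
      "\<lbrakk>a \<in> carrier R; b \<in> carrier R; x \<in> carrier M\<rbrakk> \<Longrightarrow>
        (a \<otimes>\<^bsub>R\<^esub> b) \<odot>\<^bsub>M\<^esub> x = a \<odot>\<^bsub>M\<^esub> (b \<odot>\<^bsub>M\<^esub> x)"
    and smult_one:
      "x \<in> carrier M \<Longrightarrow> \<one>\<^bsub>R\<^esub> \<odot>\<^bsub>M\<^esub> x = x"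

text \<open>Linear maps are extensional, so that equal arrows are equal as HOL functions.\<close>

definition lin_maps ::
  "('r, 'e) ring_scheme \<Rightarrow> ('r, 'u) module \<Rightarrow> ('r, 'v) module \<Rightarrow> ('u \<Rightarrow> 'v) set" where
  "lin_maps R M N =
     {f \<in> carrier M \<rightarrow>\<^sub>E carrier N.
        (\<forall>s\<in>carrier M. \<forall>t\<in>carrier M. f (s \<oplus>\<^bsub>M\<^esub> t) = f s \<oplus>\<^bsub>N\<^esub> f t) \<and>
        (\<forall>a\<in>carrier R. \<forall>s\<in>carrier M. f (a \<odot>\<^bsub>M\<^esub> s) = a \<odot>\<^bsub>N\<^esub> f s)}"

definition left_module_category ::
  "('r, 'e) ring_scheme \<Rightarrow> (('r, 'u) module, 'u \<Rightarrow> 'u) category" where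
  "left_module_category R =
     \<lparr>Obj = {M. left_module R M},
      Hom = lin_maps R,
      Idt = (\<lambda>M. \<lambda>s\<in>carrier M. s),
      Cmp = (\<lambda>L M N g f. compose (carrier L) g f)\<rparr>"


section \<open>The fundamental group and the group ring\<close>

text \<open>The product of two classes traverses a loop of the first class first.\<close>

definition fundamental_group ::
  "'a::topological_space set \<Rightarrow> 'a \<Rightarrow> (real \<Rightarrow> 'a) set monoid" where
  "fundamental_group X x =
     \<lparr>carrier = {Collect (homotopic_paths X p) | p.
                   path p \<and> path_image p \<subseteq> X \<and> pathstart p = x \<and> pathfinish p = x},
      mult = (\<lambda>A B. \<Union>p\<in>A. \<Union>q\<in>B. Collect (homotopic_paths X (p +++ q))),
      one = Collect (homotopic_paths X (\<lambda>t. x))\<rparr>"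

definition group_ring ::
  "('r, 'e) ring_scheme \<Rightarrow> ('g, 'f) monoid_scheme \<Rightarrow> ('g \<Rightarrow> 'r) ring" where
  "group_ring R G =
     \<lparr>carrier = {f \<in> carrier G \<rightarrow>\<^sub>E carrier R. finite {g \<in> carrier G. f g \<noteq> \<zero>\<^bsub>R\<^esub>}},
      mult = (\<lambda>f h. \<lambda>k\<in>carrier G.
                \<Oplus>\<^bsub>R\<^esub>g\<in>{g \<in> carrier G. f g \<noteq> \<zero>\<^bsub>R\<^esub>}. f g \<otimes>\<^bsub>R\<^esub> h (inv\<^bsub>G\<^esub> g \<otimes>\<^bsub>G\<^esub> k)),
      one = (\<lambda>k\<in>carrier G. if k = \<one>\<^bsub>G\<^esub> then \<one>\<^bsub>R\<^esub> else \<zero>\<^bsub>R\<^esub>),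
      zero = (\<lambda>k\<in>carrier G. \<zero>\<^bsub>R\<^esub>),
      add = (\<lambda>f h. \<lambda>k\<in>carrier G. f k \<oplus>\<^bsub>R\<^esub> h k)\<rparr>"


section \<open>Sheaves of modules\<close>

abbreviation opens :: "'a::topological_space set \<Rightarrow> 'a set set" where
  "opens X \<equiv> {U. openin (top_of_set X) U}"

text \<open>
  \<open>sect F U\<close> is the module of sections over \<open>U\<close>, and \<open>rstr F U V\<close> the restriction map from \<open>U\<close>
  to \<open>V \<subseteq> U\<close>.  The space is not part of the data but a parameter of the predicates
  below, which only look at its open subsets: for \<open>U\<close> open in \<open>X\<close>, the restriction to \<open>U\<close>
  of a sheaf \<open>F\<close> on \<open>X\<close> is the same record \<open>F\<close> considered over the space \<open>U\<close>.
\<close>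

record ('a, 'r, 'u) presheaf =
  sect :: "'a set \<Rightarrow> ('r, 'u) module"
  rstr :: "'a set \<Rightarrow> 'a set \<Rightarrow> 'u \<Rightarrow> 'u"

locale presheaf_of_modules =
  fixes X :: "'a::topological_space set" and R :: "('r, 'e) ring_scheme"
    and F :: "('a, 'r, 'u) presheaf"
  assumes sect_module: "U \<in> opens X \<Longrightarrow> Module.module R (sect F U)"
    and rstr_linear: "\<lbrakk>U \<in> opens X; V \<in> opens X; V \<subseteq> U\<rbrakk>
                       \<Longrightarrow> rstr F U V \<in> lin_maps R (sect F U) (sect F V)"
    and rstr_id: "\<lbrakk>U \<in> opens X; s \<in> carrier (sect F U)\<rbrakk> \<Longrightarrow> rstr F U U s = s"
    and rstr_rstr: "\<lbrakk>U \<in> opens X; V \<in> opens X; W \<in> opens X; W \<subseteq> V; V \<subseteq> U;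
                     s \<in> carrier (sect F U)\<rbrakk>
                     \<Longrightarrow> rstr F V W (rstr F U V s) = rstr F U W s"

locale sheaf_of_modules = presheaf_of_modules X R F
  for X :: "'a::topological_space set" and R :: "('r, 'e) ring_scheme"
    and F :: "('a, 'r, 'u) presheaf" +
  assumes glue: "\<lbrakk>\<U> \<subseteq> opens X;
                  \<And>V. V \<in> \<U> \<Longrightarrow> s V \<in> carrier (sect F V);
                  \<And>V W. \<lbrakk>V \<in> \<U>; W \<in> \<U>\<rbrakk> \<Longrightarrow> rstr F V (V \<inter> W) (s V) = rstr F W (V \<inter> W) (s W)\<rbrakk>
                  \<Longrightarrow> \<exists>!t. t \<in> carrier (sect F (\<Union>\<U>)) \<and> (\<forall>V\<in>\<U>. rstr F (\<Union>\<U>) V t = s V)"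

definition sheaf_homs ::
  "'a::topological_space set \<Rightarrow> ('r, 'e) ring_scheme \<Rightarrow> ('a, 'r, 'u) presheaf \<Rightarrow>
   ('a, 'r, 'v) presheaf \<Rightarrow> ('a set \<Rightarrow> 'u \<Rightarrow> 'v) set" where
  "sheaf_homs X R F G =
     {\<phi> \<in> (\<Pi>\<^sub>E U\<in>opens X. lin_maps R (sect F U) (sect G U)).
        \<forall>U\<in>opens X. \<forall>V\<in>opens X. V \<subseteq> U \<longrightarrow>
          (\<forall>s\<in>carrier (sect F U). \<phi> V (rstr F U V s) = rstr G U V (\<phi> U s))}"

definition sheaf_id ::
  "'a::topological_space set \<Rightarrow> ('a, 'r, 'u) presheaf \<Rightarrow> 'a set \<Rightarrow> 'u \<Rightarrow> 'u" where
  "sheaf_id X F = (\<lambda>U\<in>opens X. \<lambda>s\<in>carrier (sect F U). s)"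

definition sheaf_comp ::
  "'a::topological_space set \<Rightarrow> ('a, 'r, 'u) presheaf \<Rightarrow> ('a set \<Rightarrow> 'v \<Rightarrow> 'w) \<Rightarrow>
   ('a set \<Rightarrow> 'u \<Rightarrow> 'v) \<Rightarrow> 'a set \<Rightarrow> 'u \<Rightarrow> 'w" where
  "sheaf_comp X F \<psi> \<phi> = (\<lambda>U\<in>opens X. compose (carrier (sect F U)) (\<psi> U) (\<phi> U))"

definition isomorphic_sheaves ::
  "'a::topological_space set \<Rightarrow> ('r, 'e) ring_scheme \<Rightarrow> ('a, 'r, 'u) presheaf \<Rightarrow>
   ('a, 'r, 'v) presheaf \<Rightarrow> bool" where
  "isomorphic_sheaves X R F G \<longleftrightarrow>
     (\<exists>\<phi>\<in>sheaf_homs X R F G. \<exists>\<psi>\<in>sheaf_homs X R G F.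
        sheaf_comp X F \<psi> \<phi> = sheaf_id X F \<and> sheaf_comp X G \<phi> \<psi> = sheaf_id X G)"


subsection \<open>Locally constant sheaves\<close>

definition loc_const_functions ::
  "'a::topological_space set \<Rightarrow> 'u set \<Rightarrow> ('a \<Rightarrow> 'u) set" where
  "loc_const_functions U M =
     {s \<in> U \<rightarrow>\<^sub>E M. \<forall>y\<in>U. \<exists>W\<in>opens U. y \<in> W \<and> s constant_on W}"

text \<open>
  \<open>mult\<close> and \<open>one\<close> are filled in only because the record type of modules has these fields.
\<close>

definition constant_sheaf ::
  "('r, 'u) module \<Rightarrow> ('a::topological_space, 'r, 'a \<Rightarrow> 'u) presheaf" where
  "constant_sheaf M =
     \<lparr>sect = (\<lambda>U.
        \<lparr>carrier = loc_const_functions U (carrier M),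
         mult = (\<lambda>s t. undefined),
         one = undefined,
         zero = (\<lambda>y\<in>U. \<zero>\<^bsub>M\<^esub>),
         add = (\<lambda>s t. \<lambda>y\<in>U. s y \<oplus>\<^bsub>M\<^esub> t y),
         smult = (\<lambda>a s. \<lambda>y\<in>U. a \<odot>\<^bsub>M\<^esub> s y)\<rparr>),
      rstr = (\<lambda>U V. \<lambda>s\<in>loc_const_functions U (carrier M). restrict s V)\<rparr>"

text \<open>
  Taking the values \<open>M\<close> in the type \<open>'u\<close> of the sections is no restriction: over a nonempty
  open set \<open>M\<close> embeds into the sections as the constant functions.
\<close>

definition locally_constant_sheaf ::
  "'a::topological_space set \<Rightarrow> ('r, 'e) ring_scheme \<Rightarrow> ('a, 'r, 'u) presheaf \<Rightarrow> bool" where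
  "locally_constant_sheaf X R F \<longleftrightarrow>
     sheaf_of_modules X R F \<and>
     (\<exists>\<U> \<subseteq> opens X. \<Union>\<U> = X \<and>
        (\<forall>U\<in>\<U>. \<exists>M :: ('r, 'u) module.
           Module.module R M \<and> isomorphic_sheaves U R F (constant_sheaf M)))"

definition locally_constant_sheaf_category ::
  "'a::topological_space set \<Rightarrow> ('r, 'e) ring_scheme \<Rightarrow>
   (('a, 'r, 'u) presheaf, 'a set \<Rightarrow> 'u \<Rightarrow> 'u) category" where
  "locally_constant_sheaf_category X R =
     \<lparr>Obj = {F. locally_constant_sheaf X R F},
      Hom = sheaf_homs X R,
      Idt = sheaf_id X,
      Cmp = (\<lambda>F G H \<psi> \<phi>. sheaf_comp X F \<psi> \<phi>)\<rparr>"


section \<open>Size\<close>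

text \<open>
  HOL has no category of all modules: in one statement, the elements of all the modules, and
  all the sections of the sheaves, come from a fixed type \<open>'u\<close>, which plays the role of the
  universe.  It has to be closed under families indexed by the points of the space, because
  already the sections of a constant sheaf with values in \<open>M\<close> are functions from open sets
  to \<open>M\<close>.
\<close>

definition closed_under_families :: "'a set \<Rightarrow> 'u itself \<Rightarrow> bool" where
  "closed_under_families X u \<longleftrightarrow> (\<exists>e :: ('a \<Rightarrow> 'u) \<Rightarrow> 'u. inj_on e (X \<rightarrow>\<^sub>E UNIV))"

text \<open>
  Every type \<open>'w\<close> embeds, by constant functions, into such a universe, so there are universes
  containing any prescribed modules.
\<close>

lemma closed_under_families_lists:
  "closed_under_families (X :: 'a set) TYPE('a list \<Rightarrow> 'w)"
proof -
  let ?e = "\<lambda>(f :: 'a \<Rightarrow> 'a list \<Rightarrow> 'w) l. f (hd l) (tl l)"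
  have "inj ?e"
  proof (rule injI, intro ext)
    fix f g :: "'a \<Rightarrow> 'a list \<Rightarrow> 'w" and a l
    assume "?e f = ?e g"
    then have "?e f (a # l) = ?e g (a # l)" by (rule fun_cong)
    then show "f a l = g a l" by simp
  qed
  then show ?thesis
    unfolding closed_under_families_def by (blast intro: inj_on_subset)
qed

end

theory Submission
  imports Defs
begin

text \<open>
  Choose a path \<open>\<gamma> y\<close> from \<open>x\<close> to every point \<open>y\<close>.  A module over the group ring is an
  \<open>R\<close>-module \<open>P\<close> with a linear action of the fundamental group, and it gives the sheaf whose
  sections over \<open>U\<close> are the functions \<open>s : U \<rightarrow> P\<close> such that \<open>s y\<close> is the image of \<open>s z\<close> under the
  class of the loop (\<open>\<gamma> y\<close>, then \<open>p\<close>, then \<open>\<gamma> z\<close> reversed) for every path \<open>p\<close> in \<open>U\<close> from \<open>y\<close>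
  to \<open>z\<close>.  If \<open>U\<close> is open, path-connected and its loops are null-homotopic in \<open>X\<close>, then a section
  over \<open>U\<close> is determined by its value at one point, which can be arbitrary.  So the sheaf is locally
  constant, and a morphism between two such sheaves induces maps of the values at all points, which
  correspond to each other along paths and hence amount to one equivariant map: the functor is fully
  faithful.

  Conversely, germs of a locally constant sheaf can be transported along paths in a unique way that
  is invariant under homotopies; all this follows from the connectedness of the unit interval, because
  the germs extend to unique sections over the members of a base of the topology.  The fundamental group
  acts on the fibre over \<open>x\<close> by the inverse transport, and transporting germs at \<open>y\<close> back
  along \<open>\<gamma> y\<close> identifies the given sheaf with the sheaf of this representation.
\<close>

section \<open>Paths in topological spaces\<close>

text \<open>The chosen paths reduce the fundamental groupoid to the group: closing a path up with
  them is multiplicative, so the universal cover never has to be built as a space. Two size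
  constraints shape the rest. Sections must be elements of \<open>'u\<close>, so functions on open
  sets are encoded by one injection \<open>enc\<close>, and identities between sections are checked
  on decoded values at points. The representation of a given sheaf must also live on
  \<open>'u\<close>, whereas germs are sets of pairs; its fibre over \<open>x\<close> is therefore
  realised as the sections over one fixed trivialising neighbourhood. The inverse in the action
  comes from the order of multiplication: a product of classes traverses the first loop first, while
  transports compose in the opposite order. The functor constructed explicitly goes from modules to
  sheaves. Since modules over the group ring and linear actions describe the same data, the
  geometric part only deals with actions.\<close>

definition is_path :: "'a::topological_space set \<Rightarrow> 'a \<Rightarrow> 'a \<Rightarrow> (real \<Rightarrow> 'a) \<Rightarrow> bool" where
  "is_path X y z p \<longleftrightarrow> path p \<and> path_image p \<subseteq> X \<and> pathstart p = y \<and> pathfinish p = z"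

lemma is_pathD:
  assumes "is_path X y z p"
  shows "path p" "path_image p \<subseteq> X" "pathstart p = y" "pathfinish p = z" "y \<in> X" "z \<in> X"
  using assms pathstart_in_path_image[of p] pathfinish_in_path_image[of p] unfolding is_path_def by auto

lemma is_path_in: "is_path X y z p \<Longrightarrow> t \<in> {0..1} \<Longrightarrow> p t \<in> X"
  unfolding is_path_def path_image_def by auto

lemma is_path_ends: "is_path X y z p \<Longrightarrow> p 0 = y" "is_path X y z p \<Longrightarrow> p 1 = z"
  unfolding is_path_def pathstart_def pathfinish_def by auto

lemma is_path_mono: "is_path X y z p \<Longrightarrow> X \<subseteq> Y \<Longrightarrow> is_path Y y z p"
  unfolding is_path_def by auto

lemma is_path_join: "is_path X y z p \<Longrightarrow> is_path X z w q \<Longrightarrow> is_path X y w (p +++ q)"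
  unfolding is_path_def by (auto simp: subset_path_image_join)

lemma is_path_reverse: "is_path X y z p \<Longrightarrow> is_path X z y (reversepath p)"
  unfolding is_path_def by auto

lemma is_path_const: "y \<in> X \<Longrightarrow> is_path X y y (\<lambda>t. y)"
  unfolding is_path_def path_def path_image_def pathstart_def pathfinish_def by auto

lemma is_path_comp:
  assumes "is_path S a b p" "continuous_on S h" "h \<in> S \<rightarrow> X"
  shows "is_path X (h a) (h b) (h \<circ> p)"
proof -
  have "continuous_on {0..1} (h \<circ> p)"
    by (rule continuous_on_compose)
       (use assms in \<open>auto simp: is_path_def path_def path_image_def intro: continuous_on_subset\<close>)
  then show ?thesis
    using assms unfolding is_path_def path_def path_image_def pathstart_def pathfinish_def by auto
qed

lemma path_connected_is_path: "path_connected U \<Longrightarrow> y \<in> U \<Longrightarrow> z \<in> U \<Longrightarrow> \<exists>p. is_path U y z p"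
  unfolding path_connected_def is_path_def by blast

lemma homotopic_is_path: "homotopic_paths X p q \<Longrightarrow> is_path X y z p \<longleftrightarrow> is_path X y z q"
  using homotopic_paths_imp_path homotopic_paths_imp_subset homotopic_paths_imp_pathstart
    homotopic_paths_imp_pathfinish unfolding is_path_def by metis

lemma homotopic_refl: "is_path X y z p \<Longrightarrow> homotopic_paths X p p"
  by (simp add: is_path_def)

lemma homotopic_join:
  assumes "is_path X y z p" "is_path X z w q" "homotopic_paths X p p'" "homotopic_paths X q q'"
  shows "homotopic_paths X (p +++ q) (p' +++ q')"
  by (rule homotopic_paths_join) (use assms in \<open>auto simp: is_path_def\<close>)

lemma joinpaths_comp: "h \<circ> (p +++ q) = (h \<circ> p) +++ (h \<circ> q)"
  by (auto simp: joinpaths_def)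

text \<open>
  The library states the groupoid laws of paths only in normed spaces, because it uses \<open>linepath\<close>
  for constant paths.  In general they are images of homotopies between paths in a convex set.
\<close>

lemma homotopic_paths_convex_image:
  fixes S :: "'b::real_normed_vector set"
  assumes S: "convex S" and h: "continuous_on S h" "h \<in> S \<rightarrow> X"
    and p: "is_path S a b p" and q: "is_path S a b q"
  shows "homotopic_paths X (h \<circ> p) (h \<circ> q)"
proof -
  have "simply_connected S" by (rule convex_imp_simply_connected[OF S])
  then have "homotopic_paths S p q"
    using p q unfolding simply_connected_eq_homotopic_paths is_path_def by metis
  then show ?thesis by (rule homotopic_paths_continuous_image[OF _ h])
qed

lemma is_path_linepath:
  fixes a b :: "'b::real_normed_vector"
  assumes "convex S" "a \<in> S" "b \<in> S" shows "is_path S a b (linepath a b)"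
  using assms closed_segment_subset unfolding is_path_def by auto

lemma is_path_eq_comp: 
  assumes "is_path X y z p"
  shows "continuous_on {0..1} p" "p \<in> {0..1} \<rightarrow> X" "p \<circ> linepath 0 1 = p"
  using assms unfolding is_path_def path_def path_image_def by (auto simp: linepath_def)

lemma is_path_subpath:
  assumes p: "is_path X y z p" and "s \<in> {0..1}" "t \<in> {0..1}"
  shows "is_path X (p s) (p t) (p \<circ> linepath s t)"
  by (rule is_path_comp[OF is_path_linepath[of "{0..1}" s t] is_path_eq_comp(1,2)[OF p]])
     (use assms in auto)

text \<open>Both sides are images under \<open>p\<close> of paths in the unit interval with the same
  ends, and the interval is convex. The parameters may coincide or decrease, so the unit laws and
  the inverse law are the cases (0,0,1), (0,1,1) and (0,1,0).\<close>

lemma homotopic_subpaths_join: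
  assumes p: "is_path X y z p" and stu: "s \<in> {0..1}" "t \<in> {0..1}" "u \<in> {0..1}"
  shows "homotopic_paths X ((p \<circ> linepath s t) +++ (p \<circ> linepath t u)) (p \<circ> linepath s u)"
  unfolding joinpaths_comp[symmetric]
  by (rule homotopic_paths_convex_image[of "{0..1}" _ _ s u, OF _ is_path_eq_comp(1,2)[OF p]])
     (use stu in \<open>auto intro!: is_path_join is_path_linepath\<close>)

lemma homotopic_const_join:
  assumes p: "is_path X y z p"
  shows "homotopic_paths X ((\<lambda>t. y) +++ p) p"
proof -
  have "homotopic_paths X ((p \<circ> linepath 0 0) +++ (p \<circ> linepath 0 1)) (p \<circ> linepath 0 1)"
    by (rule homotopic_subpaths_join[OF p]) auto
  moreover have "p \<circ> linepath 0 0 = (\<lambda>t. y)" using is_path_ends[OF p] by (auto simp: linepath_def)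
  ultimately show ?thesis using is_path_eq_comp(3)[OF p] by simp
qed

lemma homotopic_join_const:
  assumes p: "is_path X y z p"
  shows "homotopic_paths X (p +++ (\<lambda>t. z)) p"
proof -
  have "homotopic_paths X ((p \<circ> linepath 0 1) +++ (p \<circ> linepath 1 1)) (p \<circ> linepath 0 1)"
    by (rule homotopic_subpaths_join[OF p]) auto
  moreover have "p \<circ> linepath 1 1 = (\<lambda>t. z)" using is_path_ends[OF p] by (auto simp: linepath_def)
  ultimately show ?thesis using is_path_eq_comp(3)[OF p] by simp
qed

lemma reversepath_eq_comp: "reversepath p = p \<circ> linepath 1 0"
  by (auto simp: reversepath_def linepath_def)

lemma homotopic_join_reverse:
  assumes p: "is_path X y z p"
  shows "homotopic_paths X (p +++ reversepath p) (\<lambda>t. y)"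
proof -
  have "homotopic_paths X ((p \<circ> linepath 0 1) +++ (p \<circ> linepath 1 0)) (p \<circ> linepath 0 0)"
    by (rule homotopic_subpaths_join[OF p]) auto
  moreover have "p \<circ> linepath 0 0 = (\<lambda>t. y)" using is_path_ends[OF p] by (auto simp: linepath_def)
  ultimately show ?thesis using is_path_eq_comp(3)[OF p] by (simp add: reversepath_eq_comp)
qed

lemma homotopic_reverse_join:
  assumes p: "is_path X y z p"
  shows "homotopic_paths X (reversepath p +++ p) (\<lambda>t. z)"
  using homotopic_join_reverse[OF is_path_reverse[OF p]] by simp

text \<open>The definition of simple connectedness only provides a free homotopy \<open>h\<close>
  from \<open>p\<close> to the constant loop, under which the base point moves along a loop
  \<open>al\<close>. The boundary of the square shows that \<open>p\<close> is homotopic to the join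
  of \<open>al\<close>, a constant path and \<open>al\<close> reversed, which contracts.\<close>

lemma simply_connected_homotopic_paths:
  fixes S :: "'a::topological_space set"
  assumes S: "simply_connected S" and p: "is_path S y y p"
  shows "homotopic_paths S p (\<lambda>t. y)"
proof -
  let ?A = "{0..1::real} \<times> {0..1::real}"
  have "homotopic_loops S p (\<lambda>t. y)"
    by (rule S[unfolded simply_connected_def, rule_format])
       (use p is_path_const[OF is_pathD(5)[OF p]] in \<open>simp add: is_path_def\<close>)
  then obtain h where h: "continuous_on ?A h" "h \<in> ?A \<rightarrow> S"
    and h0: "\<And>t. t \<in> {0..1} \<Longrightarrow> h (0, t) = p t" and h1: "\<And>t. t \<in> {0..1} \<Longrightarrow> h (1, t) = y"
    and ends: "\<And>s. s \<in> {0..1} \<Longrightarrow> h (s, 1) = h (s, 0)"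
    unfolding homotopic_loops pathstart_def pathfinish_def o_def by blast
  have cA: "convex ?A" by (simp add: convex_Times)
  let ?l = "\<lambda>a b. linepath a b :: real \<Rightarrow> real \<times> real"
  have seg: "\<And>a b c d. a \<in> {0..1} \<Longrightarrow> b \<in> {0..1} \<Longrightarrow> c \<in> {0..1} \<Longrightarrow> d \<in> {0..1} \<Longrightarrow>
      is_path ?A (a, b) (c, d) (?l (a, b) (c, d))"
    by (intro is_path_linepath cA) auto
  \<comment> \<open>One side of the square against the other three; both run in the convex square
    between the same corners.\<close>
  have H: "homotopic_paths S (h \<circ> ?l (0,0) (0,1))
      (h \<circ> (?l (0,0) (1,0) +++ (?l (1,0) (1,1) +++ ?l (1,1) (0,1))))"
    by (rule homotopic_paths_convex_image[OF cA h]) (auto intro!: is_path_join seg)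
  define al where "al = h \<circ> ?l (0,0) (1,0)"
  have e1: "homotopic_paths S p (h \<circ> ?l (0,0) (0,1))"
    by (rule homotopic_paths_eq)
       (use is_pathD[OF p] h0 in \<open>auto simp: linepath_def\<close>)
  have pal: "is_path S y y al"
  proof -
    have "is_path S (h (0,0)) (h (1,0)) al"
      unfolding al_def by (rule is_path_comp[OF seg h]) auto
    then show ?thesis using h0[of 0] h1[of 0] is_path_ends[OF p] by simp
  qed
  \<comment> \<open>Every stage of a free homotopy is a closed loop (\<open>ends\<close>), so the
    side t = 1 is \<open>al\<close> as well, here traversed backwards.\<close>
  have "homotopic_paths S (h \<circ> ?l (1,1) (0,1)) (reversepath al)"
    by (rule homotopic_paths_eq)
       (use is_path_comp[OF seg h, of 1 1 0 1] ends in
         \<open>auto simp: al_def linepath_def reversepath_def is_path_def\<close>)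
  moreover have "homotopic_paths S (h \<circ> ?l (1,0) (1,1)) (\<lambda>t. y)"
    by (rule homotopic_paths_eq)
       (use is_path_comp[OF seg h, of 1 0 1 1] h1 in \<open>auto simp: linepath_def is_path_def\<close>)
  ultimately have "homotopic_paths S (al +++ ((h \<circ> ?l (1,0) (1,1)) +++ (h \<circ> ?l (1,1) (0,1))))
       (al +++ ((\<lambda>t. y) +++ reversepath al))"
    using pal h1[of 0] h1[of 1]
    using is_path_comp[OF seg h, of 1 0 1 1] is_path_comp[OF seg h, of 1 1 0 1] ends[of 0] ends[of 1]
      h0[of 0] h1[of 0] is_path_ends[OF p]
    by (intro homotopic_join[OF pal is_path_join[of S y y _ y]] homotopic_join[of S y y _ y]
         homotopic_refl[OF pal]) auto
  also have "homotopic_paths S (al +++ ((\<lambda>t. y) +++ reversepath al)) (al +++ reversepath al)"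
    using pal homotopic_const_join[OF is_path_reverse[OF pal]] is_pathD(5)[OF pal]
    by (intro homotopic_join[OF pal is_path_join[of S y y _ y]] homotopic_refl[OF pal])
       (auto intro: is_path_const is_path_reverse)
  also have "homotopic_paths S (al +++ reversepath al) (\<lambda>t. y)"
    by (rule homotopic_join_reverse[OF pal])
  finally have "homotopic_paths S (h \<circ> (?l (0,0) (1,0) +++ (?l (1,0) (1,1) +++ ?l (1,1) (0,1)))) (\<lambda>t. y)"
    unfolding joinpaths_comp al_def .
  then show ?thesis using H e1 homotopic_paths_trans by metis
qed

section \<open>The fundamental group\<close>

definition path_class :: "'a::topological_space set \<Rightarrow> (real \<Rightarrow> 'a) \<Rightarrow> (real \<Rightarrow> 'a) set" where
  "path_class X p = Collect (homotopic_paths X p)"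

lemma path_class_eqI: "homotopic_paths X p q \<Longrightarrow> path_class X p = path_class X q"
  unfolding path_class_def using homotopic_paths_sym homotopic_paths_trans by blast

lemma path_class_eq_iff: "is_path X y z p \<Longrightarrow> path_class X p = path_class X q \<longleftrightarrow> homotopic_paths X p q"
proof
  assume p: "is_path X y z p" and e: "path_class X p = path_class X q"
  have "p \<in> path_class X p" using p unfolding path_class_def is_path_def by auto
  then have "p \<in> path_class X q" using e by simp
  then show "homotopic_paths X p q" unfolding path_class_def using homotopic_paths_sym by auto
qed (rule path_class_eqI)

text \<open>The multiplication of the group is defined on arbitrary sets of paths and does not
  involve \<open>x\<close>. It therefore also computes the composition of classes of paths that are
  not loops, so that groupoid calculations can be written with it.\<close>

lemma path_class_mult:
  assumes "is_path X y z p" "is_path X z w q"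
  shows "path_class X p \<otimes>\<^bsub>fundamental_group X x\<^esub> path_class X q = path_class X (p +++ q)"
proof -
  have *: "path_class X (p' +++ q') = path_class X (p +++ q)"
    if "p' \<in> path_class X p" "q' \<in> path_class X q" for p' q'
    using that unfolding path_class_def[of X p] path_class_def[of X q]
    by (intro path_class_eqI[symmetric] homotopic_join[OF assms]) auto
  have "p \<in> path_class X p" "q \<in> path_class X q"
    using assms by (auto simp: path_class_def is_path_def)
  then have "(\<Union>p'\<in>path_class X p. \<Union>q'\<in>path_class X q. path_class X (p' +++ q')) = path_class X (p +++ q)"
    using * by blast
  then show ?thesis
    by (simp add: fundamental_group_def) (simp add: path_class_def)
qed

lemma path_class_assoc:
  assumes "is_path X a b p" "is_path X b c q" "is_path X c d r"
  shows "path_class X ((p +++ q) +++ r) = path_class X (p +++ (q +++ r))"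
  by (rule path_class_eqI, rule homotopic_paths_sym, rule homotopic_paths_assoc)
     (use assms in \<open>auto simp: is_path_def\<close>)

lemma fundamental_group_carrier:
  "carrier (fundamental_group X x) = path_class X ` {p. is_path X x x p}"
  by (auto simp: fundamental_group_def path_class_def is_path_def)

lemma fundamental_group_one: "\<one>\<^bsub>fundamental_group X x\<^esub> = path_class X (\<lambda>t. x)"
  by (auto simp: fundamental_group_def path_class_def)

lemma group_fundamental_group:
  fixes X :: "'a::topological_space set"
  assumes "x \<in> X" shows "group (fundamental_group X x)"
proof (rule groupI)
  let ?G = "fundamental_group X x"
  note simps = fundamental_group_carrier fundamental_group_one
  show "\<one>\<^bsub>?G\<^esub> \<in> carrier ?G" using is_path_const[OF assms] by (auto simp: simps)
  fix A assume "A \<in> carrier ?G"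
  then obtain p where A: "A = path_class X p" and p: "is_path X x x p" by (auto simp: simps)
  show "\<one>\<^bsub>?G\<^esub> \<otimes>\<^bsub>?G\<^esub> A = A"
    unfolding simps A path_class_mult[OF is_path_const[OF assms] p]
    by (rule path_class_eqI[OF homotopic_const_join[OF p]])
  show "\<exists>B\<in>carrier ?G. B \<otimes>\<^bsub>?G\<^esub> A = \<one>\<^bsub>?G\<^esub>"
  proof
    show "path_class X (reversepath p) \<in> carrier ?G" using is_path_reverse[OF p] by (auto simp: simps)
    show "path_class X (reversepath p) \<otimes>\<^bsub>?G\<^esub> A = \<one>\<^bsub>?G\<^esub>"
      unfolding simps A path_class_mult[OF is_path_reverse[OF p] p]
      by (rule path_class_eqI[OF homotopic_reverse_join[OF p]])
  qed
  fix B assume "B \<in> carrier ?G"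
  then obtain q where B: "B = path_class X q" and q: "is_path X x x q" by (auto simp: simps)
  show "A \<otimes>\<^bsub>?G\<^esub> B \<in> carrier ?G"
    using is_path_join[OF p q] by (auto simp: A B path_class_mult[OF p q] simps)
  fix C assume "C \<in> carrier ?G"
  then obtain r where C: "C = path_class X r" and r: "is_path X x x r" by (auto simp: simps)
  show "A \<otimes>\<^bsub>?G\<^esub> B \<otimes>\<^bsub>?G\<^esub> C = A \<otimes>\<^bsub>?G\<^esub> (B \<otimes>\<^bsub>?G\<^esub> C)"
    using p q r
    by (simp add: A B C path_class_mult[of X x x _ x] is_path_join[of X x x _ x] path_class_assoc[of X x x _ x _ x])
qed

section \<open>From paths to elements of the fundamental group\<close>

locale based_space =
  fixes X :: "'a::topological_space set" and x :: 'a
  assumes path_connected_X: "path_connected X" and x_in: "x \<in> X"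
begin

abbreviation "\<pi> \<equiv> fundamental_group X x"

sublocale pi: group \<pi> by (rule group_fundamental_group[OF x_in])

text \<open>The constant path at \<open>x\<close> itself ensures that \<open>hol\<close> sends a
  loop at \<open>x\<close> to its own class (\<open>hol_loop\<close>).\<close>

definition base_path :: "'a \<Rightarrow> real \<Rightarrow> 'a" where
  "base_path y = (if y = x then \<lambda>t. x else SOME p. is_path X x y p)"

lemma base_path: "y \<in> X \<Longrightarrow> is_path X x y (base_path y)"
  unfolding base_path_def
  using someI_ex[OF path_connected_is_path[OF path_connected_X x_in, of y]] is_path_const[OF x_in]
  by auto

text \<open>Holonomy: a functor from the fundamental groupoid of \<open>X\<close> to the group at
  \<open>x\<close>, obtained by closing a path up with the chosen paths to its ends. Through it a
  representation becomes a rule for moving values along arbitrary paths.\<close>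

definition hol :: "(real \<Rightarrow> 'a) \<Rightarrow> (real \<Rightarrow> 'a) set" where
  "hol p = path_class X (base_path (pathstart p) +++ (p +++ reversepath (base_path (pathfinish p))))"

lemma reverse_base_path: "y \<in> X \<Longrightarrow> is_path X y x (reversepath (base_path y))"
  by (rule is_path_reverse[OF base_path])

lemma hol_loop_path:
  assumes "is_path X y z p"
  shows "is_path X x x (base_path y +++ (p +++ reversepath (base_path z)))"
  using assms base_path is_pathD[OF assms] by (blast intro: is_path_join is_path_reverse)

lemma hol_eq: "is_path X y z p \<Longrightarrow>
    hol p = path_class X (base_path y +++ (p +++ reversepath (base_path z)))"
  by (auto simp: hol_def is_path_def)

lemma hol_in: "is_path X y z p \<Longrightarrow> hol p \<in> carrier \<pi>"
  using hol_loop_path hol_eq by (auto simp: fundamental_group_carrier)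

lemma hol_homotopic:
  assumes "homotopic_paths X p q" shows "hol p = hol q"
proof -
  define y z where "y = pathstart p" and "z = pathfinish p"
  have p: "is_path X y z p"
    using homotopic_paths_imp_path[OF assms] homotopic_paths_imp_subset[OF assms]
    by (auto simp: y_def z_def is_path_def)
  then have q: "is_path X y z q" using homotopic_is_path[OF assms] by simp
  have b: "is_path X x y (base_path y)" "is_path X z x (reversepath (base_path z))"
    by (rule base_path[OF is_pathD(5)[OF p]], rule reverse_base_path[OF is_pathD(6)[OF p]])
  show ?thesis unfolding hol_eq[OF p] hol_eq[OF q]
    by (intro path_class_eqI homotopic_join[OF b(1) is_path_join[OF p b(2)]]
          homotopic_join[OF p b(2)] homotopic_refl[OF b(1)] homotopic_refl[OF b(2)] assms)
qed

text \<open>Between the two closed-up loops the chosen path to \<open>z\<close> is run backwards and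
  then forwards, and this detour contracts. The chain of equations only moves parentheses until the
  detour stands alone.\<close>

lemma hol_join:
  assumes p: "is_path X y z p" and q: "is_path X z w q"
  shows "hol (p +++ q) = hol p \<otimes>\<^bsub>\<pi>\<^esub> hol q"
proof -
  define a b' b c where "a = base_path y" and "b' = reversepath (base_path z)" and "b = base_path z"
    and "c = reversepath (base_path w)"
  have a: "is_path X x y a" and b': "is_path X z x b'" and b: "is_path X x z b" and c: "is_path X w x c"
    using is_pathD(5,6)[OF p] is_pathD(6)[OF q] base_path reverse_base_path
    unfolding a_def b'_def b_def c_def by blast+
  have "hol p \<otimes>\<^bsub>\<pi>\<^esub> hol q = path_class X ((a +++ (p +++ b')) +++ (b +++ (q +++ c)))"
    unfolding hol_eq[OF p] hol_eq[OF q] a_def b'_def b_def c_def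
    by (rule path_class_mult[OF hol_loop_path[OF p] hol_loop_path[OF q]])
  also have "\<dots> = path_class X (a +++ ((p +++ b') +++ (b +++ (q +++ c))))"
    by (rule path_class_assoc[OF a is_path_join[OF p b'] is_path_join[OF b is_path_join[OF q c]]])
  also have "\<dots> = path_class X a \<otimes>\<^bsub>\<pi>\<^esub> path_class X ((p +++ b') +++ (b +++ (q +++ c)))"
    by (rule path_class_mult[symmetric, OF a is_path_join[OF is_path_join[OF p b'] is_path_join[OF b is_path_join[OF q c]]]])
  also have "path_class X ((p +++ b') +++ (b +++ (q +++ c))) = path_class X (p +++ (b' +++ (b +++ (q +++ c))))"
    by (rule path_class_assoc[OF p b' is_path_join[OF b is_path_join[OF q c]]])
  also have "\<dots> = path_class X p \<otimes>\<^bsub>\<pi>\<^esub> path_class X (b' +++ (b +++ (q +++ c)))"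
    by (rule path_class_mult[symmetric, OF p is_path_join[OF b' is_path_join[OF b is_path_join[OF q c]]]])
  also have "path_class X (b' +++ (b +++ (q +++ c))) = path_class X ((b' +++ b) +++ (q +++ c))"
    by (rule path_class_assoc[symmetric, OF b' b is_path_join[OF q c]])
  also have "\<dots> = path_class X (q +++ c)"
  proof (rule path_class_eqI)
    have "homotopic_paths X ((b' +++ b) +++ (q +++ c)) ((\<lambda>t. z) +++ (q +++ c))"
      using homotopic_reverse_join[OF b] homotopic_refl[OF is_path_join[OF q c]]
      unfolding b'_def b_def[symmetric]
      by (intro homotopic_join[OF is_path_join[OF is_path_reverse[OF b] b] is_path_join[OF q c]])
    then show "homotopic_paths X ((b' +++ b) +++ (q +++ c)) (q +++ c)"
      using homotopic_const_join[OF is_path_join[OF q c]] homotopic_paths_trans by blast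
  qed
  also have "path_class X p \<otimes>\<^bsub>\<pi>\<^esub> path_class X (q +++ c) = path_class X (p +++ (q +++ c))"
    by (rule path_class_mult[OF p is_path_join[OF q c]])
  also have "\<dots> = path_class X ((p +++ q) +++ c)"
    by (rule path_class_assoc[symmetric, OF p q c])
  also have "path_class X a \<otimes>\<^bsub>\<pi>\<^esub> path_class X ((p +++ q) +++ c) = path_class X (a +++ ((p +++ q) +++ c))"
    by (rule path_class_mult[OF a is_path_join[OF is_path_join[OF p q] c]])
  also have "\<dots> = hol (p +++ q)"
    unfolding hol_eq[OF is_path_join[OF p q]] a_def c_def ..
  finally show ?thesis by simp
qed

text \<open>A constant path is homotopic to its join with itself, and the only idempotent of a group
  is the unit.\<close>

lemma hol_const: "y \<in> X \<Longrightarrow> hol (\<lambda>t. y) = \<one>\<^bsub>\<pi>\<^esub>"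
proof -
  assume y: "y \<in> X"
  have c: "is_path X y y (\<lambda>t. y)" by (rule is_path_const[OF y])
  have "hol (\<lambda>t. y) \<otimes>\<^bsub>\<pi>\<^esub> hol (\<lambda>t. y) = hol (\<lambda>t. y)"
    using hol_join[OF c c] hol_homotopic[OF homotopic_const_join[OF c]] by simp
  then show ?thesis using hol_in[OF c] by (metis pi.r_cancel_one)
qed

lemma hol_reverse:
  assumes p: "is_path X y z p" shows "hol (reversepath p) = inv\<^bsub>\<pi>\<^esub> hol p"
proof -
  have "hol (reversepath p) \<otimes>\<^bsub>\<pi>\<^esub> hol p = \<one>\<^bsub>\<pi>\<^esub>"
    using hol_join[OF is_path_reverse[OF p] p] hol_homotopic[OF homotopic_reverse_join[OF p]]
      hol_const is_pathD[OF p] by simp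
  then show ?thesis
    using pi.inv_equality hol_in[OF p] hol_in[OF is_path_reverse[OF p]] by metis
qed

text \<open>Closing up adds a constant path at \<open>x\<close> and the path's own reverse.
  Consequently a family of maps of fibres that commutes with holonomy is the same map over every
  point; this is how a morphism of sheaves becomes a single map of modules in
  \<open>gmap_surj\<close>.\<close>

lemma hol_base_path:
  assumes y: "y \<in> X" shows "hol (base_path y) = \<one>\<^bsub>\<pi>\<^esub>"
proof -
  let ?b = "base_path y"
  have b: "is_path X x y ?b" by (rule base_path[OF y])
  have "hol ?b = path_class X ((\<lambda>t. x) +++ (?b +++ reversepath ?b))"
    using hol_eq[OF b] by (simp add: base_path_def)
  also have "\<dots> = path_class X (?b +++ reversepath ?b)"
    by (rule path_class_eqI[OF homotopic_const_join[OF is_path_join[OF b is_path_reverse[OF b]]]])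
  also have "\<dots> = \<one>\<^bsub>\<pi>\<^esub>"
    unfolding fundamental_group_one by (rule path_class_eqI[OF homotopic_join_reverse[OF b]])
  finally show ?thesis .
qed

lemma hol_loop:
  assumes p: "is_path X x x p" shows "hol p = path_class X p"
proof -
  have r: "reversepath (\<lambda>t. x) = (\<lambda>t. x)" by (auto simp: reversepath_def)
  have "hol p = path_class X ((\<lambda>t. x) +++ (p +++ (\<lambda>t. x)))"
    using hol_eq[OF p] by (simp add: base_path_def r)
  also have "\<dots> = path_class X (p +++ (\<lambda>t. x))"
    by (rule path_class_eqI[OF homotopic_const_join[OF is_path_join[OF p is_path_const[OF x_in]]]])
  also have "\<dots> = path_class X p"
    by (rule path_class_eqI[OF homotopic_join_const[OF p]])
  finally show ?thesis .
qed

text \<open>Together with \<open>hol_segment_join\<close> this makes relations between parameters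
  that are phrased with the holonomy of segments symmetric and transitive, as
  \<open>path_local_induct\<close> demands.\<close>

lemma hol_segment_reverse:
  assumes p: "is_path X y z p" and ab: "a \<in> {0..1}" "b \<in> {0..1}"
  shows "hol (p \<circ> linepath b a) = inv\<^bsub>\<pi>\<^esub> hol (p \<circ> linepath a b)"
proof -
  have "p \<circ> linepath b a = reversepath (p \<circ> linepath a b)"
    by (auto simp: reversepath_def linepath_def algebra_simps)
  then show ?thesis by (simp only: hol_reverse[OF is_path_subpath[OF p ab]])
qed

lemma hol_segment_join:
  assumes p: "is_path X y z p" and abc: "a \<in> {0..1}" "b \<in> {0..1}" "c \<in> {0..1}"
  shows "hol (p \<circ> linepath a c) = hol (p \<circ> linepath a b) \<otimes>\<^bsub>\<pi>\<^esub> hol (p \<circ> linepath b c)"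
  unfolding hol_join[OF is_path_subpath[OF p abc(1,2)] is_path_subpath[OF p abc(2,3)], symmetric]
  by (rule hol_homotopic[symmetric, OF homotopic_subpaths_join[OF p abc]])

lemma hol_surj:
  assumes "g \<in> carrier \<pi>" obtains p where "is_path X x x p" "hol p = g"
  using assms hol_loop by (auto simp: fundamental_group_carrier)

end

lemma abelian_group_cong:
  assumes M: "abelian_group M" and "carrier N = carrier M" "zero N = zero M" "add N = add M"
  shows "abelian_group N"
proof -
  interpret M: abelian_group M by (rule M)
  show ?thesis
  proof (rule abelian_groupI)
    fix m assume "m \<in> carrier N"
    then show "\<exists>n\<in>carrier N. n \<oplus>\<^bsub>N\<^esub> m = \<zero>\<^bsub>N\<^esub>"
      using M.l_neg[of m] M.a_inv_closed[of m] by (auto simp: assms(2-4))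
  qed (auto simp: assms(2-4) M.a_ac)
qed

section \<open>The group ring\<close>

locale group_ring_setup = R?: cring R + G: group G
  for R :: "('r, 'e) ring_scheme" (structure) and G :: "('g, 'f) monoid_scheme"
begin

abbreviation "RG \<equiv> group_ring R G"

definition supp :: "('g \<Rightarrow> 'r) \<Rightarrow> 'g set" where
  "supp f = {g \<in> carrier G. f g \<noteq> \<zero>}"

text \<open>The group ring element a g: scalars embed with g the unit, group elements with a =
  1.\<close>

definition monom :: "'r \<Rightarrow> 'g \<Rightarrow> 'g \<Rightarrow> 'r" where
  "monom a g = (\<lambda>k\<in>carrier G. if k = g then a else \<zero>)"

lemma RG_carrier: "f \<in> carrier RG \<longleftrightarrow> f \<in> carrier G \<rightarrow>\<^sub>E carrier R \<and> finite (supp f)"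
  by (simp add: group_ring_def supp_def)

lemma RG_closed: "f \<in> carrier RG \<Longrightarrow> g \<in> carrier G \<Longrightarrow> f g \<in> carrier R"
  unfolding RG_carrier by auto

lemma RG_fin: "f \<in> carrier RG \<Longrightarrow> finite (supp f)"
  unfolding RG_carrier by auto

lemma RG_eqI:
  assumes "f \<in> carrier RG" "h \<in> carrier RG" "\<And>k. k \<in> carrier G \<Longrightarrow> f k = h k" shows "f = h"
  using assms unfolding RG_carrier by (auto intro: PiE_ext)

lemma RG_zero: "k \<in> carrier G \<Longrightarrow> \<zero>\<^bsub>RG\<^esub> k = \<zero>"
  by (simp add: group_ring_def)

lemma RG_add: "k \<in> carrier G \<Longrightarrow> (f \<oplus>\<^bsub>RG\<^esub> h) k = f k \<oplus> h k"
  by (simp add: group_ring_def)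

lemma RG_mult_supp: "k \<in> carrier G \<Longrightarrow>
    (f \<otimes>\<^bsub>RG\<^esub> h) k = (\<Oplus>g\<in>supp f. f g \<otimes> h (inv\<^bsub>G\<^esub> g \<otimes>\<^bsub>G\<^esub> k))"
  by (simp add: group_ring_def supp_def)

lemma RG_one: "\<one>\<^bsub>RG\<^esub> = monom \<one> \<one>\<^bsub>G\<^esub>"
  by (simp add: group_ring_def monom_def)

lemma supp_sub: "supp f \<subseteq> carrier G" by (auto simp: supp_def)

lemma supp_in: "g \<in> supp f \<Longrightarrow> g \<in> carrier G" by (auto simp: supp_def)

lemma supp_add: "f \<in> carrier RG \<Longrightarrow> h \<in> carrier RG \<Longrightarrow> supp (f \<oplus>\<^bsub>RG\<^esub> h) \<subseteq> supp f \<union> supp h"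
  by (auto simp: supp_def RG_add)

lemma RG_zero_closed: "\<zero>\<^bsub>RG\<^esub> \<in> carrier RG"
  unfolding RG_carrier by (auto simp: group_ring_def supp_def)

lemma RG_add_closed: "f \<in> carrier RG \<Longrightarrow> h \<in> carrier RG \<Longrightarrow> f \<oplus>\<^bsub>RG\<^esub> h \<in> carrier RG"
  using finite_subset[OF supp_add] unfolding RG_carrier
  by (auto simp: group_ring_def)

lemma monom_closed: "a \<in> carrier R \<Longrightarrow> monom a g \<in> carrier RG"
  unfolding RG_carrier
  by (auto simp: monom_def supp_def intro: finite_subset[of _ "{g}"])

lemma monom_apply: "k \<in> carrier G \<Longrightarrow> monom a g k = (if k = g then a else \<zero>)"
  by (simp add: monom_def)

lemma supp_monom: "supp (monom a g) \<subseteq> {g}"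
  by (auto simp: supp_def monom_def)

lemma monom_add:
  "a \<in> carrier R \<Longrightarrow> b \<in> carrier R \<Longrightarrow> monom (a \<oplus> b) g = monom a g \<oplus>\<^bsub>RG\<^esub> monom b g"
  by (rule RG_eqI) (auto simp: monom_closed RG_add_closed RG_add monom_apply)

lemma abelian_group_RG: "abelian_group RG"
proof (rule abelian_groupI)
  fix f assume f: "f \<in> carrier RG"
  show "\<exists>h\<in>carrier RG. h \<oplus>\<^bsub>RG\<^esub> f = \<zero>\<^bsub>RG\<^esub>"
  proof
    let ?h = "\<lambda>k\<in>carrier G. \<ominus> f k"
    have "supp ?h \<subseteq> supp f" by (auto simp: supp_def)
    then show h: "?h \<in> carrier RG"
      using f finite_subset[of "supp ?h"] unfolding RG_carrier by auto
    show "?h \<oplus>\<^bsub>RG\<^esub> f = \<zero>\<^bsub>RG\<^esub>"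
      using f h by (intro RG_eqI) (auto simp: RG_add_closed RG_zero_closed RG_add RG_zero RG_closed l_neg)
  qed
qed (auto simp: RG_add_closed RG_zero_closed RG_add RG_zero RG_closed a_ac intro!: RG_eqI)

text \<open>Every element is a finite sum of monomials, by induction on a finite set containing the
  support. Identities that are additive in an argument thereby reduce to monomials.\<close>

lemma RG_induct [consumes 1, case_names zero monom add]:
  assumes f: "f \<in> carrier RG" and z: "P \<zero>\<^bsub>RG\<^esub>"
    and m: "\<And>a g. a \<in> carrier R \<Longrightarrow> g \<in> carrier G \<Longrightarrow> P (monom a g)"
    and s: "\<And>f h. f \<in> carrier RG \<Longrightarrow> h \<in> carrier RG \<Longrightarrow> P f \<Longrightarrow> P h \<Longrightarrow> P (f \<oplus>\<^bsub>RG\<^esub> h)"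
  shows "P f"
proof -
  have "\<forall>f\<in>carrier RG. supp f \<subseteq> S \<longrightarrow> P f" if "finite S" "S \<subseteq> carrier G" for S
    using that
  proof (induction S)
    case empty
    show ?case
    proof (intro ballI impI)
      fix f assume "f \<in> carrier RG" "supp f \<subseteq> {}"
      then have "f = \<zero>\<^bsub>RG\<^esub>"
        by (intro RG_eqI) (auto simp: RG_zero_closed RG_zero supp_def)
      then show "P f" using z by simp
    qed
  next
    case (insert g S)
    show ?case
    proof (intro ballI impI)
      fix f assume f: "f \<in> carrier RG" "supp f \<subseteq> insert g S"
      have g: "g \<in> carrier G" using insert by auto
      \<comment> \<open>Erasing the coefficient at \<open>g\<close> leaves an element supported in
        \<open>S\<close>; the missing part is the monomial with coefficient
        \<open>f g\<close>.\<close>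
      let ?f = "f(g := \<zero>)"
      have sub: "supp ?f \<subseteq> S" using f(2) by (auto simp: supp_def)
      have f': "?f \<in> carrier RG"
        using f(1) g finite_subset[OF sub insert(1)] unfolding RG_carrier by (auto simp: PiE_iff extensional_def)
      have "f = ?f \<oplus>\<^bsub>RG\<^esub> monom (f g) g"
        using f f' g by (intro RG_eqI) (auto simp: RG_add_closed monom_closed RG_add monom_apply RG_closed)
      moreover have "P (?f \<oplus>\<^bsub>RG\<^esub> monom (f g) g)"
        using insert.IH insert.prems f' sub g f by (intro s) (auto simp: monom_closed m RG_closed)
      ultimately show "P f" by simp
    qed
  qed
  from this[OF RG_fin[OF f] supp_sub] f show ?thesis by auto
qed

text \<open>Terms outside the support vanish, so the convolution may be summed over any finite index
  set containing it. Several elements can then share one index set.\<close>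

lemma RG_mult_S:
  assumes f: "f \<in> carrier RG" and h: "h \<in> carrier RG" and k: "k \<in> carrier G"
    and S: "finite S" "S \<subseteq> carrier G" "supp f \<subseteq> S"
  shows "(f \<otimes>\<^bsub>RG\<^esub> h) k = (\<Oplus>g\<in>S. f g \<otimes> h (inv\<^bsub>G\<^esub> g \<otimes>\<^bsub>G\<^esub> k))"
  unfolding RG_mult_supp[OF k]
proof (rule add.finprod_mono_neutral_cong_left)
  show "f i \<otimes> h (inv\<^bsub>G\<^esub> i \<otimes>\<^bsub>G\<^esub> k) = \<zero>" if "i \<in> S - supp f" for i
    using that S k h by (auto simp: supp_def RG_closed subset_iff)
  show "(\<lambda>g. f g \<otimes> h (inv\<^bsub>G\<^esub> g \<otimes>\<^bsub>G\<^esub> k)) \<in> S \<rightarrow> carrier R"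
    using f h k S(2) by (auto simp: RG_closed subset_iff)
qed (use S in auto)

lemma RG_mult_closed:
  assumes f: "f \<in> carrier RG" and h: "h \<in> carrier RG"
  shows "f \<otimes>\<^bsub>RG\<^esub> h \<in> carrier RG"
proof -
  have sf: "\<And>g. g \<in> supp f \<Longrightarrow> g \<in> carrier G" using supp_sub by blast
  have "supp (f \<otimes>\<^bsub>RG\<^esub> h) \<subseteq> (\<Union>g\<in>supp f. (\<lambda>g'. g \<otimes>\<^bsub>G\<^esub> g') ` supp h)"
  proof
    fix k assume k: "k \<in> supp (f \<otimes>\<^bsub>RG\<^esub> h)"
    then have kG: "k \<in> carrier G" by (auto simp: supp_def)
    have "\<exists>g\<in>supp f. f g \<otimes> h (inv\<^bsub>G\<^esub> g \<otimes>\<^bsub>G\<^esub> k) \<noteq> \<zero>"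
    proof (rule ccontr)
      assume "\<not> ?thesis"
      then have "(f \<otimes>\<^bsub>RG\<^esub> h) k = \<zero>"
        unfolding RG_mult_supp[OF kG] by (intro add.finprod_one_eqI) auto
      then show False using k by (simp add: supp_def)
    qed
    then obtain g where g: "g \<in> supp f" "f g \<otimes> h (inv\<^bsub>G\<^esub> g \<otimes>\<^bsub>G\<^esub> k) \<noteq> \<zero>" by blast
    have "h (inv\<^bsub>G\<^esub> g \<otimes>\<^bsub>G\<^esub> k) \<noteq> \<zero>"
    proof
      assume "h (inv\<^bsub>G\<^esub> g \<otimes>\<^bsub>G\<^esub> k) = \<zero>"
      with g(2) show False using RG_closed[OF f sf[OF g(1)]] by simp
    qed
    then have "inv\<^bsub>G\<^esub> g \<otimes>\<^bsub>G\<^esub> k \<in> supp h"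
      using kG sf[OF g(1)] by (simp add: supp_def)
    then have "g \<otimes>\<^bsub>G\<^esub> (inv\<^bsub>G\<^esub> g \<otimes>\<^bsub>G\<^esub> k) \<in> (\<Union>g\<in>supp f. (\<lambda>g'. g \<otimes>\<^bsub>G\<^esub> g') ` supp h)"
      using g(1) by blast
    moreover have "g \<otimes>\<^bsub>G\<^esub> (inv\<^bsub>G\<^esub> g \<otimes>\<^bsub>G\<^esub> k) = k"
      using kG sf[OF g(1)] by (simp add: G.m_assoc[symmetric])
    ultimately show "k \<in> (\<Union>g\<in>supp f. (\<lambda>g'. g \<otimes>\<^bsub>G\<^esub> g') ` supp h)" by simp
  qed
  then have "finite (supp (f \<otimes>\<^bsub>RG\<^esub> h))"
    by (rule finite_subset) (use f h RG_fin in auto)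
  moreover have "(f \<otimes>\<^bsub>RG\<^esub> h) k \<in> carrier R" if "k \<in> carrier G" for k
    unfolding RG_mult_supp[OF that] using f h sf that by (intro finsum_closed) (auto simp: RG_closed)
  ultimately show ?thesis unfolding RG_carrier by (auto simp: group_ring_def)
qed

lemma RG_l_distr:
  assumes f: "f \<in> carrier RG" and f': "f' \<in> carrier RG" and h: "h \<in> carrier RG"
  shows "(f \<oplus>\<^bsub>RG\<^esub> f') \<otimes>\<^bsub>RG\<^esub> h = f \<otimes>\<^bsub>RG\<^esub> h \<oplus>\<^bsub>RG\<^esub> f' \<otimes>\<^bsub>RG\<^esub> h"
proof (rule RG_eqI)
  \<comment> \<open>Cancellation may make the support of the sum smaller than the union, so all
    three products are summed over the union.\<close>
  let ?S = "supp f \<union> supp f'"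
  fix k assume k: "k \<in> carrier G"
  have S: "finite ?S" "?S \<subseteq> carrier G" using RG_fin f f' supp_sub by auto
  have "((f \<oplus>\<^bsub>RG\<^esub> f') \<otimes>\<^bsub>RG\<^esub> h) k = (\<Oplus>g\<in>?S. (f \<oplus>\<^bsub>RG\<^esub> f') g \<otimes> h (inv\<^bsub>G\<^esub> g \<otimes>\<^bsub>G\<^esub> k))"
    using RG_mult_S[OF RG_add_closed[OF f f'] h k S supp_add[OF f f']] .
  also have "\<dots> = (\<Oplus>g\<in>?S. f g \<otimes> h (inv\<^bsub>G\<^esub> g \<otimes>\<^bsub>G\<^esub> k) \<oplus> f' g \<otimes> h (inv\<^bsub>G\<^esub> g \<otimes>\<^bsub>G\<^esub> k))"
    using f f' h k by (intro finsum_cong') (auto simp: RG_add RG_closed l_distr dest!: supp_in)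
  also have "\<dots> = (f \<otimes>\<^bsub>RG\<^esub> h) k \<oplus> (f' \<otimes>\<^bsub>RG\<^esub> h) k"
    using f f' h k
    by (subst finsum_addf) (auto simp: RG_mult_S[OF f h k S] RG_mult_S[OF f' h k S] RG_closed dest!: supp_in)
  finally show "((f \<oplus>\<^bsub>RG\<^esub> f') \<otimes>\<^bsub>RG\<^esub> h) k = (f \<otimes>\<^bsub>RG\<^esub> h \<oplus>\<^bsub>RG\<^esub> f' \<otimes>\<^bsub>RG\<^esub> h) k"
    by (simp add: RG_add k)
qed (use assms in \<open>auto simp: RG_mult_closed RG_add_closed\<close>)

lemma RG_r_distr:
  assumes f: "f \<in> carrier RG" and h: "h \<in> carrier RG" and h': "h' \<in> carrier RG"
  shows "f \<otimes>\<^bsub>RG\<^esub> (h \<oplus>\<^bsub>RG\<^esub> h') = f \<otimes>\<^bsub>RG\<^esub> h \<oplus>\<^bsub>RG\<^esub> f \<otimes>\<^bsub>RG\<^esub> h'"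
proof (rule RG_eqI)
  fix k assume k: "k \<in> carrier G"
  have S': "\<And>g. g \<in> supp f \<Longrightarrow> g \<in> carrier G" using supp_sub by blast
  have "(f \<otimes>\<^bsub>RG\<^esub> (h \<oplus>\<^bsub>RG\<^esub> h')) k =
      (\<Oplus>g\<in>supp f. f g \<otimes> h (inv\<^bsub>G\<^esub> g \<otimes>\<^bsub>G\<^esub> k) \<oplus> f g \<otimes> h' (inv\<^bsub>G\<^esub> g \<otimes>\<^bsub>G\<^esub> k))"
    unfolding RG_mult_supp[OF k]
    using f h h' k S' by (intro finsum_cong') (auto simp: RG_add RG_closed r_distr)
  also have "\<dots> = (f \<otimes>\<^bsub>RG\<^esub> h) k \<oplus> (f \<otimes>\<^bsub>RG\<^esub> h') k"
    using f h h' k S' by (subst finsum_addf) (auto simp: RG_mult_supp RG_closed)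
  finally show "(f \<otimes>\<^bsub>RG\<^esub> (h \<oplus>\<^bsub>RG\<^esub> h')) k = (f \<otimes>\<^bsub>RG\<^esub> h \<oplus>\<^bsub>RG\<^esub> f \<otimes>\<^bsub>RG\<^esub> h') k"
    by (simp add: RG_add k)
qed (use assms in \<open>auto simp: RG_mult_closed RG_add_closed\<close>)

lemma monom_mult:
  assumes a: "a \<in> carrier R" and b: "b \<in> carrier R" and g: "g \<in> carrier G" and h: "h \<in> carrier G"
  shows "monom a g \<otimes>\<^bsub>RG\<^esub> monom b h = monom (a \<otimes> b) (g \<otimes>\<^bsub>G\<^esub> h)"
proof (rule RG_eqI)
  fix k assume k: "k \<in> carrier G"
  have "(monom a g \<otimes>\<^bsub>RG\<^esub> monom b h) k = a \<otimes> monom b h (inv\<^bsub>G\<^esub> g \<otimes>\<^bsub>G\<^esub> k)"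
  proof -
    have c: "monom b h (inv\<^bsub>G\<^esub> g \<otimes>\<^bsub>G\<^esub> k) \<in> carrier R"
      using RG_closed[OF monom_closed[OF b]] g k by simp
    have "(monom a g \<otimes>\<^bsub>RG\<^esub> monom b h) k = (\<Oplus>i\<in>{g}. monom a g i \<otimes> monom b h (inv\<^bsub>G\<^esub> i \<otimes>\<^bsub>G\<^esub> k))"
      by (rule RG_mult_S[OF monom_closed[OF a] monom_closed[OF b] k _ _ supp_monom]) (use g in auto)
    also have "\<dots> = monom a g g \<otimes> monom b h (inv\<^bsub>G\<^esub> g \<otimes>\<^bsub>G\<^esub> k)"
      using c g a by (subst finsum_insert) (auto simp: monom_apply)
    finally show ?thesis using g by (simp add: monom_apply[of g a g])
  qed
  also have "\<dots> = monom (a \<otimes> b) (g \<otimes>\<^bsub>G\<^esub> h) k"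
  proof -
    have "inv\<^bsub>G\<^esub> g \<otimes>\<^bsub>G\<^esub> k = h \<longleftrightarrow> k = g \<otimes>\<^bsub>G\<^esub> h"
      using g h k G.inv_solve_left by metis
    then show ?thesis using assms k by (simp add: monom_apply)
  qed
  finally show "(monom a g \<otimes>\<^bsub>RG\<^esub> monom b h) k = monom (a \<otimes> b) (g \<otimes>\<^bsub>G\<^esub> h) k" .
qed (use assms in \<open>auto simp: monom_closed RG_mult_closed\<close>)

text \<open>Both sides of the associative and unit laws are additive in every argument, so
  \<open>RG_induct\<close> applies to one argument after another. For monomials the laws are those
  of \<open>R\<close> and of the group.\<close>

lemma ring_RG: "ring RG"
proof -
  interpret A: abelian_group RG by (rule abelian_group_RG)
  note [simp] = RG_mult_closed monom_closed RG_l_distr RG_r_distr monom_mult RG_one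
  have zl: "\<zero>\<^bsub>RG\<^esub> \<otimes>\<^bsub>RG\<^esub> f = \<zero>\<^bsub>RG\<^esub>" if f: "f \<in> carrier RG" for f
  proof -
    have "\<zero>\<^bsub>RG\<^esub> \<otimes>\<^bsub>RG\<^esub> f \<oplus>\<^bsub>RG\<^esub> \<zero>\<^bsub>RG\<^esub> \<otimes>\<^bsub>RG\<^esub> f = \<zero>\<^bsub>RG\<^esub> \<otimes>\<^bsub>RG\<^esub> f"
      using RG_l_distr[of "\<zero>\<^bsub>RG\<^esub>" "\<zero>\<^bsub>RG\<^esub>" f] f by simp
    then show ?thesis using A.add.l_cancel_one f by (metis A.zero_closed RG_mult_closed)
  qed
  have zr: "f \<otimes>\<^bsub>RG\<^esub> \<zero>\<^bsub>RG\<^esub> = \<zero>\<^bsub>RG\<^esub>" if f: "f \<in> carrier RG" for f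
  proof -
    have "f \<otimes>\<^bsub>RG\<^esub> \<zero>\<^bsub>RG\<^esub> \<oplus>\<^bsub>RG\<^esub> f \<otimes>\<^bsub>RG\<^esub> \<zero>\<^bsub>RG\<^esub> = f \<otimes>\<^bsub>RG\<^esub> \<zero>\<^bsub>RG\<^esub>"
      using RG_r_distr[of f "\<zero>\<^bsub>RG\<^esub>" "\<zero>\<^bsub>RG\<^esub>"] f by simp
    then show ?thesis using A.add.l_cancel_one f by (metis A.zero_closed RG_mult_closed)
  qed
  note [simp] = zl zr
  \<comment> \<open>Associativity with two monomial factors on the left; \<open>mon2\<close> and
    \<open>assoc\<close> then free the middle factor and the first one.\<close>
  have mon3: "monom a g \<otimes>\<^bsub>RG\<^esub> monom b h \<otimes>\<^bsub>RG\<^esub> l = monom a g \<otimes>\<^bsub>RG\<^esub> (monom b h \<otimes>\<^bsub>RG\<^esub> l)"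
    if "a \<in> carrier R" "b \<in> carrier R" "g \<in> carrier G" "h \<in> carrier G" "l \<in> carrier RG" for a b g h l
    using that(5)
  proof (induction l rule: RG_induct)
    case zero then show ?case using that by simp
  next
    case (monom c k) then show ?case using that by (simp add: m_assoc G.m_assoc)
  next
    case (add u v) then show ?case using that by (simp del: monom_mult)
  qed
  have mon2: "monom a g \<otimes>\<^bsub>RG\<^esub> f \<otimes>\<^bsub>RG\<^esub> l = monom a g \<otimes>\<^bsub>RG\<^esub> (f \<otimes>\<^bsub>RG\<^esub> l)"
    if "a \<in> carrier R" "g \<in> carrier G" "f \<in> carrier RG" "l \<in> carrier RG" for a g f l
    using that(3) by (induction f rule: RG_induct) (use that mon3 in auto)
  have assoc: "f \<otimes>\<^bsub>RG\<^esub> h \<otimes>\<^bsub>RG\<^esub> l = f \<otimes>\<^bsub>RG\<^esub> (h \<otimes>\<^bsub>RG\<^esub> l)"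
    if "f \<in> carrier RG" "h \<in> carrier RG" "l \<in> carrier RG" for f h l
    using that(1) by (induction f rule: RG_induct) (use that mon2 in auto)
  have onel: "monom \<one> \<one>\<^bsub>G\<^esub> \<otimes>\<^bsub>RG\<^esub> f = f" if "f \<in> carrier RG" for f
    using that by (induction f rule: RG_induct) auto
  have oner: "f \<otimes>\<^bsub>RG\<^esub> monom \<one> \<one>\<^bsub>G\<^esub> = f" if "f \<in> carrier RG" for f
    using that by (induction f rule: RG_induct) auto
  show ?thesis
    by (rule ringI[OF abelian_group_RG monoidI]) (auto simp: assoc onel oner)
qed

section \<open>Modules over the group ring and linear actions on \<open>R\<close>-modules\<close>

definition restr :: "('g \<Rightarrow> 'r, 'u) module \<Rightarrow> ('r, 'u) module" where
  "restr M = \<lparr>carrier = carrier M, mult = mult M, one = one M, zero = zero M, add = add M,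
     smult = (\<lambda>a m. monom a \<one>\<^bsub>G\<^esub> \<odot>\<^bsub>M\<^esub> m)\<rparr>"

definition gact :: "('g \<Rightarrow> 'r, 'u) module \<Rightarrow> 'g \<Rightarrow> 'u \<Rightarrow> 'u" where
  "gact M g m = monom \<one> g \<odot>\<^bsub>M\<^esub> m"

lemma restr_simps [simp]:
  "carrier (restr M) = carrier M" "zero (restr M) = zero M" "add (restr M) = add M"
  "a \<odot>\<^bsub>restr M\<^esub> m = monom a \<one>\<^bsub>G\<^esub> \<odot>\<^bsub>M\<^esub> m"
  by (simp_all add: restr_def)

end

locale group_rep = group_ring_setup R G
  for R :: "('r, 'e) ring_scheme" (structure) and G :: "('g, 'f) monoid_scheme" +
  fixes P :: "('r, 'u) module" and act :: "'g \<Rightarrow> 'u \<Rightarrow> 'u"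
  assumes mod: "Module.module R P"
    and act_closed: "g \<in> carrier G \<Longrightarrow> m \<in> carrier P \<Longrightarrow> act g m \<in> carrier P"
    and act_add: "g \<in> carrier G \<Longrightarrow> m \<in> carrier P \<Longrightarrow> n \<in> carrier P \<Longrightarrow>
                    act g (m \<oplus>\<^bsub>P\<^esub> n) = act g m \<oplus>\<^bsub>P\<^esub> act g n"
    and act_smult: "g \<in> carrier G \<Longrightarrow> a \<in> carrier R \<Longrightarrow> m \<in> carrier P \<Longrightarrow>
                    act g (a \<odot>\<^bsub>P\<^esub> m) = a \<odot>\<^bsub>P\<^esub> act g m"
    and act_one: "m \<in> carrier P \<Longrightarrow> act \<one>\<^bsub>G\<^esub> m = m"
    and act_mult: "g \<in> carrier G \<Longrightarrow> h \<in> carrier G \<Longrightarrow> m \<in> carrier P \<Longrightarrow>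
                    act (g \<otimes>\<^bsub>G\<^esub> h) m = act g (act h m)"
begin

sublocale P: Module.module R P by (rule mod)

lemma act_inv: "g \<in> carrier G \<Longrightarrow> m \<in> carrier P \<Longrightarrow> act (inv\<^bsub>G\<^esub> g) (act g m) = m"
  by (simp add: act_mult[symmetric] act_one)

lemma act_inv': "g \<in> carrier G \<Longrightarrow> m \<in> carrier P \<Longrightarrow> act g (act (inv\<^bsub>G\<^esub> g) m) = m"
  by (simp add: act_mult[symmetric] act_one)

text \<open>Linear extension of the action, inverse to passing to \<open>restr\<close> and
  \<open>gact\<close>. The group may be infinite, hence the sum over the support. Carrier, zero and
  addition are those of \<open>P\<close>.\<close>

definition extend :: "('g \<Rightarrow> 'r, 'u) module" where
  "extend = \<lparr>carrier = carrier P, mult = mult P, one = one P, zero = zero P, add = add P,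
     smult = (\<lambda>f m. \<Oplus>\<^bsub>P\<^esub>g\<in>supp f. f g \<odot>\<^bsub>P\<^esub> act g m)\<rparr>"

lemma extend_simps [simp]:
  "carrier extend = carrier P" "zero extend = zero P" "add extend = add P"
  by (simp_all add: extend_def)

lemma extend_smult:
  assumes f: "f \<in> carrier RG" and m: "m \<in> carrier P"
    and S: "finite S" "S \<subseteq> carrier G" "supp f \<subseteq> S"
  shows "f \<odot>\<^bsub>extend\<^esub> m = (\<Oplus>\<^bsub>P\<^esub>g\<in>S. f g \<odot>\<^bsub>P\<^esub> act g m)"
proof -
  have "(\<Oplus>\<^bsub>P\<^esub>g\<in>supp f. f g \<odot>\<^bsub>P\<^esub> act g m) = (\<Oplus>\<^bsub>P\<^esub>g\<in>S. f g \<odot>\<^bsub>P\<^esub> act g m)"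
  proof (rule P.add.finprod_mono_neutral_cong_left)
    show "f g \<odot>\<^bsub>P\<^esub> act g m = \<zero>\<^bsub>P\<^esub>" if "g \<in> S - supp f" for g
    proof -
      have "g \<in> carrier G" "f g = \<zero>" using that S by (auto simp: supp_def)
      then show ?thesis using act_closed[of g m] m P.smult_l_null by simp
    qed
    show "(\<lambda>g. f g \<odot>\<^bsub>P\<^esub> act g m) \<in> S \<rightarrow> carrier P"
      using S(2) m f by (auto simp: act_closed RG_closed subset_iff)
  qed (use S in auto)
  then show ?thesis by (simp add: extend_def)
qed

lemma extend_closed:
  assumes f: "f \<in> carrier RG" and m: "m \<in> carrier P"
  shows "f \<odot>\<^bsub>extend\<^esub> m \<in> carrier P"
  unfolding extend_smult[OF f m RG_fin[OF f] supp_sub subset_refl]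
  by (intro P.finsum_closed) (use f m in \<open>auto simp: act_closed RG_closed dest: supp_in\<close>)

lemma extend_monom:
  assumes a: "a \<in> carrier R" and g: "g \<in> carrier G" and m: "m \<in> carrier P"
  shows "monom a g \<odot>\<^bsub>extend\<^esub> m = a \<odot>\<^bsub>P\<^esub> act g m"
proof -
  have "monom a g \<odot>\<^bsub>extend\<^esub> m = (\<Oplus>\<^bsub>P\<^esub>i\<in>{g}. monom a g i \<odot>\<^bsub>P\<^esub> act i m)"
    by (rule extend_smult[OF monom_closed[OF a] m _ _ supp_monom]) (use g in auto)
  also have "\<dots> = monom a g g \<odot>\<^bsub>P\<^esub> act g m"
    using a g m act_closed[OF g m] by (subst P.finsum_insert) (auto simp: monom_apply)
  finally show ?thesis using g by (simp add: monom_apply)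
qed

lemma extend_add_right:
  assumes f: "f \<in> carrier RG" and m: "m \<in> carrier P" and n: "n \<in> carrier P"
  shows "f \<odot>\<^bsub>extend\<^esub> (m \<oplus>\<^bsub>P\<^esub> n) = f \<odot>\<^bsub>extend\<^esub> m \<oplus>\<^bsub>P\<^esub> f \<odot>\<^bsub>extend\<^esub> n"
proof -
  have "f \<odot>\<^bsub>extend\<^esub> (m \<oplus>\<^bsub>P\<^esub> n) = (\<Oplus>\<^bsub>P\<^esub>g\<in>supp f. f g \<odot>\<^bsub>P\<^esub> act g m \<oplus>\<^bsub>P\<^esub> f g \<odot>\<^bsub>P\<^esub> act g n)"
    unfolding extend_smult[OF f P.add.m_closed[OF m n] RG_fin[OF f] supp_sub subset_refl]
    using f m n by (intro P.finsum_cong') (auto simp: act_add act_closed RG_closed P.smult_r_distr dest!: supp_in)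
  also have "\<dots> = f \<odot>\<^bsub>extend\<^esub> m \<oplus>\<^bsub>P\<^esub> f \<odot>\<^bsub>extend\<^esub> n"
    unfolding extend_smult[OF f m RG_fin[OF f] supp_sub subset_refl]
      extend_smult[OF f n RG_fin[OF f] supp_sub subset_refl]
    using f m n by (intro P.finsum_addf) (auto simp: act_closed RG_closed dest!: supp_in)
  finally show ?thesis .
qed

lemma extend_add_left:
  assumes f: "f \<in> carrier RG" and h: "h \<in> carrier RG" and m: "m \<in> carrier P"
  shows "(f \<oplus>\<^bsub>RG\<^esub> h) \<odot>\<^bsub>extend\<^esub> m = f \<odot>\<^bsub>extend\<^esub> m \<oplus>\<^bsub>P\<^esub> h \<odot>\<^bsub>extend\<^esub> m"
proof -
  let ?S = "supp f \<union> supp h"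
  have S: "finite ?S" "?S \<subseteq> carrier G" using RG_fin f h supp_sub by auto
  have "(f \<oplus>\<^bsub>RG\<^esub> h) \<odot>\<^bsub>extend\<^esub> m = (\<Oplus>\<^bsub>P\<^esub>g\<in>?S. f g \<odot>\<^bsub>P\<^esub> act g m \<oplus>\<^bsub>P\<^esub> h g \<odot>\<^bsub>P\<^esub> act g m)"
    unfolding extend_smult[OF RG_add_closed[OF f h] m S supp_add[OF f h]]
    using f h m by (intro P.finsum_cong') (auto simp: RG_add act_closed RG_closed P.smult_l_distr dest!: supp_in)
  also have "\<dots> = f \<odot>\<^bsub>extend\<^esub> m \<oplus>\<^bsub>P\<^esub> h \<odot>\<^bsub>extend\<^esub> m"
    unfolding extend_smult[OF f m S Un_upper1] extend_smult[OF h m S Un_upper2]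
    using f h m by (intro P.finsum_addf) (auto simp: act_closed RG_closed dest!: supp_in)
  finally show ?thesis .
qed

text \<open>Associativity is the only axiom with content. It is checked by \<open>RG_induct\<close>,
  in the right factor for a monomial on the left (\<open>mon\<close>) and then in the left factor;
  on monomials it says that the action is linear and multiplicative.\<close>

lemma left_module_extend: "left_module RG extend"
proof -
  interpret A: ring RG by (rule ring_RG)
  have ag: "abelian_group extend"
    by (rule abelian_group_cong[OF P.abelian_group_axioms]) auto
  have zl: "\<zero>\<^bsub>RG\<^esub> \<odot>\<^bsub>extend\<^esub> m = \<zero>\<^bsub>P\<^esub>" if m: "m \<in> carrier P" for m
    using extend_smult[OF A.zero_closed m, of "{}"] by (auto simp: supp_def RG_zero)
  have mon_zr: "monom a g \<odot>\<^bsub>extend\<^esub> \<zero>\<^bsub>P\<^esub> = \<zero>\<^bsub>P\<^esub>" if "a \<in> carrier R" "g \<in> carrier G" for a g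
  proof -
    let ?z = "monom a g \<odot>\<^bsub>extend\<^esub> \<zero>\<^bsub>P\<^esub>"
    have c: "?z \<in> carrier P" by (rule extend_closed[OF monom_closed]) (use that in auto)
    have "?z \<oplus>\<^bsub>P\<^esub> ?z = ?z"
      using extend_add_right[OF monom_closed[OF that(1)] P.zero_closed P.zero_closed] by simp
    then show ?thesis using c P.add.l_cancel_one by (metis P.zero_closed)
  qed
  have mon: "(monom a g \<otimes>\<^bsub>RG\<^esub> h) \<odot>\<^bsub>extend\<^esub> m = monom a g \<odot>\<^bsub>extend\<^esub> (h \<odot>\<^bsub>extend\<^esub> m)"
    if a: "a \<in> carrier R" and g: "g \<in> carrier G" and h: "h \<in> carrier RG" and m: "m \<in> carrier P" for a g h m
    using h
  proof (induction h rule: RG_induct)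
    case zero then show ?case using a g m by (simp add: monom_closed zl mon_zr)
  next
    case (monom b k) then show ?case using a g m
      by (simp add: monom_mult extend_monom act_closed act_smult act_mult P.smult_assoc1)
  next
    case (add u v) then show ?case using a g m
      by (simp add: A.r_distr monom_closed extend_add_left extend_add_right extend_closed)
  qed
  have assoc: "(f \<otimes>\<^bsub>RG\<^esub> h) \<odot>\<^bsub>extend\<^esub> m = f \<odot>\<^bsub>extend\<^esub> (h \<odot>\<^bsub>extend\<^esub> m)"
    if f: "f \<in> carrier RG" and h: "h \<in> carrier RG" and m: "m \<in> carrier P" for f h m
    using f
  proof (induction f rule: RG_induct)
    case zero then show ?case using h m by (simp add: zl extend_closed)
  next
    case (monom b k) then show ?case using h m by (simp add: mon)
  next
    case (add u v) then show ?case using h m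
      by (simp add: A.l_distr extend_add_left extend_closed)
  qed
  show ?thesis
    by (intro left_module.intro ring_RG ag left_module_axioms.intro)
       (auto simp: extend_closed extend_add_left extend_add_right assoc RG_one extend_monom act_one)
qed

end

context group_ring_setup
begin

lemma group_rep_restr:
  assumes M: "left_module RG M" shows "group_rep R G (restr M) (gact M)"
proof -
  interpret M: left_module RG M by (rule M)
  have abelian: "abelian_group (restr M)"
    by (rule abelian_group_cong[OF M.abelian_group_axioms]) auto
  have m: "Module.module R (restr M)"
    by (rule moduleI[OF is_cring abelian])
       (auto simp: monom_closed M.smult_closed M.smult_l_distr M.smult_r_distr monom_add
          M.smult_assoc[symmetric] monom_mult RG_one[symmetric] M.smult_one)
  show ?thesis
    by (intro group_rep.intro group_rep_axioms.intro group_ring_setup_axioms m)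
       (auto simp: gact_def monom_closed M.smult_closed M.smult_r_distr
          M.smult_assoc[symmetric] monom_mult RG_one[symmetric] M.smult_one)
qed

text \<open>A monomial a g factors as (a 1)(1 g), so linearity over monomials splits into
  \<open>R\<close>-linearity and equivariance, and additivity does the rest. The arrows of the
  module category thus become the equivariant maps that the sheaf side produces.\<close>

lemma lin_maps_RG_iff:
  assumes M: "left_module RG M" and N: "left_module RG N"
  shows "f \<in> lin_maps RG M N \<longleftrightarrow> f \<in> lin_maps R (restr M) (restr N) \<and>
     (\<forall>g\<in>carrier G. \<forall>m\<in>carrier M. f (gact M g m) = gact N g (f m))"
proof
  assume "f \<in> lin_maps RG M N"
  then show "f \<in> lin_maps R (restr M) (restr N) \<and>
     (\<forall>g\<in>carrier G. \<forall>m\<in>carrier M. f (gact M g m) = gact N g (f m))"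
    by (auto simp: lin_maps_def gact_def monom_closed)
next
  interpret M: left_module RG M by (rule M)
  interpret N: left_module RG N by (rule N)
  assume f: "f \<in> lin_maps R (restr M) (restr N) \<and>
     (\<forall>g\<in>carrier G. \<forall>m\<in>carrier M. f (gact M g m) = gact N g (f m))"
  then have fc: "\<And>m. m \<in> carrier M \<Longrightarrow> f m \<in> carrier N"
    and fa: "\<And>m n. m \<in> carrier M \<Longrightarrow> n \<in> carrier M \<Longrightarrow> f (m \<oplus>\<^bsub>M\<^esub> n) = f m \<oplus>\<^bsub>N\<^esub> f n"
    by (auto simp: lin_maps_def)
  have fm: "f (monom a g \<odot>\<^bsub>M\<^esub> m) = monom a g \<odot>\<^bsub>N\<^esub> f m"
    if "a \<in> carrier R" "g \<in> carrier G" "m \<in> carrier M" for a g m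
  proof -
    have *: "monom a \<one>\<^bsub>G\<^esub> \<otimes>\<^bsub>RG\<^esub> monom \<one> g = monom a g" using that by (simp add: monom_mult)
    have "f (monom a g \<odot>\<^bsub>M\<^esub> m) = f (monom a \<one>\<^bsub>G\<^esub> \<odot>\<^bsub>M\<^esub> gact M g m)"
      unfolding *[symmetric] gact_def using that by (simp add: M.smult_assoc monom_closed)
    also have "\<dots> = monom a \<one>\<^bsub>G\<^esub> \<odot>\<^bsub>N\<^esub> f (gact M g m)"
      using f that by (simp add: lin_maps_def gact_def M.smult_closed monom_closed)
    also have "\<dots> = monom a \<one>\<^bsub>G\<^esub> \<odot>\<^bsub>N\<^esub> gact N g (f m)" using f that by simp
    also have "\<dots> = monom a g \<odot>\<^bsub>N\<^esub> f m"
      unfolding gact_def using that fc by (simp add: N.smult_assoc[symmetric] monom_closed *)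
    finally show ?thesis .
  qed
  \<comment> \<open>Zero is itself a monomial, so the zero case of the induction is an instance of
    \<open>fm\<close>.\<close>
  have zl: "\<zero>\<^bsub>RG\<^esub> = monom \<zero> \<one>\<^bsub>G\<^esub>"
    by (auto simp: monom_def group_ring_def)
  have "f (h \<odot>\<^bsub>M\<^esub> m) = h \<odot>\<^bsub>N\<^esub> f m" if h: "h \<in> carrier RG" and m: "m \<in> carrier M" for h m
    using h
  proof (induction h rule: RG_induct)
    case zero then show ?case unfolding zl using fm m by simp
  next
    case (monom b k) then show ?case using fm m by simp
  next
    case (add u v) then show ?case using m fa fc
      by (simp add: M.smult_l_distr N.smult_l_distr M.smult_closed)
  qed
  then show "f \<in> lin_maps RG M N" using f by (auto simp: lin_maps_def)
qed

end

section \<open>Equivalences of categories\<close>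

text \<open>Every object \<open>A\<close> of \<open>C\<close> gets a chosen \<open>Fo A\<close> and
  an isomorphism \<open>i A\<close> to \<open>Go (Fo A)\<close> with inverse \<open>j A\<close>.
  Arrows are conjugated with these and pulled back through the bijections \<open>Gm\<close>;
  equations in \<open>D\<close> are verified after applying \<open>Gm\<close>, which is
  faithful.\<close>

lemma equivalent_categories_fully_faithful:
  fixes C :: "('o, 'm) category" and D :: "('p, 'n) category"
  assumes C: "category C" and D: "category D" and G: "is_functor D C Go Gm"
    and ff: "\<And>M N. M \<in> Obj D \<Longrightarrow> N \<in> Obj D \<Longrightarrow>
              bij_betw (Gm M N) (Hom D M N) (Hom C (Go M) (Go N))"
    and es: "\<And>A. A \<in> Obj C \<Longrightarrow> \<exists>M\<in>Obj D. \<exists>i. is_iso C A (Go M) i"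
  shows "equivalent_categories C D"
proof -
  interpret C: category C by (rule C)
  interpret D: category D by (rule D)
  have Go: "\<And>M. M \<in> Obj D \<Longrightarrow> Go M \<in> Obj C"
    and Gm: "\<And>M N f. M \<in> Obj D \<Longrightarrow> N \<in> Obj D \<Longrightarrow> f \<in> Hom D M N \<Longrightarrow> Gm M N f \<in> Hom C (Go M) (Go N)"
    and Gid: "\<And>M. M \<in> Obj D \<Longrightarrow> Gm M M (Idt D M) = Idt C (Go M)"
    and Gcmp: "\<And>L M N f g. L \<in> Obj D \<Longrightarrow> M \<in> Obj D \<Longrightarrow> N \<in> Obj D \<Longrightarrow> f \<in> Hom D L M \<Longrightarrow> g \<in> Hom D M N \<Longrightarrow>
        Gm L N (Cmp D L M N g f) = Cmp C (Go L) (Go M) (Go N) (Gm M N g) (Gm L M f)"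
    using G unfolding is_functor_def by blast+
  have "\<forall>A\<in>Obj C. \<exists>M i j. M \<in> Obj D \<and> i \<in> Hom C A (Go M) \<and> j \<in> Hom C (Go M) A \<and>
      Cmp C A (Go M) A j i = Idt C A \<and> Cmp C (Go M) A (Go M) i j = Idt C (Go M)"
    using es unfolding is_iso_def by blast
  then obtain Fo i j where Fo: "\<And>A. A \<in> Obj C \<Longrightarrow> Fo A \<in> Obj D"
    and i: "\<And>A. A \<in> Obj C \<Longrightarrow> i A \<in> Hom C A (Go (Fo A))"
    and j: "\<And>A. A \<in> Obj C \<Longrightarrow> j A \<in> Hom C (Go (Fo A)) A"
    and ji: "\<And>A. A \<in> Obj C \<Longrightarrow> Cmp C A (Go (Fo A)) A (j A) (i A) = Idt C A"
    and ij: "\<And>A. A \<in> Obj C \<Longrightarrow> Cmp C (Go (Fo A)) A (Go (Fo A)) (i A) (j A) = Idt C (Go (Fo A))"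
    by metis
  define pre where "pre M N h = inv_into (Hom D M N) (Gm M N) h" for M N h
  have pre_in: "\<And>M N h. M \<in> Obj D \<Longrightarrow> N \<in> Obj D \<Longrightarrow> h \<in> Hom C (Go M) (Go N) \<Longrightarrow> pre M N h \<in> Hom D M N"
    and Ginv: "\<And>M N h. M \<in> Obj D \<Longrightarrow> N \<in> Obj D \<Longrightarrow> h \<in> Hom C (Go M) (Go N) \<Longrightarrow> Gm M N (pre M N h) = h"
    unfolding pre_def using ff by (auto simp: bij_betw_def intro: inv_into_into f_inv_into_f)
  have Ginj: "f = g" if "M \<in> Obj D" "N \<in> Obj D" "f \<in> Hom D M N" "g \<in> Hom D M N" "Gm M N f = Gm M N g" for M N f g
    using ff[OF that(1,2)] that(3-5) unfolding bij_betw_def inj_on_def by blast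
  \<comment> \<open>\<open>f\<close> conjugated by the chosen isomorphisms: the arrow that
    \<open>Gm\<close> has to assign to \<open>Fm A B f\<close>.\<close>
  define K where "K A B f = Cmp C (Go (Fo A)) B (Go (Fo B)) (i B) (Cmp C (Go (Fo A)) A B f (j A))" for A B f
  define Fm where "Fm A B f = pre (Fo A) (Fo B) (K A B f)" for A B f
  have K: "K A B f \<in> Hom C (Go (Fo A)) (Go (Fo B))" if "A \<in> Obj C" "B \<in> Obj C" "f \<in> Hom C A B" for A B f
    unfolding K_def using that by (intro C.Cmp_in Go Fo i j)
  have Fm: "Fm A B f \<in> Hom D (Fo A) (Fo B)" and GFm: "Gm (Fo A) (Fo B) (Fm A B f) = K A B f"
    if "A \<in> Obj C" "B \<in> Obj C" "f \<in> Hom C A B" for A B f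
    unfolding Fm_def using that by (auto intro!: pre_in Ginv Fo K)
  have K_i: "Cmp C A (Go (Fo A)) (Go (Fo B)) (K A B f) (i A) = Cmp C A B (Go (Fo B)) (i B) f"
    if "A \<in> Obj C" "B \<in> Obj C" "f \<in> Hom C A B" for A B f
  proof -
    have "Cmp C A (Go (Fo A)) (Go (Fo B)) (K A B f) (i A) =
        Cmp C A B (Go (Fo B)) (i B) (Cmp C A (Go (Fo A)) B (Cmp C (Go (Fo A)) A B f (j A)) (i A))"
      unfolding K_def using that by (intro C.Cmp_assoc[symmetric]) (auto intro!: C.Cmp_in Go Fo i j)
    also have "Cmp C A (Go (Fo A)) B (Cmp C (Go (Fo A)) A B f (j A)) (i A) = f"
      using that C.Cmp_assoc[of A "Go (Fo A)" A B "i A" "j A" f]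
      by (simp add: Go Fo i j ji C.Idt_right)
    finally show ?thesis .
  qed
  have j_K: "Cmp C (Go (Fo A)) (Go (Fo B)) B (j B) (K A B f) = Cmp C (Go (Fo A)) A B f (j A)"
    if "A \<in> Obj C" "B \<in> Obj C" "f \<in> Hom C A B" for A B f
    unfolding K_def
    using that C.Cmp_assoc[of "Go (Fo A)" B "Go (Fo B)" B "Cmp C (Go (Fo A)) A B f (j A)" "i B" "j B"]
    by (simp add: Go Fo i j ji C.Idt_left C.Cmp_in)
  have F: "is_functor C D Fo Fm"
    unfolding is_functor_def
  proof (intro conjI ballI)
    fix A assume A: "A \<in> Obj C"
    show "Fo A \<in> Obj D" by (rule Fo[OF A])
    have "Gm (Fo A) (Fo A) (Fm A A (Idt C A)) = Gm (Fo A) (Fo A) (Idt D (Fo A))"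
      using A by (simp add: GFm C.Idt_in K_def C.Idt_left Go Fo j ij Gid)
    then show "Fm A A (Idt C A) = Idt D (Fo A)"
      using A by (auto intro!: Ginj Fo Fm C.Idt_in D.Idt_in)
  next
    fix A B f assume "A \<in> Obj C" "B \<in> Obj C" "f \<in> Hom C A B"
    then show "Fm A B f \<in> Hom D (Fo A) (Fo B)" by (rule Fm)
  next
    fix A B E f g assume ABE: "A \<in> Obj C" "B \<in> Obj C" "E \<in> Obj C" and fg: "f \<in> Hom C A B" "g \<in> Hom C B E"
    have "K A E (Cmp C A B E g f) = Cmp C (Go (Fo A)) (Go (Fo B)) (Go (Fo E)) (K B E g) (K A B f)"
    proof -
      have "Cmp C (Go (Fo A)) (Go (Fo B)) (Go (Fo E)) (K B E g) (K A B f)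
          = Cmp C (Go (Fo A)) B (Go (Fo E)) (Cmp C B (Go (Fo B)) (Go (Fo E)) (K B E g) (i B)) (Cmp C (Go (Fo A)) A B f (j A))"
        unfolding K_def[of A B f] using ABE fg
        by (intro C.Cmp_assoc) (auto intro!: C.Cmp_in Go Fo i j K)
      also have "\<dots> = Cmp C (Go (Fo A)) B (Go (Fo E)) (Cmp C B E (Go (Fo E)) (i E) g) (Cmp C (Go (Fo A)) A B f (j A))"
        using ABE fg by (simp add: K_i)
      also have "\<dots> = Cmp C (Go (Fo A)) E (Go (Fo E)) (i E) (Cmp C (Go (Fo A)) B E g (Cmp C (Go (Fo A)) A B f (j A)))"
        using ABE fg by (intro C.Cmp_assoc[symmetric]) (auto intro!: C.Cmp_in Go Fo i j)
      also have "Cmp C (Go (Fo A)) B E g (Cmp C (Go (Fo A)) A B f (j A)) = Cmp C (Go (Fo A)) A E (Cmp C A B E g f) (j A)"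
        using ABE fg by (intro C.Cmp_assoc) (auto intro!: C.Cmp_in Go Fo i j)
      finally show ?thesis unfolding K_def[of A E] ..
    qed
    then have "Gm (Fo A) (Fo E) (Fm A E (Cmp C A B E g f)) =
        Gm (Fo A) (Fo E) (Cmp D (Fo A) (Fo B) (Fo E) (Fm B E g) (Fm A B f))"
      using ABE fg by (simp add: GFm C.Cmp_in Gcmp Fo Fm)
    then show "Fm A E (Cmp C A B E g f) = Cmp D (Fo A) (Fo B) (Fo E) (Fm B E g) (Fm A B f)"
      using ABE fg by (intro Ginj[of "Fo A" "Fo E"]) (auto intro!: Fo Fm C.Cmp_in D.Cmp_in)
  qed
  have eta: "natural_iso C C (\<lambda>A. A) (\<lambda>A B f. f) (\<lambda>A. Go (Fo A)) (\<lambda>A B f. Gm (Fo A) (Fo B) (Fm A B f)) i"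
    unfolding natural_iso_def is_iso_def using i j ij ji by (auto simp: GFm K_i intro!: bexI[of _ "j _"])
  \<comment> \<open>The counit at \<open>M\<close> and its inverse are lifts through
    \<open>Gm\<close> of \<open>j (Go M)\<close> and \<open>i (Go M)\<close>, arrows between
    \<open>Go (Fo (Go M))\<close> and \<open>Go M\<close>.\<close>
  define e where "e M = pre (Fo (Go M)) M (j (Go M))" for M
  define e' where "e' M = pre M (Fo (Go M)) (i (Go M))" for M
  have e: "e M \<in> Hom D (Fo (Go M)) M" "Gm (Fo (Go M)) M (e M) = j (Go M)"
    and e': "e' M \<in> Hom D M (Fo (Go M))" "Gm M (Fo (Go M)) (e' M) = i (Go M)"
    if "M \<in> Obj D" for M
    unfolding e_def e'_def using that by (auto intro!: pre_in Ginv Go Fo i j)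
  have ee': "Cmp D (Fo (Go M)) M (Fo (Go M)) (e' M) (e M) = Idt D (Fo (Go M))"
    "Cmp D M (Fo (Go M)) M (e M) (e' M) = Idt D M" if M: "M \<in> Obj D" for M
  proof -
    note [simp] = M Go Fo e e' Gcmp Gid ij ji
    show "Cmp D (Fo (Go M)) M (Fo (Go M)) (e' M) (e M) = Idt D (Fo (Go M))"
      by (rule Ginj[of "Fo (Go M)" "Fo (Go M)"]) (auto intro!: D.Cmp_in D.Idt_in)
    show "Cmp D M (Fo (Go M)) M (e M) (e' M) = Idt D M"
      by (rule Ginj[of M M]) (auto intro!: D.Cmp_in D.Idt_in)
  qed
  have nat: "Cmp D (Fo (Go A)) (Fo (Go B)) B (e B) (Fm (Go A) (Go B) (Gm A B f)) = Cmp D (Fo (Go A)) A B f (e A)"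
    if A: "A \<in> Obj D" and B: "B \<in> Obj D" and f: "f \<in> Hom D A B" for A B f
    by (rule Ginj[of "Fo (Go A)" B])
       (use A B f in \<open>simp_all add: D.Cmp_in Gcmp GFm j_K Go Fo Fm Gm e\<close>)
  have "natural_iso D D (\<lambda>A. Fo (Go A)) (\<lambda>A B f. Fm (Go A) (Go B) (Gm A B f)) (\<lambda>A. A) (\<lambda>A B f. f) e"
    unfolding natural_iso_def is_iso_def using e e' ee' nat by (auto intro!: bexI[of _ "e' _"])
  then show ?thesis
    unfolding equivalent_categories_def using C D F G eta by blast
qed

section \<open>Linear maps and the category of left modules\<close>

lemma compose_in_lin_maps:
  assumes "f \<in> lin_maps R L M" "g \<in> lin_maps R M N"
    and "\<And>s t. s \<in> carrier L \<Longrightarrow> t \<in> carrier L \<Longrightarrow> s \<oplus>\<^bsub>L\<^esub> t \<in> carrier L"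
    and "\<And>a s. a \<in> carrier R \<Longrightarrow> s \<in> carrier L \<Longrightarrow> a \<odot>\<^bsub>L\<^esub> s \<in> carrier L"
  shows "compose (carrier L) g f \<in> lin_maps R L N"
  using assms by (auto simp: lin_maps_def compose_def PiE_iff)

lemma lin_maps_fun: "f \<in> lin_maps R L M \<Longrightarrow> f \<in> carrier L \<rightarrow>\<^sub>E carrier M"
  by (auto simp: lin_maps_def)

lemma lin_maps_closed: "f \<in> lin_maps R L M \<Longrightarrow> s \<in> carrier L \<Longrightarrow> f s \<in> carrier M"
  by (auto simp: lin_maps_def)

lemma lin_maps_add: "f \<in> lin_maps R L M \<Longrightarrow> s \<in> carrier L \<Longrightarrow> t \<in> carrier L \<Longrightarrow> f (s \<oplus>\<^bsub>L\<^esub> t) = f s \<oplus>\<^bsub>M\<^esub> f t"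
  by (auto simp: lin_maps_def)

lemma lin_maps_smult: "f \<in> lin_maps R L M \<Longrightarrow> a \<in> carrier R \<Longrightarrow> s \<in> carrier L \<Longrightarrow> f (a \<odot>\<^bsub>L\<^esub> s) = a \<odot>\<^bsub>M\<^esub> f s"
  by (auto simp: lin_maps_def)

lemma id_in_lin_maps:
  assumes "\<And>s t. s \<in> carrier L \<Longrightarrow> t \<in> carrier L \<Longrightarrow> s \<oplus>\<^bsub>L\<^esub> t \<in> carrier L"
    and "\<And>a s. a \<in> carrier R \<Longrightarrow> s \<in> carrier L \<Longrightarrow> a \<odot>\<^bsub>L\<^esub> s \<in> carrier L"
  shows "(\<lambda>s\<in>carrier L. s) \<in> lin_maps R L L"
  using assms by (auto simp: lin_maps_def)

lemma compose_ext_id: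
  assumes "f \<in> A \<rightarrow>\<^sub>E B" shows "compose A f (\<lambda>s\<in>A. s) = f" "compose A (\<lambda>s\<in>B. s) f = f"
  using assms by (auto simp: compose_def PiE_iff extensional_def fun_eq_iff)

lemma compose_assoc_ext:
  assumes "f \<in> A \<rightarrow>\<^sub>E B" shows "compose A h (compose A g f) = compose A (compose B h g) f"
  using assms by (auto simp: compose_def PiE_iff fun_eq_iff)

lemma category_left_modules:
  fixes A :: "('r, 'e) ring_scheme"
  shows "category (left_module_category A :: (('r, 'u) module, 'u \<Rightarrow> 'u) category)"
proof -
  have cl: "s \<oplus>\<^bsub>M\<^esub> t \<in> carrier M"
    if "left_module A M" "s \<in> carrier M" "t \<in> carrier M" for M :: "('r, 'u) module" and s t
  proof -
    interpret M: left_module A M by (rule that)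
    show ?thesis using that by auto
  qed
  show ?thesis
    unfolding left_module_category_def
    by (rule category.intro; simp)
       (auto intro!: id_in_lin_maps compose_in_lin_maps compose_ext_id[OF lin_maps_fun]
         compose_assoc_ext[OF lin_maps_fun] dest: cl left_module.smult_closed)
qed

section \<open>Sheaves\<close>

lemma sheaf_homs_lin:
  "\<phi> \<in> sheaf_homs X R F G \<Longrightarrow> U \<in> opens X \<Longrightarrow> \<phi> U \<in> lin_maps R (sect F U) (sect G U)"
  by (auto simp: sheaf_homs_def)

lemma sheaf_homs_rstr:
  "\<phi> \<in> sheaf_homs X R F G \<Longrightarrow> U \<in> opens X \<Longrightarrow> V \<in> opens X \<Longrightarrow> V \<subseteq> U \<Longrightarrow> s \<in> carrier (sect F U) \<Longrightarrow>
     \<phi> V (rstr F U V s) = rstr G U V (\<phi> U s)"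
  by (auto simp: sheaf_homs_def)

lemma sheaf_homs_closed:
  "\<phi> \<in> sheaf_homs X R F G \<Longrightarrow> U \<in> opens X \<Longrightarrow> s \<in> carrier (sect F U) \<Longrightarrow> \<phi> U s \<in> carrier (sect G U)"
  by (blast intro: lin_maps_closed sheaf_homs_lin)

lemma sheaf_homs_eqI:
  assumes "\<phi> \<in> sheaf_homs X R F G" "\<psi> \<in> sheaf_homs X R F G"
    and "\<And>U s. U \<in> opens X \<Longrightarrow> s \<in> carrier (sect F U) \<Longrightarrow> \<phi> U s = \<psi> U s"
  shows "\<phi> = \<psi>"
proof (rule PiE_ext)
  show "\<phi> \<in> (\<Pi>\<^sub>E U\<in>opens X. lin_maps R (sect F U) (sect G U))" "\<psi> \<in> (\<Pi>\<^sub>E U\<in>opens X. lin_maps R (sect F U) (sect G U))"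
    using assms(1,2) by (simp_all add: sheaf_homs_def)
  fix U assume U: "U \<in> opens X"
  show "\<phi> U = \<psi> U"
    by (rule PiE_ext[OF lin_maps_fun lin_maps_fun])
       (use sheaf_homs_lin[OF assms(1) U] sheaf_homs_lin[OF assms(2) U] assms(3)[OF U] in auto)
qed

lemma (in presheaf_of_modules) sect_closed:
  assumes "U \<in> opens X" "s \<in> carrier (sect F U)" "t \<in> carrier (sect F U)"
  shows "s \<oplus>\<^bsub>sect F U\<^esub> t \<in> carrier (sect F U)"
    "a \<in> carrier R \<Longrightarrow> a \<odot>\<^bsub>sect F U\<^esub> s \<in> carrier (sect F U)"
proof -
  interpret M: Module.module R "sect F U" by (rule sect_module[OF assms(1)])
  show "s \<oplus>\<^bsub>sect F U\<^esub> t \<in> carrier (sect F U)"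
    "a \<in> carrier R \<Longrightarrow> a \<odot>\<^bsub>sect F U\<^esub> s \<in> carrier (sect F U)" using assms by auto
qed

lemma (in presheaf_of_modules) rstr_closed:
  "U \<in> opens X \<Longrightarrow> V \<in> opens X \<Longrightarrow> V \<subseteq> U \<Longrightarrow> s \<in> carrier (sect F U) \<Longrightarrow> rstr F U V s \<in> carrier (sect F V)"
  by (rule lin_maps_closed[OF rstr_linear])

lemma (in presheaf_of_modules) sheaf_id_in: "sheaf_id X F \<in> sheaf_homs X R F F"
  unfolding sheaf_homs_def sheaf_id_def
  by (auto intro!: id_in_lin_maps sect_closed simp: rstr_closed)

lemma (in presheaf_of_modules) sheaf_comp_in:
  assumes f: "\<phi> \<in> sheaf_homs X R F G" and g: "\<psi> \<in> sheaf_homs X R G H"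
  shows "sheaf_comp X F \<psi> \<phi> \<in> sheaf_homs X R F H"
  unfolding sheaf_homs_def sheaf_comp_def
proof (intro CollectI conjI PiE_I ballI impI)
  fix U assume U: "U \<in> opens X"
  then show "(\<lambda>U\<in>opens X. compose (carrier (sect F U)) (\<psi> U) (\<phi> U)) U \<in> lin_maps R (sect F U) (sect H U)"
    by (auto intro!: compose_in_lin_maps[OF sheaf_homs_lin[OF f U] sheaf_homs_lin[OF g U]] sect_closed[OF U])
  fix V s assume V: "V \<in> opens X" "V \<subseteq> U" "s \<in> carrier (sect F U)"
  show "(\<lambda>U\<in>opens X. compose (carrier (sect F U)) (\<psi> U) (\<phi> U)) V (rstr F U V s) =
       rstr H U V ((\<lambda>U\<in>opens X. compose (carrier (sect F U)) (\<psi> U) (\<phi> U)) U s)"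
    using U V rstr_closed[OF U V]
    by (simp add: compose_eq sheaf_homs_rstr[OF f U V] sheaf_homs_rstr[OF g U V(1,2)] sheaf_homs_closed[OF f])
qed (auto simp: sheaf_comp_def)

lemma sheaf_comp_apply:
  "U \<in> opens X \<Longrightarrow> s \<in> carrier (sect F U) \<Longrightarrow> sheaf_comp X F \<psi> \<phi> U s = \<psi> U (\<phi> U s)"
  by (simp add: sheaf_comp_def compose_eq)

lemma sheaf_id_apply: "U \<in> opens X \<Longrightarrow> s \<in> carrier (sect F U) \<Longrightarrow> sheaf_id X F U s = s"
  by (simp add: sheaf_id_def)

lemma category_locally_constant_sheaves:
  fixes X :: "'a::topological_space set" and R :: "('r, 'e) ring_scheme"
  shows "category (locally_constant_sheaf_category X R :: (('a, 'r, 'u) presheaf, 'a set \<Rightarrow> 'u \<Rightarrow> 'u) category)"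
proof -
  have p: "presheaf_of_modules X R F" if "locally_constant_sheaf X R F" for F :: "('a, 'r, 'u) presheaf"
    using that unfolding locally_constant_sheaf_def sheaf_of_modules_def by blast
  note ids = presheaf_of_modules.sheaf_id_in[OF p] and cmp = presheaf_of_modules.sheaf_comp_in[OF p]
  show ?thesis
    unfolding locally_constant_sheaf_category_def
  proof (rule category.intro; simp)
    fix A B :: "('a, 'r, 'u) presheaf" and f
    assume A: "locally_constant_sheaf X R A" and B: "locally_constant_sheaf X R B"
    show "sheaf_id X A \<in> sheaf_homs X R A A" by (rule ids[OF A])
    assume f: "f \<in> sheaf_homs X R A B"
    show "sheaf_comp X A f (sheaf_id X A) = f"
      by (rule sheaf_homs_eqI[OF cmp[OF A ids[OF A] f] f]) (simp add: sheaf_comp_apply sheaf_id_apply)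
    show "sheaf_comp X A (sheaf_id X B) f = f"
      by (rule sheaf_homs_eqI[OF cmp[OF A f ids[OF B]] f])
         (simp add: sheaf_comp_apply sheaf_id_apply sheaf_homs_closed[OF f])
    fix D E :: "('a, 'r, 'u) presheaf" and g h
    assume D: "locally_constant_sheaf X R D" and E: "locally_constant_sheaf X R E"
      and g: "g \<in> sheaf_homs X R B D"
    show "sheaf_comp X A g f \<in> sheaf_homs X R A D" by (rule cmp[OF A f g])
    assume h: "h \<in> sheaf_homs X R D E"
    show "sheaf_comp X A h (sheaf_comp X A g f) = sheaf_comp X A (sheaf_comp X B h g) f"
      by (rule sheaf_homs_eqI[OF cmp[OF A cmp[OF A f g] h] cmp[OF A f cmp[OF B g h]]])
         (simp add: sheaf_comp_apply sheaf_homs_closed[OF f])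
  qed
qed

text \<open>The inverse of a bijective morphism is automatically linear and compatible with
  restriction. Isomorphisms of sheaves can therefore be given as morphisms that are bijective over
  every open set.\<close>

lemma sheaf_iso_of_bij:
  fixes F :: "('a::topological_space, 'r, 'u) presheaf" and G :: "('a, 'r, 'v) presheaf"
  assumes F: "presheaf_of_modules X R F" and f: "\<phi> \<in> sheaf_homs X R F G"
    and bij: "\<And>U. U \<in> opens X \<Longrightarrow> bij_betw (\<phi> U) (carrier (sect F U)) (carrier (sect G U))"
  shows "\<exists>\<psi>\<in>sheaf_homs X R G F. sheaf_comp X F \<psi> \<phi> = sheaf_id X F \<and> sheaf_comp X G \<phi> \<psi> = sheaf_id X G"
proof -
  interpret F: presheaf_of_modules X R F by (rule F)
  define \<psi> where "\<psi> = (\<lambda>U\<in>opens X. \<lambda>t\<in>carrier (sect G U). inv_into (carrier (sect F U)) (\<phi> U) t)"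
  have in_F: "\<psi> U t \<in> carrier (sect F U)" and fp: "\<phi> U (\<psi> U t) = t" if "U \<in> opens X" "t \<in> carrier (sect G U)" for U t
    using bij[OF that(1)] that unfolding \<psi>_def bij_betw_def by (auto intro: inv_into_into f_inv_into_f)
  have pf: "\<psi> U (\<phi> U s) = s" if "U \<in> opens X" "s \<in> carrier (sect F U)" for U s
    using bij_betw_inv_into_left[OF bij[OF that(1)] that(2)] that sheaf_homs_closed[OF f that] by (simp add: \<psi>_def)
  have psi: "\<psi> \<in> sheaf_homs X R G F"
    unfolding sheaf_homs_def
  proof (intro CollectI conjI PiE_I ballI impI)
    fix U assume U: "U \<in> opens X"
    note lin = sheaf_homs_lin[OF f U]
    show "\<psi> U \<in> lin_maps R (sect G U) (sect F U)"
      unfolding lin_maps_def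
    proof (intro CollectI conjI PiE_I ballI)
      fix s assume s: "s \<in> carrier (sect G U)"
      show "\<psi> U s \<in> carrier (sect F U)" by (rule in_F[OF U s])
      fix t assume t: "t \<in> carrier (sect G U)"
      have "s \<oplus>\<^bsub>sect G U\<^esub> t = \<phi> U (\<psi> U s \<oplus>\<^bsub>sect F U\<^esub> \<psi> U t)"
        by (simp only: lin_maps_add[OF lin in_F[OF U s] in_F[OF U t]] fp[OF U s] fp[OF U t])
      then show "\<psi> U (s \<oplus>\<^bsub>sect G U\<^esub> t) = \<psi> U s \<oplus>\<^bsub>sect F U\<^esub> \<psi> U t"
        by (simp only: pf[OF U F.sect_closed(1)[OF U in_F[OF U s] in_F[OF U t]]])
    next
      fix a s assume a: "a \<in> carrier R" and s: "s \<in> carrier (sect G U)"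
      have "a \<odot>\<^bsub>sect G U\<^esub> s = \<phi> U (a \<odot>\<^bsub>sect F U\<^esub> \<psi> U s)"
        by (simp only: lin_maps_smult[OF lin a in_F[OF U s]] fp[OF U s])
      then show "\<psi> U (a \<odot>\<^bsub>sect G U\<^esub> s) = a \<odot>\<^bsub>sect F U\<^esub> \<psi> U s"
        by (simp only: pf[OF U F.sect_closed(2)[OF U in_F[OF U s] in_F[OF U s] a]])
    qed (use U in \<open>simp add: \<psi>_def\<close>)
    fix V t assume V: "V \<in> opens X" "V \<subseteq> U" and t: "t \<in> carrier (sect G U)"
    have "rstr G U V t = \<phi> V (rstr F U V (\<psi> U t))"
      by (simp only: sheaf_homs_rstr[OF f U V in_F[OF U t]] fp[OF U t])
    then show "\<psi> V (rstr G U V t) = rstr F U V (\<psi> U t)"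
      by (simp only: pf[OF V(1) F.rstr_closed[OF U V in_F[OF U t]]])
  qed (simp add: \<psi>_def)
  have "sheaf_comp X F \<psi> \<phi> = sheaf_id X F" "sheaf_comp X G \<phi> \<psi> = sheaf_id X G"
    unfolding sheaf_comp_def sheaf_id_def compose_def by (intro restrict_ext pf fp; assumption)+
  then show ?thesis using psi by blast
qed

section \<open>Open subsets, and connectedness arguments along paths\<close>

lemma opens_sub: "U \<in> opens X \<Longrightarrow> U \<subseteq> X"
  by (auto dest: openin_imp_subset)

lemma opens_trans: "V \<in> opens U \<Longrightarrow> U \<in> opens X \<Longrightarrow> V \<in> opens X"
  using openin_trans by blast

lemma opens_restrict: "V \<in> opens X \<Longrightarrow> V \<subseteq> U \<Longrightarrow> U \<subseteq> X \<Longrightarrow> V \<in> opens U"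
  using openin_subset_trans by auto

lemma opens_Int: "U \<in> opens X \<Longrightarrow> V \<in> opens X \<Longrightarrow> U \<inter> V \<in> opens X"
  by auto

lemma opens_Union: "\<U> \<subseteq> opens X \<Longrightarrow> \<Union>\<U> \<in> opens X"
  by auto

lemma interval_nbhd:
  fixes p :: "real \<Rightarrow> 'a::topological_space"
  assumes p: "continuous_on {0..1} p" "p ` {0..1} \<subseteq> X" and U: "U \<in> opens X" and a: "a \<in> {0..1}" "p a \<in> U"
  obtains d where "d > 0" "\<And>r. r \<in> {0..1} \<Longrightarrow> r \<in> ball a d \<Longrightarrow> p r \<in> U"
proof -
  have "openin (top_of_set {0..1}) ({0..1} \<inter> p -` U)"
    using continuous_openin_preimage[OF p(1), of X U] p(2) U by (simp add: image_subset_iff_funcset)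
  moreover have "a \<in> {0..1} \<inter> p -` U" using a by simp
  ultimately obtain d where "d > 0" "\<forall>b\<in>{0..1}. dist b a < d \<longrightarrow> b \<in> {0..1} \<inter> p -` U"
    unfolding openin_euclidean_subtopology_iff by blast
  then show thesis using that[of d] by (auto simp: dist_commute)
qed

text \<open>The relation is symmetric and transitive and relates every parameter to a whole
  neighbourhood of it, so the connectedness of the unit interval leaves a single class. This takes
  the place of cutting a path into finitely many short pieces.\<close>

lemma path_local_induct:
  assumes p: "is_path U y z p"
    and sym: "\<And>a b. a \<in> {0..1} \<Longrightarrow> b \<in> {0..1} \<Longrightarrow> Q a b \<Longrightarrow> Q b a"
    and trans: "\<And>a b c. a \<in> {0..1} \<Longrightarrow> b \<in> {0..1} \<Longrightarrow> c \<in> {0..1} \<Longrightarrow> Q a b \<Longrightarrow> Q b c \<Longrightarrow> Q a c"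
    and loc: "\<And>a. a \<in> {0..1} \<Longrightarrow> \<exists>W. W \<in> opens U \<and> p a \<in> W \<and>
                (\<forall>b\<in>{0..1}. is_path W (p a) (p b) (p \<circ> linepath a b) \<longrightarrow> Q a b)"
  shows "Q 0 (1::real)"
proof (rule connected_equivalence_relation[of "{0..1}"])
  fix a :: real assume a: "a \<in> {0..1}"
  obtain W where W: "W \<in> opens U" "p a \<in> W"
    and Q: "\<And>b. b \<in> {0..1} \<Longrightarrow> is_path W (p a) (p b) (p \<circ> linepath a b) \<Longrightarrow> Q a b"
    using loc[OF a] by blast
  have c: "continuous_on {0..1} p" "p ` {0..1} \<subseteq> U"
    using is_path_eq_comp[OF p] by auto
  obtain d where d: "d > 0" "\<And>b. b \<in> {0..1} \<Longrightarrow> b \<in> ball a d \<Longrightarrow> p b \<in> W"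
    by (rule interval_nbhd[OF c W(1) a W(2)]) blast
  \<comment> \<open>Convexity of \<open>?T\<close> keeps the segment from \<open>a\<close> to any
    \<open>b\<close> inside it, so \<open>p\<close> carries the segment into
    \<open>W\<close>.\<close>
  let ?T = "ball a d \<inter> {0..1}"
  have QT: "Q a b" if b: "b \<in> ?T" for b
  proof (rule Q)
    show "is_path W (p a) (p b) (p \<circ> linepath a b)"
    proof (rule is_path_comp[OF is_path_linepath])
      show "convex ?T" by (intro convex_Int convex_ball convex_closed_interval)
      show "continuous_on ?T p" using c(1) by (rule continuous_on_subset) auto
    qed (use a b d in auto)
  qed (use b in auto)
  have T: "openin (top_of_set {0..1}) ?T" by (subst Int_commute) (rule openin_open_Int[OF open_ball])
  have "a \<in> ?T" using a d(1) by simp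
  with QT T show "\<exists>T. openin (top_of_set {0..1}) T \<and> a \<in> T \<and> (\<forall>x\<in>T. Q a x)"
    by (intro exI[of _ ?T] conjI ballI)
next
  fix a b :: real assume h: "Q a b" "a \<in> {0..1}" "b \<in> {0..1}"
  show "Q b a" by (rule sym[OF h(2,3,1)])
next
  fix a b c :: real assume h: "Q a b" "Q b c" "a \<in> {0..1}" "b \<in> {0..1}" "c \<in> {0..1}"
  show "Q a c" by (rule trans[OF h(3,4,5,1,2)])
qed auto

lemma presheaf_of_modules_open:
  assumes "presheaf_of_modules X R F" "U \<in> opens X"
  shows "presheaf_of_modules U R F"
proof -
  interpret presheaf_of_modules X R F by (rule assms)
  show ?thesis
    by (rule presheaf_of_modules.intro)
       (use opens_trans[OF _ assms(2)] in \<open>blast intro: sect_module rstr_linear rstr_id rstr_rstr\<close>)+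
qed

text \<open>The pointwise structure on the functions in \<open>S\<close> is transported along the
  encoding \<open>e\<close>, with \<open>d\<close> as decoder. Negatives are products with the
  scalar -1, so they lie in \<open>S\<close> by closure under scalars.\<close>

lemma module_of_functions:
  fixes S :: "('a \<Rightarrow> 'u) set" and P :: "('r, 'u) module" and e :: "('a \<Rightarrow> 'u) \<Rightarrow> 'v"
    and M :: "('r, 'v) module"
  assumes P: "Module.module R P" and S: "S \<subseteq> U \<rightarrow>\<^sub>E carrier P" and e: "inj_on e S"
    and d: "\<And>s. s \<in> S \<Longrightarrow> d (e s) = s"
    and carrier: "carrier M = e ` S" and zero: "zero M = e (\<lambda>y\<in>U. \<zero>\<^bsub>P\<^esub>)"
    and add: "\<And>s t. s \<in> S \<Longrightarrow> t \<in> S \<Longrightarrow> e s \<oplus>\<^bsub>M\<^esub> e t = e (\<lambda>y\<in>U. s y \<oplus>\<^bsub>P\<^esub> t y)"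
    and smult: "\<And>a s. a \<in> carrier R \<Longrightarrow> s \<in> S \<Longrightarrow> a \<odot>\<^bsub>M\<^esub> e s = e (\<lambda>y\<in>U. a \<odot>\<^bsub>P\<^esub> s y)"
    and S_zero: "(\<lambda>y\<in>U. \<zero>\<^bsub>P\<^esub>) \<in> S"
    and S_add: "\<And>s t. s \<in> S \<Longrightarrow> t \<in> S \<Longrightarrow> (\<lambda>y\<in>U. s y \<oplus>\<^bsub>P\<^esub> t y) \<in> S"
    and S_smult: "\<And>a s. a \<in> carrier R \<Longrightarrow> s \<in> S \<Longrightarrow> (\<lambda>y\<in>U. a \<odot>\<^bsub>P\<^esub> s y) \<in> S"
  shows "Module.module R M"
proof -
  interpret P: Module.module R P by (rule P)
  have v: "\<And>s y. s \<in> S \<Longrightarrow> y \<in> U \<Longrightarrow> s y \<in> carrier P" using S by blast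
  have ext: "\<And>s. s \<in> S \<Longrightarrow> restrict s U = s" using S by (blast intro: PiE_restrict)
  have "abelian_group M"
  proof (rule abelian_groupI)
    fix a assume "a \<in> carrier M"
    then obtain s where s: "s \<in> S" "a = e s" by (auto simp: carrier)
    have "(\<lambda>y\<in>U. (\<ominus>\<^bsub>R\<^esub> \<one>\<^bsub>R\<^esub>) \<odot>\<^bsub>P\<^esub> s y) \<in> S" using S_smult s by simp
    then have "e (\<lambda>y\<in>U. (\<ominus>\<^bsub>R\<^esub> \<one>\<^bsub>R\<^esub>) \<odot>\<^bsub>P\<^esub> s y) \<oplus>\<^bsub>M\<^esub> a = \<zero>\<^bsub>M\<^esub>"
      using s v by (simp add: add zero P.smult_l_minus P.l_neg cong: restrict_cong)
    then show "\<exists>b\<in>carrier M. b \<oplus>\<^bsub>M\<^esub> a = \<zero>\<^bsub>M\<^esub>"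
      using S_smult s by (auto simp: carrier)
  qed (auto simp: carrier zero add S_zero S_add v ext P.a_ac cong: restrict_cong)
  then show ?thesis
    by (rule moduleI[OF P.R.is_cring])
       (auto simp: carrier zero add smult S_zero S_add S_smult v ext P.smult_l_distr P.smult_r_distr
          P.smult_assoc1 cong: restrict_cong)
qed

lemma loc_constD:
  assumes "s \<in> loc_const_functions U A" "y \<in> U"
  obtains W where "W \<in> opens U" "y \<in> W" "s constant_on W"
proof -
  have "\<exists>W\<in>opens U. y \<in> W \<and> s constant_on W"
    using assms by (simp add: loc_const_functions_def)
  then show ?thesis using that by blast
qed

section \<open>The sheaf of a representation\<close>

locale rep_setup = based_space X x + R?: cring R
  for X :: "'a::topological_space set" and x :: 'a and R :: "('r, 'e) ring_scheme" (structure) +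
  fixes enc :: "('a \<Rightarrow> 'u) \<Rightarrow> 'u"
  assumes enc_inj: "inj_on enc (X \<rightarrow>\<^sub>E UNIV)"
    and lpc: "locally path_connected X" and lsc: "locally simply_connected X"
begin

sublocale group_ring_setup R \<pi> ..

definition val :: "'u \<Rightarrow> 'a \<Rightarrow> 'u" where
  "val t = inv_into (X \<rightarrow>\<^sub>E UNIV) enc t"

text \<open>By extensionality a function on \<open>U\<close> is already a member of the function
  space over \<open>X\<close>, so the single injection \<open>enc\<close> encodes the functions on
  all open subsets.\<close>

lemma ext_mono: "s \<in> U \<rightarrow>\<^sub>E A \<Longrightarrow> U \<subseteq> X \<Longrightarrow> s \<in> X \<rightarrow>\<^sub>E UNIV"
  by (auto simp: PiE_iff extensional_def)

lemma val_enc: "s \<in> U \<rightarrow>\<^sub>E A \<Longrightarrow> U \<subseteq> X \<Longrightarrow> val (enc s) = s"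
  unfolding val_def by (rule inv_into_f_f[OF enc_inj ext_mono])

text \<open>Trivial holonomy expresses that a loop in \<open>U\<close> contracts in
  \<open>X\<close>, possibly leaving \<open>U\<close> on the way. Nonemptiness supplies the point to
  which values are moved in \<open>good_constant\<close>.\<close>

definition good :: "'a set \<Rightarrow> bool" where
  "good U \<longleftrightarrow> U \<in> opens X \<and> U \<noteq> {} \<and> path_connected U \<and> (\<forall>y p. is_path U y y p \<longrightarrow> hol p = \<one>\<^bsub>\<pi>\<^esub>)"

lemma goodD: "good U \<Longrightarrow> U \<in> opens X" "good U \<Longrightarrow> path_connected U" "good U \<Longrightarrow> U \<subseteq> X"
  unfolding good_def by (auto dest: openin_imp_subset)

lemma path_connected_base:
  assumes U: "U \<in> opens X" and y: "y \<in> U"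
  obtains W where "W \<in> opens X" "path_connected W" "y \<in> W" "W \<subseteq> U"
  using lpc[unfolded locally_path_connected, rule_format, OF conjI[OF _ y]] U by auto

text \<open>Local simple connectedness yields a simply connected \<open>B\<close>, possibly not
  open, around an open \<open>A\<close>. A path-connected open \<open>W\<close> inside
  \<open>A\<close> is good, because its loops contract in \<open>B\<close>.\<close>

lemma good_base:
  assumes U: "U \<in> opens X" and y: "y \<in> U"
  obtains W where "good W" "y \<in> W" "W \<subseteq> U"
proof -
  obtain A B where A: "openin (top_of_set X) A" and B: "simply_connected B" "y \<in> A" "A \<subseteq> B" "B \<subseteq> U"
    using lsc[unfolded locally_def, rule_format, OF conjI[OF _ y]] U by auto
  obtain W where W: "W \<in> opens X" "path_connected W" "y \<in> W" "W \<subseteq> A"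
    by (rule path_connected_base[of A y]) (use A B(2) in auto)
  have "B \<subseteq> X" using B(4) opens_sub[OF U] by blast
  have "hol p = \<one>\<^bsub>\<pi>\<^esub>" if p: "is_path W z z p" for z p
  proof -
    have p': "is_path B z z p" using is_path_mono[OF p] W(4) B(3) by blast
    have "homotopic_paths X p (\<lambda>t. z)"
      using homotopic_paths_subset[OF simply_connected_homotopic_paths[OF B(1) p'] \<open>B \<subseteq> X\<close>] .
    then show ?thesis using hol_homotopic hol_const is_pathD(5)[OF p'] \<open>B \<subseteq> X\<close> by (metis subsetD)
  qed
  then have "good W" unfolding good_def using W by auto
  then show thesis using W(3,4) B(3,4) that by simp
qed

definition seg :: "'a set \<Rightarrow> 'a \<Rightarrow> 'a \<Rightarrow> real \<Rightarrow> 'a" where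
  "seg U y z = (SOME p. is_path U y z p)"

lemma seg: "path_connected U \<Longrightarrow> y \<in> U \<Longrightarrow> z \<in> U \<Longrightarrow> is_path U y z (seg U y z)"
  unfolding seg_def by (rule someI_ex[OF path_connected_is_path])

text \<open>The two paths differ by a loop in \<open>U\<close>, whose holonomy is trivial.\<close>

lemma good_hol_eq:
  assumes U: "good U" and p: "is_path U y z p" and q: "is_path U y z q"
  shows "hol p = hol q"
proof -
  note X = is_path_mono[OF _ goodD(3)[OF U]]
  have "hol p \<otimes>\<^bsub>\<pi>\<^esub> inv\<^bsub>\<pi>\<^esub> hol q = hol (p +++ reversepath q)"
    by (simp add: hol_join[OF X[OF p] X[OF is_path_reverse[OF q]]] hol_reverse[OF X[OF q]])
  also have "\<dots> = \<one>\<^bsub>\<pi>\<^esub>"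
    using U is_path_join[OF p is_path_reverse[OF q]] unfolding good_def by blast
  finally show ?thesis
    using pi.inv_solve_right'[of "\<one>\<^bsub>\<pi>\<^esub>" "hol p" "hol q"] hol_in[OF X[OF p]] hol_in[OF X[OF q]] by simp
qed

end

locale pi_rep = rep_setup X x R enc + group_rep R "fundamental_group X x" P act
  for X :: "'a::topological_space set" and x :: 'a and R :: "('r, 'e) ring_scheme" (structure)
    and enc :: "('a \<Rightarrow> 'u) \<Rightarrow> 'u" and P :: "('r, 'u) module" and act :: "(real \<Rightarrow> 'a) set \<Rightarrow> 'u \<Rightarrow> 'u"
begin

text \<open>
  The sections over \<open>U\<close>.  In terms of the universal cover they are the equivariant locally
  constant functions on its part over \<open>U\<close>; such a function is given by its values at the classes
  of the chosen paths from \<open>x\<close> to the points of \<open>U\<close>.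
\<close>

definition flat :: "'a set \<Rightarrow> ('a \<Rightarrow> 'u) set" where
  "flat U = {s \<in> U \<rightarrow>\<^sub>E carrier P. \<forall>y z p. is_path U y z p \<longrightarrow> s y = act (hol p) (s z)}"

definition rep_sheaf :: "('a, 'r, 'u) presheaf" where
  "rep_sheaf =
     \<lparr>sect = (\<lambda>U.
        \<lparr>carrier = enc ` flat U,
         mult = (\<lambda>s t. undefined),
         one = undefined,
         zero = enc (\<lambda>y\<in>U. \<zero>\<^bsub>P\<^esub>),
         add = (\<lambda>s t. enc (\<lambda>y\<in>U. val s y \<oplus>\<^bsub>P\<^esub> val t y)),
         smult = (\<lambda>a s. enc (\<lambda>y\<in>U. a \<odot>\<^bsub>P\<^esub> val s y))\<rparr>),
      rstr = (\<lambda>U V. \<lambda>s\<in>enc ` flat U. enc (restrict (val s) V))\<rparr>"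

abbreviation "sc U \<equiv> carrier (sect rep_sheaf U)"

lemma flatD: "s \<in> flat U \<Longrightarrow> s \<in> U \<rightarrow>\<^sub>E carrier P"
  "s \<in> flat U \<Longrightarrow> is_path U y z p \<Longrightarrow> s y = act (hol p) (s z)"
  unfolding flat_def by auto

lemma sc_eq: "sc U = enc ` flat U"
  by (simp add: rep_sheaf_def)

lemma val_flat: "U \<subseteq> X \<Longrightarrow> s \<in> flat U \<Longrightarrow> val (enc s) = s"
  using val_enc flatD(1) by blast

lemma val_in: "U \<in> opens X \<Longrightarrow> t \<in> sc U \<Longrightarrow> val t \<in> flat U"
  unfolding sc_eq by (erule imageE) (simp only: val_flat[OF opens_sub])

lemma enc_val: "U \<in> opens X \<Longrightarrow> t \<in> sc U \<Longrightarrow> enc (val t) = t"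
  unfolding sc_eq by (erule imageE) (simp only: val_flat[OF opens_sub])

lemma val_closed: "U \<in> opens X \<Longrightarrow> t \<in> sc U \<Longrightarrow> y \<in> U \<Longrightarrow> val t y \<in> carrier P"
  by (rule PiE_mem[OF flatD(1)[OF val_in]])

lemma sc_eqI:
  assumes U: "U \<in> opens X" and "s \<in> sc U" "t \<in> sc U" "\<And>y. y \<in> U \<Longrightarrow> val s y = val t y"
  shows "s = t"
proof -
  have "val s = val t"
    by (rule PiE_ext[OF flatD(1)[OF val_in] flatD(1)[OF val_in]]) (use assms in auto)
  then show ?thesis using enc_val[OF U] assms by metis
qed

lemma flat_add:
  assumes U: "U \<subseteq> X" and s: "s \<in> flat U" and t: "t \<in> flat U"
  shows "(\<lambda>y\<in>U. s y \<oplus>\<^bsub>P\<^esub> t y) \<in> flat U"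
proof -
  have v: "\<And>y. y \<in> U \<Longrightarrow> s y \<in> carrier P" "\<And>y. y \<in> U \<Longrightarrow> t y \<in> carrier P" using flatD(1)[OF s] flatD(1)[OF t] by auto
  show ?thesis unfolding flat_def
  proof (intro CollectI conjI allI impI)
    fix y z p assume p: "is_path U y z p"
    then show "(\<lambda>y\<in>U. s y \<oplus>\<^bsub>P\<^esub> t y) y = act (hol p) ((\<lambda>y\<in>U. s y \<oplus>\<^bsub>P\<^esub> t y) z)"
      using is_pathD(5,6)[OF p] hol_in[OF is_path_mono[OF p U]] v
      by (simp add: act_add flatD(2)[OF s p] flatD(2)[OF t p])
  qed (use v in auto)
qed

lemma flat_smult:
  assumes U: "U \<subseteq> X" and s: "s \<in> flat U" and a: "a \<in> carrier R"
  shows "(\<lambda>y\<in>U. a \<odot>\<^bsub>P\<^esub> s y) \<in> flat U"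
proof -
  have v: "\<And>y. y \<in> U \<Longrightarrow> s y \<in> carrier P" using flatD(1)[OF s] by auto
  show ?thesis unfolding flat_def
  proof (intro CollectI conjI allI impI)
    fix y z p assume p: "is_path U y z p"
    then show "(\<lambda>y\<in>U. a \<odot>\<^bsub>P\<^esub> s y) y = act (hol p) ((\<lambda>y\<in>U. a \<odot>\<^bsub>P\<^esub> s y) z)"
      using is_pathD(5,6)[OF p] hol_in[OF is_path_mono[OF p U]] v a
      by (simp add: act_smult flatD(2)[OF s p])
  qed (use v a in auto)
qed

lemma act_zero: "g \<in> carrier \<pi> \<Longrightarrow> act g \<zero>\<^bsub>P\<^esub> = \<zero>\<^bsub>P\<^esub>"
  using act_smult[of g \<zero> "\<zero>\<^bsub>P\<^esub>"] act_closed[of g "\<zero>\<^bsub>P\<^esub>"] by simp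

lemma flat_zero: "U \<subseteq> X \<Longrightarrow> (\<lambda>y\<in>U. \<zero>\<^bsub>P\<^esub>) \<in> flat U"
  unfolding flat_def
proof (intro CollectI conjI allI impI)
  fix y z p assume U: "U \<subseteq> X" and p: "is_path U y z p"
  show "(\<lambda>y\<in>U. \<zero>\<^bsub>P\<^esub>) y = act (hol p) ((\<lambda>y\<in>U. \<zero>\<^bsub>P\<^esub>) z)"
    using is_pathD(5,6)[OF p] by (simp add: act_zero[OF hol_in[OF is_path_mono[OF p U]]])
qed auto

lemma flat_restrict: "s \<in> flat U \<Longrightarrow> V \<subseteq> U \<Longrightarrow> restrict s V \<in> flat V"
  unfolding flat_def
proof (intro CollectI conjI allI impI)
  fix y z p assume s: "s \<in> {s \<in> U \<rightarrow>\<^sub>E carrier P. \<forall>y z p. is_path U y z p \<longrightarrow> s y = act (hol p) (s z)}"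
    and V: "V \<subseteq> U" and p: "is_path V y z p"
  then show "restrict s V y = act (hol p) (restrict s V z)"
    using is_pathD(5,6)[OF p] is_path_mono[OF p V] by simp
qed auto

lemma sc_add:
  assumes U: "U \<in> opens X" and s: "s \<in> sc U" and t: "t \<in> sc U" and y: "y \<in> U"
  shows "val (s \<oplus>\<^bsub>sect rep_sheaf U\<^esub> t) y = val s y \<oplus>\<^bsub>P\<^esub> val t y"
  using val_flat[OF opens_sub[OF U] flat_add[OF opens_sub[OF U] val_in[OF U s] val_in[OF U t]]] y
  by (simp add: rep_sheaf_def)

lemma sc_smult:
  assumes U: "U \<in> opens X" and s: "s \<in> sc U" and a: "a \<in> carrier R" and y: "y \<in> U"
  shows "val (a \<odot>\<^bsub>sect rep_sheaf U\<^esub> s) y = a \<odot>\<^bsub>P\<^esub> val s y"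
  using val_flat[OF opens_sub[OF U] flat_smult[OF opens_sub[OF U] val_in[OF U s] a]] y
  by (simp add: rep_sheaf_def)

lemma sc_rstr:
  assumes U: "U \<in> opens X" and V: "V \<in> opens X" "V \<subseteq> U" and s: "s \<in> sc U"
  shows "rstr rep_sheaf U V s \<in> sc V" "y \<in> V \<Longrightarrow> val (rstr rep_sheaf U V s) y = val s y"
proof -
  have f: "restrict (val s) V \<in> flat V" by (rule flat_restrict[OF val_in[OF U s] V(2)])
  have e: "rstr rep_sheaf U V s = enc (restrict (val s) V)"
    using s unfolding sc_eq by (simp add: rep_sheaf_def)
  show "rstr rep_sheaf U V s \<in> sc V" unfolding e sc_eq using f by (rule imageI)
  show "y \<in> V \<Longrightarrow> val (rstr rep_sheaf U V s) y = val s y"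
    unfolding e using val_flat[OF opens_sub[OF V(1)] f] by simp
qed

lemma presheaf_rep_sheaf: "presheaf_of_modules X R rep_sheaf"
proof (rule presheaf_of_modules.intro)
  fix U assume U: "U \<in> opens X"
  note UX = opens_sub[OF U]
  have inj: "inj_on enc (flat U)"
    using inj_on_inverseI[of "flat U" val enc] val_flat[OF UX] by blast
  show m: "Module.module R (sect rep_sheaf U)"
    by (rule module_of_functions[where S = "flat U" and e = enc and d = val and U = U, OF mod])
       (use inj flat_add[OF UX] flat_smult[OF UX] flat_zero[OF UX] subsetI[OF flatD(1)] val_flat[OF UX]
         in \<open>simp_all add: rep_sheaf_def\<close>)
next
  fix U V assume U: "U \<in> opens X" and V: "V \<in> opens X" "V \<subseteq> U"
  note UX = opens_sub[OF U]
  have cl: "s \<oplus>\<^bsub>sect rep_sheaf U\<^esub> t \<in> sc U" if "s \<in> sc U" "t \<in> sc U" "U \<in> opens X" for s t U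
    using imageI[OF flat_add[OF opens_sub[OF that(3)] val_in[OF that(3,1)] val_in[OF that(3,2)]], of enc]
    unfolding sc_eq by (simp add: rep_sheaf_def)
  have cl': "a \<odot>\<^bsub>sect rep_sheaf U\<^esub> s \<in> sc U" if "s \<in> sc U" "a \<in> carrier R" "U \<in> opens X" for s a U
    using imageI[OF flat_smult[OF opens_sub[OF that(3)] val_in[OF that(3,1)] that(2)], of enc]
    unfolding sc_eq by (simp add: rep_sheaf_def)
  note r = sc_rstr[OF U V]
  have in_U: "\<And>y. y \<in> V \<Longrightarrow> y \<in> U" using V(2) by blast
  show "rstr rep_sheaf U V \<in> lin_maps R (sect rep_sheaf U) (sect rep_sheaf V)"
    unfolding lin_maps_def
  proof (intro CollectI conjI ballI PiE_I)
    fix s assume s: "s \<in> sc U"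
    show "rstr rep_sheaf U V s \<in> sc V" by (rule r[OF s])
    fix t assume t: "t \<in> sc U"
    show "rstr rep_sheaf U V (s \<oplus>\<^bsub>sect rep_sheaf U\<^esub> t) = rstr rep_sheaf U V s \<oplus>\<^bsub>sect rep_sheaf V\<^esub> rstr rep_sheaf U V t"
    proof (rule sc_eqI[OF V(1) r(1)[OF cl[OF s t U]] cl[OF r(1)[OF s] r(1)[OF t] V(1)]])
      fix y assume y: "y \<in> V"
      show "val (rstr rep_sheaf U V (s \<oplus>\<^bsub>sect rep_sheaf U\<^esub> t)) y =
          val (rstr rep_sheaf U V s \<oplus>\<^bsub>sect rep_sheaf V\<^esub> rstr rep_sheaf U V t) y"
        by (simp only: r(2)[OF cl[OF s t U] y] r(2)[OF s y] r(2)[OF t y] sc_add[OF U s t in_U[OF y]]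
            sc_add[OF V(1) r(1)[OF s] r(1)[OF t] y])
    qed
  next
    fix a s assume a: "a \<in> carrier R" and s: "s \<in> sc U"
    show "rstr rep_sheaf U V (a \<odot>\<^bsub>sect rep_sheaf U\<^esub> s) = a \<odot>\<^bsub>sect rep_sheaf V\<^esub> rstr rep_sheaf U V s"
    proof (rule sc_eqI[OF V(1) r(1)[OF cl'[OF s a U]] cl'[OF r(1)[OF s] a V(1)]])
      fix y assume y: "y \<in> V"
      show "val (rstr rep_sheaf U V (a \<odot>\<^bsub>sect rep_sheaf U\<^esub> s)) y =
          val (a \<odot>\<^bsub>sect rep_sheaf V\<^esub> rstr rep_sheaf U V s) y"
        by (simp only: r(2)[OF cl'[OF s a U] y] r(2)[OF s y] sc_smult[OF U s a in_U[OF y]]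
            sc_smult[OF V(1) r(1)[OF s] a y])
    qed
  next
    fix s assume "s \<notin> sc U"
    then show "rstr rep_sheaf U V s = undefined" unfolding sc_eq by (simp add: rep_sheaf_def)
  qed
next
  fix U s assume U: "U \<in> opens X" and s: "s \<in> sc U"
  show "rstr rep_sheaf U U s = s"
    by (rule sc_eqI[OF U sc_rstr(1)[OF U U _ s] s]) (simp_all add: sc_rstr(2)[OF U U _ s])
next
  fix U V W s assume U: "U \<in> opens X" and V: "V \<in> opens X" and W: "W \<in> opens X" and WV: "W \<subseteq> V" and VU: "V \<subseteq> U"
    and s: "s \<in> sc U"
  have VW: "\<And>y. y \<in> W \<Longrightarrow> y \<in> V" using WV by blast
  have WU: "W \<subseteq> U" using WV VU by blast
  note r1 = sc_rstr[OF U V VU s]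
  show "rstr rep_sheaf V W (rstr rep_sheaf U V s) = rstr rep_sheaf U W s"
    by (rule sc_eqI[OF W sc_rstr(1)[OF V W WV r1(1)] sc_rstr(1)[OF U W WU s]])
       (simp add: sc_rstr(2)[OF V W WV r1(1)] sc_rstr(2)[OF U W WU s] r1(2) VW)
qed

sublocale psh: presheaf_of_modules X R rep_sheaf by (rule presheaf_rep_sheaf)

text \<open>Sections of \<open>rep_sheaf\<close> are determined by their decoded values, so the
  conditions on a morphism into it can be stated pointwise in \<open>P\<close>. This serves both for
  \<open>gmap\<close> and for the comparison with a given sheaf.\<close>

lemma sheaf_hom_intoI:
  fixes F :: "('a, 'r, 'v) presheaf"
  assumes F: "presheaf_of_modules X R F"
    and ext: "\<phi> \<in> extensional (opens X)" "\<And>U. U \<in> opens X \<Longrightarrow> \<phi> U \<in> extensional (carrier (sect F U))"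
    and cl: "\<And>U s. U \<in> opens X \<Longrightarrow> s \<in> carrier (sect F U) \<Longrightarrow> \<phi> U s \<in> sc U"
    and add: "\<And>U s t y. U \<in> opens X \<Longrightarrow> s \<in> carrier (sect F U) \<Longrightarrow> t \<in> carrier (sect F U) \<Longrightarrow> y \<in> U \<Longrightarrow>
        val (\<phi> U (s \<oplus>\<^bsub>sect F U\<^esub> t)) y = val (\<phi> U s) y \<oplus>\<^bsub>P\<^esub> val (\<phi> U t) y"
    and smult: "\<And>U a s y. U \<in> opens X \<Longrightarrow> a \<in> carrier R \<Longrightarrow> s \<in> carrier (sect F U) \<Longrightarrow> y \<in> U \<Longrightarrow>
        val (\<phi> U (a \<odot>\<^bsub>sect F U\<^esub> s)) y = a \<odot>\<^bsub>P\<^esub> val (\<phi> U s) y"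
    and rstr: "\<And>U V s y. U \<in> opens X \<Longrightarrow> V \<in> opens X \<Longrightarrow> V \<subseteq> U \<Longrightarrow> s \<in> carrier (sect F U) \<Longrightarrow> y \<in> V \<Longrightarrow>
        val (\<phi> V (rstr F U V s)) y = val (\<phi> U s) y"
  shows "\<phi> \<in> sheaf_homs X R F rep_sheaf"
proof -
  interpret F: presheaf_of_modules X R F by (rule F)
  show ?thesis
    unfolding sheaf_homs_def lin_maps_def
  proof (intro CollectI conjI PiE_I ballI impI)
    fix U s assume U: "U \<in> opens X" and s: "s \<in> carrier (sect F U)"
    note c = cl[OF U s]
    show "\<phi> U s \<in> sc U" by (rule c)
    { fix t assume t: "t \<in> carrier (sect F U)"
      show "\<phi> U (s \<oplus>\<^bsub>sect F U\<^esub> t) = \<phi> U s \<oplus>\<^bsub>sect rep_sheaf U\<^esub> \<phi> U t"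
        by (rule sc_eqI[OF U cl[OF U F.sect_closed(1)[OF U s t]] psh.sect_closed(1)[OF U c cl[OF U t]]])
           (simp only: add[OF U s t] sc_add[OF U c cl[OF U t]]) }
    { fix V assume V: "V \<in> opens X" "V \<subseteq> U"
      show "\<phi> V (rstr F U V s) = rstr rep_sheaf U V (\<phi> U s)"
        by (rule sc_eqI[OF V(1) cl[OF V(1) F.rstr_closed[OF U V s]] sc_rstr(1)[OF U V c]])
           (simp only: rstr[OF U V s] sc_rstr(2)[OF U V c]) }
  next
    fix U a s assume U: "U \<in> opens X" and a: "a \<in> carrier R" and s: "s \<in> carrier (sect F U)"
    note c = cl[OF U s]
    show "\<phi> U (a \<odot>\<^bsub>sect F U\<^esub> s) = a \<odot>\<^bsub>sect rep_sheaf U\<^esub> \<phi> U s"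
      by (rule sc_eqI[OF U cl[OF U F.sect_closed(2)[OF U s s a]] psh.sect_closed(2)[OF U c c a]])
         (simp only: smult[OF U a s] sc_smult[OF U c a])
  qed (use ext in \<open>simp_all add: extensional_def\<close>)
qed

text \<open>Flatness is a local condition although it speaks of arbitrarily long paths: holonomy is
  multiplicative along segments, and short segments stay in one of the sets \<open>V\<close>. A path
  in a union of open sets may leave each of them, so gluing flat sections relies on this.\<close>

lemma flat_local:
  assumes U: "U \<subseteq> X" and s: "s \<in> U \<rightarrow>\<^sub>E carrier P"
    and loc: "\<And>y. y \<in> U \<Longrightarrow> \<exists>V. V \<in> opens U \<and> y \<in> V \<and> (\<forall>y z p. is_path V y z p \<longrightarrow> s y = act (hol p) (s z))"
  shows "s \<in> flat U"
  unfolding flat_def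
proof (intro CollectI conjI allI impI s)
  fix y z p assume p: "is_path U y z p"
  note seg = is_path_subpath[OF is_path_mono[OF p U]]
  have in_U: "\<And>a. a \<in> {0..1} \<Longrightarrow> p a \<in> U" by (rule is_path_in[OF p])
  then have sP: "\<And>a. a \<in> {0..1} \<Longrightarrow> s (p a) \<in> carrier P" using s by blast
  define Q where "Q a b \<longleftrightarrow> s (p a) = act (hol (p \<circ> linepath a b)) (s (p b))" for a b :: real
  have "Q 0 1"
  proof (rule path_local_induct[OF p])
    fix a b :: real assume ab: "a \<in> {0..1}" "b \<in> {0..1}" and q: "Q a b"
    show "Q b a"
      using q sP ab hol_in[OF seg[OF ab]]
      unfolding Q_def hol_segment_reverse[OF is_path_mono[OF p U] ab] by (simp add: act_inv)
  next
    fix a b c :: real assume abc: "a \<in> {0..1}" "b \<in> {0..1}" "c \<in> {0..1}" and q: "Q a b" "Q b c"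
    show "Q a c"
      using q sP abc hol_in[OF seg[OF abc(1,2)]] hol_in[OF seg[OF abc(2,3)]]
      unfolding Q_def hol_segment_join[OF is_path_mono[OF p U] abc] by (simp add: act_mult)
  next
    fix a :: real assume a: "a \<in> {0..1}"
    obtain V where V: "V \<in> opens U" "p a \<in> V"
      and s: "\<forall>y z p. is_path V y z p \<longrightarrow> s y = act (hol p) (s z)"
      using loc[OF in_U[OF a]] by (elim exE conjE)
    then show "\<exists>W. W \<in> opens U \<and> p a \<in> W \<and> (\<forall>b\<in>{0..1}. is_path W (p a) (p b) (p \<circ> linepath a b) \<longrightarrow> Q a b)"
      unfolding Q_def by (intro exI[of _ V] conjI ballI impI) simp_all
  qed
  then show "s y = act (hol p) (s z)"
    unfolding Q_def is_path_eq_comp(3)[OF p] is_path_ends[OF p] .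
qed

lemma sheaf_rep_sheaf: "sheaf_of_modules X R rep_sheaf"
proof (intro sheaf_of_modules.intro sheaf_of_modules_axioms.intro presheaf_rep_sheaf)
  fix \<U> s
  assume UX: "\<U> \<subseteq> opens X" and s: "\<And>V. V \<in> \<U> \<Longrightarrow> s V \<in> sc V"
    and comp: "\<And>V W. V \<in> \<U> \<Longrightarrow> W \<in> \<U> \<Longrightarrow> rstr rep_sheaf V (V \<inter> W) (s V) = rstr rep_sheaf W (V \<inter> W) (s W)"
  have o: "\<And>V. V \<in> \<U> \<Longrightarrow> V \<in> opens X" using UX by blast
  have U: "\<Union>\<U> \<in> opens X" by (rule opens_Union[OF UX])
  have agree: "val (s V) y = val (s W) y" if V: "V \<in> \<U>" and W: "W \<in> \<U>" and y: "y \<in> V" "y \<in> W" for V W y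
  proof -
    have i: "V \<inter> W \<in> opens X" by (rule opens_Int[OF o[OF V] o[OF W]])
    have "val (s V) y = val (rstr rep_sheaf V (V \<inter> W) (s V)) y"
      using sc_rstr(2)[OF o[OF V] i _ s[OF V], of y] y by simp
    also have "\<dots> = val (s W) y"
      unfolding comp[OF V W] using sc_rstr(2)[OF o[OF W] i _ s[OF W], of y] y by simp
    finally show ?thesis .
  qed
  \<comment> \<open>The choice of a member through \<open>y\<close> is harmless, since by
    \<open>agree\<close> all of them give the same value.\<close>
  define t where "t = (\<lambda>y\<in>\<Union>\<U>. val (s (SOME V. V \<in> \<U> \<and> y \<in> V)) y)"
  have t: "t y = val (s V) y" if V: "V \<in> \<U>" "y \<in> V" for V y
  proof -
    have "\<exists>V. V \<in> \<U> \<and> y \<in> V" using V by blast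
    from someI_ex[OF this] have W: "(SOME V. V \<in> \<U> \<and> y \<in> V) \<in> \<U>" "y \<in> (SOME V. V \<in> \<U> \<and> y \<in> V)" by simp_all
    have "y \<in> \<Union>\<U>" using V by blast
    then have "t y = val (s (SOME V. V \<in> \<U> \<and> y \<in> V)) y" unfolding t_def by (rule restrict_apply')
    then show ?thesis unfolding agree[OF W(1) V(1) W(2) V(2)] .
  qed
  have tf: "t \<in> flat (\<Union>\<U>)"
  proof (rule flat_local[OF opens_sub[OF U]])
    show "t \<in> \<Union>\<U> \<rightarrow>\<^sub>E carrier P"
    proof (rule PiE_I)
      fix y assume "y \<in> \<Union>\<U>"
      then obtain V where V: "V \<in> \<U>" "y \<in> V" by blast
      show "t y \<in> carrier P" unfolding t[OF V] by (rule val_closed[OF o[OF V(1)] s[OF V(1)] V(2)])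
    qed (simp add: t_def)
    fix y assume "y \<in> \<Union>\<U>"
    then obtain V where V: "V \<in> \<U>" "y \<in> V" by blast
    have "V \<in> opens (\<Union>\<U>)" by (rule opens_restrict[OF o[OF V(1)] Union_upper[OF V(1)] opens_sub[OF U]])
    moreover have "t y = act (hol p) (t z)" if p: "is_path V y z p" for y z p
      using flatD(2)[OF val_in[OF o[OF V(1)] s[OF V(1)]] p] t[OF V(1)] is_pathD(5,6)[OF p] by simp
    ultimately show "\<exists>V. V \<in> opens (\<Union>\<U>) \<and> y \<in> V \<and> (\<forall>y z p. is_path V y z p \<longrightarrow> t y = act (hol p) (t z))"
      using V(2) by (intro exI[of _ V] conjI allI impI)
  qed
  have ts: "enc t \<in> sc (\<Union>\<U>)" unfolding sc_eq using tf by (rule imageI)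
  have sub: "\<And>V. V \<in> \<U> \<Longrightarrow> V \<subseteq> \<Union>\<U>" by blast
  show "\<exists>!t. t \<in> sc (\<Union>\<U>) \<and> (\<forall>V\<in>\<U>. rstr rep_sheaf (\<Union>\<U>) V t = s V)"
  proof (rule ex1I[of _ "enc t"], intro conjI ballI ts)
    fix V assume V: "V \<in> \<U>"
    show "rstr rep_sheaf (\<Union>\<U>) V (enc t) = s V"
      by (rule sc_eqI[OF o[OF V] sc_rstr(1)[OF U o[OF V] sub[OF V] ts] s[OF V]])
         (simp add: sc_rstr(2)[OF U o[OF V] sub[OF V] ts] val_flat[OF opens_sub[OF U] tf] t[OF V])
  next
    fix t' assume t': "t' \<in> sc (\<Union>\<U>) \<and> (\<forall>V\<in>\<U>. rstr rep_sheaf (\<Union>\<U>) V t' = s V)"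
    show "t' = enc t"
    proof (rule sc_eqI[OF U _ ts])
      fix y assume "y \<in> \<Union>\<U>"
      then obtain V where V: "V \<in> \<U>" "y \<in> V" by blast
      have "val t' y = val (rstr rep_sheaf (\<Union>\<U>) V t') y"
        by (rule sc_rstr(2)[OF U o[OF V(1)] sub[OF V(1)] conjunct1[OF t'] V(2), symmetric])
      also have "\<dots> = val (s V) y" using conjunct2[OF t'] V(1) by simp
      also have "\<dots> = val (enc t) y" by (simp only: val_flat[OF opens_sub[OF U] tf] t[OF V])
      finally show "val t' y = val (enc t) y" .
    qed (use t' in simp)
  qed
qed

text \<open>Over a good \<open>U\<close> values can be moved to the fixed point \<open>z\<close>
  along paths in \<open>U\<close>. In that frame, flat means constant along paths; the formula is
  the inverse change of frame, which moves \<open>u y\<close> from \<open>z\<close> back to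
  \<open>y\<close>.\<close>

lemma flat_transport:
  assumes U: "good U" and W: "W \<subseteq> U" and u: "u \<in> W \<rightarrow>\<^sub>E carrier P" and z: "z \<in> U"
    and const: "\<And>y y' p. is_path W y y' p \<Longrightarrow> u y = u y'"
  shows "(\<lambda>y\<in>W. act (inv\<^bsub>\<pi>\<^esub> hol (seg U z y)) (u y)) \<in> flat W"
proof -
  note pc = goodD(2)[OF U] and UX = goodD(3)[OF U]
  have h: "hol (seg U z y) \<in> carrier \<pi>" if "y \<in> W" for y
    by (rule hol_in[OF is_path_mono[OF seg[OF pc z] UX]]) (use that W in blast)
  have uP: "\<And>y. y \<in> W \<Longrightarrow> u y \<in> carrier P" using u by blast
  show ?thesis unfolding flat_def
  proof (intro CollectI conjI allI impI)
    show "(\<lambda>y\<in>W. act (inv\<^bsub>\<pi>\<^esub> hol (seg U z y)) (u y)) \<in> W \<rightarrow>\<^sub>E carrier P"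
      using h uP by (auto intro: act_closed)
    fix y y' p assume p: "is_path W y y' p"
    have yW: "y \<in> W" "y' \<in> W" using is_pathD(5,6)[OF p] by auto
    have pU: "is_path U y y' p" by (rule is_path_mono[OF p W])
    have s: "is_path U z y (seg U z y)" "is_path U z y' (seg U z y')" using seg[OF pc z] yW W by auto
    have hp: "hol p \<in> carrier \<pi>" by (rule hol_in[OF is_path_mono[OF pU UX]])
    \<comment> \<open>Going from \<open>z\<close> to \<open>y\<close> and then along
      \<open>p\<close> is another path in \<open>U\<close> from \<open>z\<close> to
      \<open>y'\<close>, so goodness identifies the holonomies.\<close>
    have e: "hol (seg U z y') = hol (seg U z y) \<otimes>\<^bsub>\<pi>\<^esub> hol p"
      using good_hol_eq[OF U s(2) is_path_join[OF s(1) pU]] hol_join[OF is_path_mono[OF s(1) UX] is_path_mono[OF pU UX]] by simp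
    have "hol p \<otimes>\<^bsub>\<pi>\<^esub> inv\<^bsub>\<pi>\<^esub> hol (seg U z y') = inv\<^bsub>\<pi>\<^esub> hol (seg U z y)"
      unfolding e using h[OF yW(1)] hp by (simp add: pi.inv_mult_group pi.m_assoc[symmetric])
    then have "act (hol p) (act (inv\<^bsub>\<pi>\<^esub> hol (seg U z y')) (u y')) = act (inv\<^bsub>\<pi>\<^esub> hol (seg U z y)) (u y')"
      using act_mult[of "hol p" "inv\<^bsub>\<pi>\<^esub> hol (seg U z y')" "u y'"] hp h[OF yW(2)] uP[OF yW(2)] by simp
    then show "(\<lambda>y\<in>W. act (inv\<^bsub>\<pi>\<^esub> hol (seg U z y)) (u y)) y =
        act (hol p) ((\<lambda>y\<in>W. act (inv\<^bsub>\<pi>\<^esub> hol (seg U z y)) (u y)) y')"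
      using yW const[OF p] by simp
  qed
qed

text \<open>The function that is constantly \<open>m\<close> in the frame at \<open>z\<close> is
  flat, and the change of frame is the identity at \<open>z\<close>. With
  \<open>section_unique\<close>, evaluation at any point identifies the sections over
  \<open>U\<close> with \<open>P\<close>.\<close>

lemma good_section:
  assumes U: "good U" and z: "z \<in> U" and m: "m \<in> carrier P"
  obtains t where "t \<in> sc U" "val t z = m"
proof -
  let ?s = "\<lambda>y\<in>U. act (inv\<^bsub>\<pi>\<^esub> hol (seg U z y)) ((\<lambda>y\<in>U. m) y)"
  have c: "(\<lambda>y\<in>U. m) y = (\<lambda>y\<in>U. m) y'" if p: "is_path U y y' p" for y y' p
    using is_pathD(5,6)[OF p] by simp
  have f: "?s \<in> flat U"
    by (rule flat_transport[OF U order_refl _ z c]) (use m in auto)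
  have "hol (seg U z z) = \<one>\<^bsub>\<pi>\<^esub>"
    using U seg[OF goodD(2)[OF U] z z] unfolding good_def by blast
  then have "?s z = m" using z m act_one by simp
  then show thesis using that[of "enc ?s"] f val_flat[OF goodD(3)[OF U] f] unfolding sc_eq by auto
qed

lemma section_unique:
  assumes U: "U \<in> opens X" "path_connected U" and s: "s \<in> sc U" and t: "t \<in> sc U"
    and z: "z \<in> U" "val s z = val t z"
  shows "s = t"
proof (rule sc_eqI[OF U(1) s t])
  fix y assume y: "y \<in> U"
  have "is_path U y z (seg U y z)" by (rule seg[OF U(2) y z(1)])
  from flatD(2)[OF val_in[OF U(1) s] this] flatD(2)[OF val_in[OF U(1) t] this]
  show "val s y = val t y" using z(2) by simp
qed

text \<open>The isomorphism moves every value to one point \<open>z\<close>. An open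
  \<open>W\<close> inside \<open>U\<close> may be disconnected, so the images are only locally
  constant; conversely, locally constant functions are constant along paths, which is what
  \<open>flat_transport\<close> asks for.\<close>

lemma good_constant:
  assumes U: "good U"
  shows "isomorphic_sheaves U R rep_sheaf (constant_sheaf P)"
proof -
  obtain z where z: "z \<in> U" using U unfolding good_def by blast
  note pc = goodD(2)[OF U] and UX = goodD(3)[OF U] and Uo = goodD(1)[OF U]
  let ?C = "constant_sheaf P"
  define h where "h y = hol (seg U z y)" for y
  have hG: "h y \<in> carrier \<pi>" if "y \<in> U" for y
    unfolding h_def using hol_in[OF is_path_mono[OF seg[OF pc z that] UX]] .
  have hp: "h y' = h y \<otimes>\<^bsub>\<pi>\<^esub> hol p" if p: "is_path U y y' p" for y y' p
    unfolding h_def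
    using good_hol_eq[OF U seg[OF pc z is_pathD(6)[OF p]] is_path_join[OF seg[OF pc z is_pathD(5)[OF p]] p]]
      hol_join[OF is_path_mono[OF seg[OF pc z is_pathD(5)[OF p]] UX] is_path_mono[OF p UX]] by simp
  define \<phi> where "\<phi> = (\<lambda>W\<in>opens U. \<lambda>t\<in>sc W. \<lambda>y\<in>W. act (h y) (val t y))"
  have WX: "\<And>W. W \<in> opens U \<Longrightarrow> W \<in> opens X" using opens_trans[OF _ Uo] .
  have WU: "\<And>W y. W \<in> opens U \<Longrightarrow> y \<in> W \<Longrightarrow> y \<in> U" using opens_sub by blast
  have phi_eq: "\<phi> W t = (\<lambda>y\<in>W. act (h y) (val t y))" if "W \<in> opens U" "t \<in> sc W" for W t
    unfolding \<phi>_def using that by simp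
  have phi: "\<phi> W t y = act (h y) (val t y)" if "W \<in> opens U" "t \<in> sc W" "y \<in> W" for W t y
    unfolding \<phi>_def using that by simp
  have cC: "carrier (sect ?C W) = loc_const_functions W (carrier P)" for W
    by (simp add: constant_sheaf_def)
  have phi_in: "\<phi> W t \<in> carrier (sect ?C W)" if W: "W \<in> opens U" and t: "t \<in> sc W" for W t
    unfolding cC loc_const_functions_def
  proof (intro CollectI conjI ballI)
    have v: "\<And>y. y \<in> W \<Longrightarrow> val t y \<in> carrier P" by (rule val_closed[OF WX[OF W] t])
    show "\<phi> W t \<in> W \<rightarrow>\<^sub>E carrier P"
    proof (rule PiE_I)
      fix y assume y: "y \<in> W"
      show "\<phi> W t y \<in> carrier P" unfolding phi[OF W t y] by (rule act_closed[OF hG[OF WU[OF W y]] v[OF y]])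
    qed (use W t in \<open>simp add: \<phi>_def\<close>)
    fix y assume y: "y \<in> W"
    \<comment> \<open>A path-connected neighbourhood turns constancy along paths into local
      constancy.\<close>
    obtain V where V: "V \<in> opens X" "path_connected V" "y \<in> V" "V \<subseteq> W"
      by (rule path_connected_base[OF WX[OF W] y])
    have "\<phi> W t y' = \<phi> W t y" if y': "y' \<in> V" for y'
    proof -
      have p: "is_path V y' y (seg V y' y)" by (rule seg[OF V(2) y' V(3)])
      have pW: "is_path W y' y (seg V y' y)" by (rule is_path_mono[OF p V(4)])
      have yy: "y' \<in> W" "y' \<in> U" "y \<in> U" using y' y V(4) WU[OF W] by auto
      have pU: "is_path U y' y (seg V y' y)" by (rule is_path_mono[OF pW opens_sub[OF W]])
      show ?thesis
        using hG[OF yy(2)] hol_in[OF is_path_mono[OF pU UX]] v[OF y]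
        by (simp add: phi[OF W t yy(1)] phi[OF W t y] hp[OF pU] act_mult flatD(2)[OF val_in[OF WX[OF W] t] pW])
    qed
    then have "\<phi> W t constant_on V" unfolding constant_on_def by (intro exI ballI)
    moreover have "V \<in> opens W" by (rule opens_restrict[OF V(1,4) opens_sub[OF WX[OF W]]])
    ultimately show "\<exists>V\<in>opens W. y \<in> V \<and> \<phi> W t constant_on V" using V(3) by (intro bexI[of _ V] conjI)
  qed
  have ext: "u = u'" if "u \<in> carrier (sect ?C W)" "u' \<in> carrier (sect ?C W)" "\<And>y. y \<in> W \<Longrightarrow> u y = u' y" for u u' W
    using that unfolding cC loc_const_functions_def by (blast intro: PiE_ext)
  have phi_hom: "\<phi> \<in> sheaf_homs U R rep_sheaf ?C"
    unfolding sheaf_homs_def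
  proof (intro CollectI conjI PiE_I ballI impI)
    fix W assume W: "W \<in> opens U"
    note vc = val_closed[OF WX[OF W]]
    show "\<phi> W \<in> lin_maps R (sect rep_sheaf W) (sect ?C W)"
      unfolding lin_maps_def
    proof (intro CollectI conjI ballI PiE_I)
      fix s assume s: "s \<in> sc W"
      show "\<phi> W s \<in> carrier (sect ?C W)" by (rule phi_in[OF W s])
      fix t assume t: "t \<in> sc W"
      note st = psh.sect_closed(1)[OF WX[OF W] s t]
      show "\<phi> W (s \<oplus>\<^bsub>sect rep_sheaf W\<^esub> t) = \<phi> W s \<oplus>\<^bsub>sect ?C W\<^esub> \<phi> W t"
      proof -
        have "\<phi> W s \<oplus>\<^bsub>sect ?C W\<^esub> \<phi> W t = (\<lambda>y\<in>W. \<phi> W s y \<oplus>\<^bsub>P\<^esub> \<phi> W t y)" by (simp add: constant_sheaf_def)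
        also have "\<dots> = \<phi> W (s \<oplus>\<^bsub>sect rep_sheaf W\<^esub> t)"
          unfolding phi_eq[OF W st]
          by (rule restrict_ext) (simp only: phi[OF W s] phi[OF W t] sc_add[OF WX[OF W] s t] act_add hG WU[OF W] vc s t)
        finally show ?thesis by (rule sym)
      qed
    next
      fix a s assume a: "a \<in> carrier R" and s: "s \<in> sc W"
      note as = psh.sect_closed(2)[OF WX[OF W] s s a]
      show "\<phi> W (a \<odot>\<^bsub>sect rep_sheaf W\<^esub> s) = a \<odot>\<^bsub>sect ?C W\<^esub> \<phi> W s"
      proof -
        have "a \<odot>\<^bsub>sect ?C W\<^esub> \<phi> W s = (\<lambda>y\<in>W. a \<odot>\<^bsub>P\<^esub> \<phi> W s y)" by (simp add: constant_sheaf_def)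
        also have "\<dots> = \<phi> W (a \<odot>\<^bsub>sect rep_sheaf W\<^esub> s)"
          unfolding phi_eq[OF W as]
          by (rule restrict_ext) (simp only: phi[OF W s] sc_smult[OF WX[OF W] s a] act_smult hG WU[OF W] vc s a)
        finally show ?thesis by (rule sym)
      qed
    qed (use W in \<open>simp add: \<phi>_def\<close>)
    fix V s assume V: "V \<in> opens U" "V \<subseteq> W" and s: "s \<in> sc W"
    note rs = sc_rstr[OF WX[OF W] WX[OF V(1)] V(2) s]
    have "rstr ?C W V (\<phi> W s) = restrict (\<phi> W s) V"
      using phi_in[OF W s] unfolding cC by (simp add: constant_sheaf_def)
    also have "\<dots> = \<phi> V (rstr rep_sheaf W V s)"
      unfolding phi_eq[OF V(1) rs(1)]
      by (rule restrict_ext) (simp only: phi[OF W s] rs(2) subsetD[OF V(2)])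
    finally show "\<phi> V (rstr rep_sheaf W V s) = rstr ?C W V (\<phi> W s)" by (rule sym)
  qed (simp add: \<phi>_def)
  have bij: "bij_betw (\<phi> W) (sc W) (carrier (sect ?C W))" if W: "W \<in> opens U" for W
    unfolding bij_betw_def
  proof (intro conjI inj_onI subset_antisym image_subsetI subsetI)
    fix s t assume s: "s \<in> sc W" and t: "t \<in> sc W" and e: "\<phi> W s = \<phi> W t"
    show "s = t"
    proof (rule sc_eqI[OF WX[OF W] s t])
      fix y assume y: "y \<in> W"
      have "act (h y) (val s y) = act (h y) (val t y)"
        using fun_cong[OF e, of y] by (simp add: phi[OF W s y] phi[OF W t y])
      then show "val s y = val t y"
        using act_inv[OF hG[OF WU[OF W y]]] val_closed[OF WX[OF W] s y] val_closed[OF WX[OF W] t y] by metis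
    qed
  next
    fix s assume "s \<in> sc W" then show "\<phi> W s \<in> carrier (sect ?C W)" by (rule phi_in[OF W])
  next
    fix u assume u: "u \<in> carrier (sect ?C W)"
    then have uL: "u \<in> loc_const_functions W (carrier P)" by (simp only: cC)
    then have uP: "u \<in> W \<rightarrow>\<^sub>E carrier P" by (simp add: loc_const_functions_def)
    have const: "u y = u y'" if p: "is_path W y y' p" for y y' p
    proof -
      have "u (p 0) = u (p 1)"
      proof (rule path_local_induct[OF p, where Q = "\<lambda>a b. u (p a) = u (p b)"])
        fix a :: real assume a: "a \<in> {0..1}"
        obtain V where V: "V \<in> opens W" "p a \<in> V" "u constant_on V"
          by (rule loc_constD[OF uL is_path_in[OF p a]])
        obtain k where k: "\<And>y. y \<in> V \<Longrightarrow> u y = k" using V(3) unfolding constant_on_def by blast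
        have "u (p a) = u (p b)" if "is_path V (p a) (p b) (p \<circ> linepath a b)" for b
          using k[OF V(2)] k[OF is_pathD(6)[OF that]] by simp
        then show "\<exists>V. V \<in> opens W \<and> p a \<in> V \<and> (\<forall>b\<in>{0..1}. is_path V (p a) (p b) (p \<circ> linepath a b) \<longrightarrow> u (p a) = u (p b))"
          using V by (intro exI[of _ V] conjI ballI impI)
      qed simp_all
      then show ?thesis using is_path_ends[OF p] by simp
    qed
    let ?s = "\<lambda>y\<in>W. act (inv\<^bsub>\<pi>\<^esub> hol (seg U z y)) (u y)"
    have f: "?s \<in> flat W" by (rule flat_transport[OF U opens_sub[OF W] uP z const])
    have es: "enc ?s \<in> sc W" unfolding sc_eq using f by (rule imageI)
    have "\<phi> W (enc ?s) = u"
    proof (rule ext[OF phi_in[OF W es] u])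
      fix y assume y: "y \<in> W"
      then have "u y \<in> carrier P" using uP by blast
      then show "\<phi> W (enc ?s) y = u y"
        using y act_inv'[OF hG[OF WU[OF W y]]]
        by (simp add: phi[OF W es y] val_flat[OF opens_sub[OF WX[OF W]] f] h_def)
    qed
    then show "u \<in> \<phi> W ` sc W" by (rule image_eqI[OF sym es])
  qed
  show ?thesis
    unfolding isomorphic_sheaves_def
    using phi_hom sheaf_iso_of_bij[OF presheaf_of_modules_open[OF presheaf_rep_sheaf Uo] phi_hom bij] by blast
qed

lemma locally_constant_rep_sheaf: "locally_constant_sheaf X R rep_sheaf"
proof -
  have "\<Union>{U. good U} = X"
  proof
    show "X \<subseteq> \<Union>{U. good U}"
    proof
      fix y assume "y \<in> X"
      then obtain W where "good W" "y \<in> W" using good_base[of X y] by auto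
      then show "y \<in> \<Union>{U. good U}" by blast
    qed
  qed (use goodD(3) in blast)
  then show ?thesis
    unfolding locally_constant_sheaf_def
    using sheaf_rep_sheaf good_constant mod
    by (intro conjI exI[of _ "{U. good U}"] ballI exI[of _ P] subsetI) (simp_all add: good_def)
qed

end

section \<open>Full faithfulness\<close>

locale two_reps = rep_setup X x R enc + P: pi_rep X x R enc P act + Q: pi_rep X x R enc Q act'
  for X :: "'a::topological_space set" and x :: 'a and R :: "('r, 'e) ring_scheme" (structure)
    and enc :: "('a \<Rightarrow> 'u) \<Rightarrow> 'u" and P :: "('r, 'u) module" and act :: "(real \<Rightarrow> 'a) set \<Rightarrow> 'u \<Rightarrow> 'u"
    and Q :: "('r, 'u) module" and act' :: "(real \<Rightarrow> 'a) set \<Rightarrow> 'u \<Rightarrow> 'u"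
begin

definition equivariant_maps :: "('u \<Rightarrow> 'u) set" where
  "equivariant_maps = {f \<in> lin_maps R P Q. \<forall>g\<in>carrier \<pi>. \<forall>m\<in>carrier P. f (act g m) = act' g (f m)}"

definition gmap :: "('u \<Rightarrow> 'u) \<Rightarrow> 'a set \<Rightarrow> 'u \<Rightarrow> 'u" where
  "gmap f = (\<lambda>U\<in>opens X. \<lambda>t\<in>P.sc U. enc (\<lambda>y\<in>U. f (val t y)))"

lemma equivariant_mapsD:
  assumes "f \<in> equivariant_maps"
  shows "f \<in> lin_maps R P Q"
    "g \<in> carrier \<pi> \<Longrightarrow> m \<in> carrier P \<Longrightarrow> f (act g m) = act' g (f m)"
  using assms unfolding equivariant_maps_def by simp_all

lemma gmap_flat:
  assumes f: "f \<in> equivariant_maps" and U: "U \<in> opens X" and t: "t \<in> P.sc U"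
  shows "(\<lambda>y\<in>U. f (val t y)) \<in> Q.flat U"
  unfolding Q.flat_def
proof (intro CollectI conjI allI impI PiE_I)
  note fl = equivariant_mapsD(1)[OF f]
  fix y assume y: "y \<in> U"
  show "(\<lambda>y\<in>U. f (val t y)) y \<in> carrier Q"
    using y lin_maps_closed[OF fl P.val_closed[OF U t y]] by simp
next
  fix y z p assume p: "is_path U y z p"
  have "hol p \<in> carrier \<pi>" by (rule hol_in[OF is_path_mono[OF p opens_sub[OF U]]])
  then show "(\<lambda>y\<in>U. f (val t y)) y = act' (hol p) ((\<lambda>y\<in>U. f (val t y)) z)"
    using is_pathD(5,6)[OF p] P.flatD(2)[OF P.val_in[OF U t] p]
      equivariant_mapsD(2)[OF f, of "hol p" "val t z"] P.val_closed[OF U t] by simp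
qed simp

lemma gmap_apply:
  assumes f: "f \<in> equivariant_maps" and U: "U \<in> opens X" and t: "t \<in> P.sc U"
  shows "gmap f U t \<in> Q.sc U" "y \<in> U \<Longrightarrow> val (gmap f U t) y = f (val t y)"
proof -
  have e: "gmap f U t = enc (\<lambda>y\<in>U. f (val t y))" unfolding gmap_def using U t by simp
  show "gmap f U t \<in> Q.sc U" unfolding e Q.sc_eq by (rule imageI[OF gmap_flat[OF f U t]])
  show "y \<in> U \<Longrightarrow> val (gmap f U t) y = f (val t y)"
    unfolding e Q.val_flat[OF opens_sub[OF U] gmap_flat[OF f U t]] by simp
qed

lemma gmap_hom:
  assumes f: "f \<in> equivariant_maps"
  shows "gmap f \<in> sheaf_homs X R P.rep_sheaf Q.rep_sheaf"
proof (rule Q.sheaf_hom_intoI[OF P.presheaf_rep_sheaf])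
  note fl = equivariant_mapsD(1)[OF f] and g = gmap_apply(2)[OF f] and sc = P.psh.sect_closed
  fix U s y assume U: "U \<in> opens X" and s: "s \<in> P.sc U"
  show "gmap f U s \<in> Q.sc U" by (rule gmap_apply(1)[OF f U s])
  { fix t assume t: "t \<in> P.sc U" and y: "y \<in> U"
    show "val (gmap f U (s \<oplus>\<^bsub>sect P.rep_sheaf U\<^esub> t)) y = val (gmap f U s) y \<oplus>\<^bsub>Q\<^esub> val (gmap f U t) y"
      by (simp only: g[OF U sc(1)[OF U s t] y] g[OF U s y] g[OF U t y] P.sc_add[OF U s t y]
          lin_maps_add[OF fl P.val_closed[OF U s y] P.val_closed[OF U t y]]) }
  { fix a assume a: "a \<in> carrier R" and y: "y \<in> U"
    show "val (gmap f U (a \<odot>\<^bsub>sect P.rep_sheaf U\<^esub> s)) y = a \<odot>\<^bsub>Q\<^esub> val (gmap f U s) y"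
      by (simp only: g[OF U sc(2)[OF U s s a] y] g[OF U s y] P.sc_smult[OF U s a y]
          lin_maps_smult[OF fl a P.val_closed[OF U s y]]) }
  { fix V assume V: "V \<in> opens X" "V \<subseteq> U" and y: "y \<in> V"
    note rs = P.sc_rstr[OF U V s]
    show "val (gmap f V (rstr P.rep_sheaf U V s)) y = val (gmap f U s) y"
      by (simp only: g[OF V(1) rs(1) y] rs(2)[OF y] g[OF U s subsetD[OF V(2) y]]) }
qed (simp_all add: gmap_def)

text \<open>Every \<open>m\<close> is the value at \<open>x\<close> of a section over a good
  neighbourhood, so \<open>f m\<close> can be read off from \<open>gmap f\<close>.\<close>

lemma gmap_inj:
  assumes f: "f \<in> equivariant_maps" and f': "f' \<in> equivariant_maps" and e: "gmap f = gmap f'"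
  shows "f = f'"
proof (rule PiE_ext[OF lin_maps_fun[OF equivariant_mapsD(1)[OF f]] lin_maps_fun[OF equivariant_mapsD(1)[OF f']]])
  fix m assume m: "m \<in> carrier P"
  obtain W where W: "good W" "x \<in> W" by (rule good_base[of X x]) (use x_in in auto)
  obtain t where t: "t \<in> P.sc W" "val t x = m" by (rule P.good_section[OF W m])
  show "f m = f' m"
    using gmap_apply(2)[OF f goodD(1)[OF W(1)] t(1) W(2)] gmap_apply(2)[OF f' goodD(1)[OF W(1)] t(1) W(2)] t(2) e
    by simp
qed

text \<open>Two sections with the same value at \<open>y\<close> coincide on a good neighbourhood of
  \<open>y\<close>. Hence a morphism, although given on sections, acts on the values at
  \<open>y\<close>.\<close>

lemma sheaf_hom_val_local:
  assumes phi: "\<phi> \<in> sheaf_homs X R P.rep_sheaf Q.rep_sheaf"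
    and U: "U \<in> opens X" "t \<in> P.sc U" "y \<in> U" and V: "V \<in> opens X" "s \<in> P.sc V" "y \<in> V"
    and e: "val t y = val s y"
  shows "val (\<phi> U t) y = val (\<phi> V s) y"
proof -
  obtain W where W: "good W" "y \<in> W" "W \<subseteq> U \<inter> V"
    by (rule good_base[OF opens_Int[OF U(1) V(1)]]) (use U V in auto)
  have WU: "W \<subseteq> U" and WV: "W \<subseteq> V" using W(3) by auto
  note Wo = goodD(1)[OF W(1)]
  note rt = P.sc_rstr[OF U(1) Wo WU U(2)] and rs = P.sc_rstr[OF V(1) Wo WV V(2)]
  have eq: "rstr P.rep_sheaf U W t = rstr P.rep_sheaf V W s"
    by (rule P.section_unique[OF Wo goodD(2)[OF W(1)] rt(1) rs(1) W(2)])
       (simp only: rt(2)[OF W(2)] rs(2)[OF W(2)] e)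
  have "val (\<phi> U t) y = val (rstr Q.rep_sheaf U W (\<phi> U t)) y"
    by (rule Q.sc_rstr(2)[OF U(1) Wo WU sheaf_homs_closed[OF phi U(1,2)] W(2), symmetric])
  also have "\<dots> = val (rstr Q.rep_sheaf V W (\<phi> V s)) y"
    by (simp only: sheaf_homs_rstr[OF phi U(1) Wo WU U(2), symmetric]
        sheaf_homs_rstr[OF phi V(1) Wo WV V(2), symmetric] eq)
  also have "\<dots> = val (\<phi> V s) y"
    by (rule Q.sc_rstr(2)[OF V(1) Wo WV sheaf_homs_closed[OF phi V(1,2)] W(2)])
  finally show ?thesis .
qed

lemma gmap_surj:
  assumes phi: "\<phi> \<in> sheaf_homs X R P.rep_sheaf Q.rep_sheaf"
  shows "\<exists>f\<in>equivariant_maps. gmap f = \<phi>"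
proof -
  \<comment> \<open>\<open>F y\<close> is the map on fibres over \<open>y\<close>; the maps over different points correspond along paths.\<close>
  define F where "F y m = (SOME n. \<exists>W t. good W \<and> y \<in> W \<and> t \<in> P.sc W \<and> val t y = m \<and> n = val (\<phi> W t) y)" for y m
  have F: "val (\<phi> U t) y = F y (val t y)" if U: "U \<in> opens X" "t \<in> P.sc U" "y \<in> U" for U t y
  proof -
    obtain W where W: "good W" "y \<in> W" by (rule good_base[OF U(1,3)])
    obtain s where s: "s \<in> P.sc W" "val s y = val t y"
      by (rule P.good_section[OF W P.val_closed[OF U]])
    then have "\<exists>n W s. good W \<and> y \<in> W \<and> s \<in> P.sc W \<and> val s y = val t y \<and> n = val (\<phi> W s) y"
      using W by blast
    from someI_ex[OF this] obtain W s where W: "good W" "y \<in> W" and s: "s \<in> P.sc W" "val s y = val t y"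
      and n: "F y (val t y) = val (\<phi> W s) y" unfolding F_def by blast
    show ?thesis unfolding n
      by (rule sheaf_hom_val_local[OF phi U goodD(1)[OF W(1)] s(1) W(2) s(2)[symmetric]])
  qed
  have sec: "\<exists>U t. good U \<and> U \<subseteq> V \<and> y \<in> U \<and> t \<in> P.sc U \<and> val t y = m" if y: "y \<in> V" and V: "V \<in> opens X" and m: "m \<in> carrier P" for y m V
  proof -
    obtain W where W: "good W" "y \<in> W" "W \<subseteq> V" by (rule good_base[OF V y])
    obtain s where "s \<in> P.sc W" "val s y = m" by (rule P.good_section[OF W(1,2) m])
    then show ?thesis using W by blast
  qed
  have Xo: "X \<in> opens X" by simp
  have Fc: "F y m \<in> carrier Q" if y: "y \<in> X" and m: "m \<in> carrier P" for y m
  proof -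
    obtain U t where U: "good U" "y \<in> U" and t: "t \<in> P.sc U" "val t y = m"
      using sec[OF y Xo m] by blast
    show ?thesis
      using F[OF goodD(1)[OF U(1)] t(1) U(2)] t(2)
        Q.val_closed[OF goodD(1)[OF U(1)] sheaf_homs_closed[OF phi goodD(1)[OF U(1)] t(1)] U(2)] by simp
  qed
  have Fh: "F y (act (hol p) m) = act' (hol p) (F z m)" if p: "is_path X y z p" and m: "m \<in> carrier P" for y z p m
  proof -
    note seg = is_path_subpath[OF p]
    define T where "T a b \<longleftrightarrow> (\<forall>m\<in>carrier P. F (p a) (act (hol (p \<circ> linepath a b)) m) =
      act' (hol (p \<circ> linepath a b)) (F (p b) m))" for a b :: real
    have Fcp: "F (p a) m \<in> carrier Q" if "a \<in> {0..1}" "m \<in> carrier P" for a m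
      by (rule Fc[OF is_path_in[OF p that(1)] that(2)])
    have "T 0 1"
    proof (rule path_local_induct[OF p])
      fix a b :: real assume ab: "a \<in> {0..1}" "b \<in> {0..1}" and T: "T a b"
      let ?h = "hol (p \<circ> linepath a b)"
      note h = hol_in[OF seg[OF ab]]
      have ih: "inv\<^bsub>\<pi>\<^esub> ?h \<in> carrier \<pi>" using h by simp
      show "T b a"
        unfolding T_def hol_segment_reverse[OF p ab]
      proof
        fix m assume m: "m \<in> carrier P"
        let ?m = "act (inv\<^bsub>\<pi>\<^esub> ?h) m"
        have m': "?m \<in> carrier P" by (rule P.act_closed[OF ih m])
        have "F (p a) m = act' ?h (F (p b) ?m)"
          using T m' unfolding T_def by (metis P.act_inv'[OF h m])
        then show "F (p b) ?m = act' (inv\<^bsub>\<pi>\<^esub> ?h) (F (p a) m)"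
          using Q.act_inv[OF h Fcp[OF ab(2) m']] by simp
      qed
    next
      fix a b c :: real assume abc: "a \<in> {0..1}" "b \<in> {0..1}" "c \<in> {0..1}" and T: "T a b" "T b c"
      note h1 = hol_in[OF seg[OF abc(1,2)]] and h2 = hol_in[OF seg[OF abc(2,3)]]
      show "T a c"
        unfolding T_def hol_segment_join[OF p abc]
      proof
        fix m assume m: "m \<in> carrier P"
        show "F (p a) (act (hol (p \<circ> linepath a b) \<otimes>\<^bsub>\<pi>\<^esub> hol (p \<circ> linepath b c)) m) =
          act' (hol (p \<circ> linepath a b) \<otimes>\<^bsub>\<pi>\<^esub> hol (p \<circ> linepath b c)) (F (p c) m)"
          using T m P.act_closed[OF h2 m] unfolding T_def P.act_mult[OF h1 h2 m] Q.act_mult[OF h1 h2 Fcp[OF abc(3) m]]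
          by simp
      qed
    next
      fix a :: real assume a: "a \<in> {0..1}"
      obtain W where W: "good W" "p a \<in> W" by (rule good_base[OF Xo is_path_in[OF p a]])
      \<comment> \<open>Inside a good \<open>W\<close> one section \<open>t\<close> has the
        prescribed value at \<open>p b\<close>. Both \<open>t\<close> and its image under the
        morphism are flat, which relates the two ends.\<close>
      have "T a b" if b: "b \<in> {0..1}" and q: "is_path W (p a) (p b) (p \<circ> linepath a b)" for b
        unfolding T_def
      proof
        fix m assume m: "m \<in> carrier P"
        note Wo = goodD(1)[OF W(1)] and qW = is_pathD(5,6)[OF q]
        obtain t where t: "t \<in> P.sc W" "val t (p b) = m" by (rule P.good_section[OF W(1) qW(2) m])
        note ft = sheaf_homs_closed[OF phi Wo t(1)]
        have "F (p a) (act (hol (p \<circ> linepath a b)) m) = val (\<phi> W t) (p a)"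
          by (simp only: F[OF Wo t(1) qW(1)] P.flatD(2)[OF P.val_in[OF Wo t(1)] q] t(2))
        also have "\<dots> = act' (hol (p \<circ> linepath a b)) (F (p b) m)"
          by (simp only: Q.flatD(2)[OF Q.val_in[OF Wo ft] q] F[OF Wo t(1) qW(2)] t(2))
        finally show "F (p a) (act (hol (p \<circ> linepath a b)) m) = act' (hol (p \<circ> linepath a b)) (F (p b) m)" .
      qed
      then show "\<exists>W. W \<in> opens X \<and> p a \<in> W \<and> (\<forall>b\<in>{0..1}. is_path W (p a) (p b) (p \<circ> linepath a b) \<longrightarrow> T a b)"
        using W(2) goodD(1)[OF W(1)] by (intro exI[of _ W] conjI ballI impI)
    qed
    then show ?thesis using m unfolding T_def is_path_eq_comp(3)[OF p] is_path_ends[OF p] by blast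
  qed
  define f where "f = restrict (F x) (carrier P)"
  have Ff: "F y m = f m" if y: "y \<in> X" and m: "m \<in> carrier P" for y m
  proof -
    have "F x (act \<one>\<^bsub>\<pi>\<^esub> m) = act' \<one>\<^bsub>\<pi>\<^esub> (F y m)"
      using Fh[OF base_path[OF y] m] by (simp only: hol_base_path[OF y])
    then show ?thesis using m unfolding f_def by (simp add: P.act_one Q.act_one Fc[OF y m])
  qed
  have lin: "f \<in> lin_maps R P Q"
    unfolding lin_maps_def
  proof (intro CollectI conjI PiE_I ballI)
    fix m assume m: "m \<in> carrier P"
    show "f m \<in> carrier Q" unfolding Ff[OF x_in m, symmetric] by (rule Fc[OF x_in m])
    obtain U t where U: "good U" "x \<in> U" and t: "t \<in> P.sc U" "val t x = m" using sec[OF x_in Xo m] by blast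
    note Uo = goodD(1)[OF U(1)]
    note ft = sheaf_homs_closed[OF phi Uo t(1)]
    have fm: "f m = val (\<phi> U t) x" using F[OF Uo t(1) U(2)] Ff[OF x_in m] t(2) by simp
    fix n assume n: "n \<in> carrier P"
    obtain s where s: "s \<in> P.sc U" "val s x = n" by (rule P.good_section[OF U n])
    note fs = sheaf_homs_closed[OF phi Uo s(1)]
    have fn: "f n = val (\<phi> U s) x" using F[OF Uo s(1) U(2)] Ff[OF x_in n] s(2) by simp
    note ts = P.psh.sect_closed(1)[OF Uo t(1) s(1)]
    have "f (m \<oplus>\<^bsub>P\<^esub> n) = val (\<phi> U (t \<oplus>\<^bsub>sect P.rep_sheaf U\<^esub> s)) x"
      using F[OF Uo ts U(2)] Ff[OF x_in P.P.add.m_closed[OF m n]] by (simp only: P.sc_add[OF Uo t(1) s(1) U(2)] t(2) s(2))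
    also have "\<dots> = f m \<oplus>\<^bsub>Q\<^esub> f n"
      by (simp only: lin_maps_add[OF sheaf_homs_lin[OF phi Uo] t(1) s(1)] Q.sc_add[OF Uo ft fs U(2)] fm fn)
    finally show "f (m \<oplus>\<^bsub>P\<^esub> n) = f m \<oplus>\<^bsub>Q\<^esub> f n" .
  next
    fix a m assume a: "a \<in> carrier R" and m: "m \<in> carrier P"
    obtain U t where U: "good U" "x \<in> U" and t: "t \<in> P.sc U" "val t x = m" using sec[OF x_in Xo m] by blast
    note Uo = goodD(1)[OF U(1)]
    note ft = sheaf_homs_closed[OF phi Uo t(1)]
    have fm: "f m = val (\<phi> U t) x" using F[OF Uo t(1) U(2)] Ff[OF x_in m] t(2) by simp
    note as = P.psh.sect_closed(2)[OF Uo t(1) t(1) a]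
    have "f (a \<odot>\<^bsub>P\<^esub> m) = val (\<phi> U (a \<odot>\<^bsub>sect P.rep_sheaf U\<^esub> t)) x"
      using F[OF Uo as U(2)] Ff[OF x_in P.P.smult_closed[OF a m]] by (simp only: P.sc_smult[OF Uo t(1) a U(2)] t(2))
    also have "\<dots> = a \<odot>\<^bsub>Q\<^esub> f m"
      by (simp only: lin_maps_smult[OF sheaf_homs_lin[OF phi Uo] a t(1)] Q.sc_smult[OF Uo ft a U(2)] fm)
    finally show "f (a \<odot>\<^bsub>P\<^esub> m) = a \<odot>\<^bsub>Q\<^esub> f m" .
  qed (simp add: f_def)
  have "f (act g m) = act' g (f m)" if g: "g \<in> carrier \<pi>" and m: "m \<in> carrier P" for g m
  proof -
    obtain p where p: "is_path X x x p" "hol p = g" by (rule hol_surj[OF g])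
    show ?thesis
      using Fh[OF p(1) m] Ff[OF x_in m] Ff[OF x_in P.act_closed[OF g m]] by (simp only: p(2))
  qed
  then have fE: "f \<in> equivariant_maps" unfolding equivariant_maps_def using lin by simp
  have "gmap f = \<phi>"
  proof (rule sheaf_homs_eqI[OF gmap_hom[OF fE] phi])
    fix U s assume U: "U \<in> opens X" and s: "s \<in> P.sc U"
    show "gmap f U s = \<phi> U s"
    proof (rule Q.sc_eqI[OF U gmap_apply(1)[OF fE U s] sheaf_homs_closed[OF phi U s]])
      fix y assume y: "y \<in> U"
      have yX: "y \<in> X" using y opens_sub[OF U] by blast
      show "val (gmap f U s) y = val (\<phi> U s) y"
        by (simp only: gmap_apply(2)[OF fE U s y] F[OF U s y] Ff[OF yX P.val_closed[OF U s y]])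
    qed
  qed
  then show ?thesis using fE by blast
qed

lemma gmap_bij: "bij_betw gmap equivariant_maps (sheaf_homs X R P.rep_sheaf Q.rep_sheaf)"
  unfolding bij_betw_def
proof (intro conjI inj_onI subset_antisym image_subsetI subsetI)
  fix \<phi> assume "\<phi> \<in> sheaf_homs X R P.rep_sheaf Q.rep_sheaf"
  from gmap_surj[OF this] show "\<phi> \<in> gmap ` equivariant_maps" by blast
qed (simp_all add: gmap_inj gmap_hom)

end

section \<open>Germs and parallel transport\<close>

locale lc_sheaf = sheaf_of_modules X R F
  for X :: "'a::topological_space set" and R :: "('r, 'e) ring_scheme" and F :: "('a, 'r, 'u) presheaf" +
  assumes lpc: "locally path_connected X"
    and locally_constant: "\<exists>\<U> \<subseteq> opens X. \<Union>\<U> = X \<and>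
        (\<forall>U\<in>\<U>. \<exists>M :: ('r, 'u) module. Module.module R M \<and> isomorphic_sheaves U R F (constant_sheaf M))"
begin

abbreviation "S U \<equiv> carrier (sect F U)"

definition germ :: "'a \<Rightarrow> 'a set \<Rightarrow> 'u \<Rightarrow> ('a set \<times> 'u) set" where
  "germ y U s = {(V, t). V \<in> opens X \<and> y \<in> V \<and> t \<in> S V \<and>
     (\<exists>W\<in>opens X. y \<in> W \<and> W \<subseteq> U \<and> W \<subseteq> V \<and> rstr F U W s = rstr F V W t)}"

definition stalk :: "'a \<Rightarrow> ('a set \<times> 'u) set set" where
  "stalk y = {germ y U s | U s. U \<in> opens X \<and> y \<in> U \<and> s \<in> S U}"

lemma germ_in_stalk: "U \<in> opens X \<Longrightarrow> y \<in> U \<Longrightarrow> s \<in> S U \<Longrightarrow> germ y U s \<in> stalk y"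
  unfolding stalk_def by (rule CollectI, rule exI[of _ U], rule exI[of _ s]) simp

lemma stalkE:
  assumes "a \<in> stalk y" obtains U s where "U \<in> opens X" "y \<in> U" "s \<in> S U" "a = germ y U s"
  using assms unfolding stalk_def by (elim CollectE exE conjE) simp

lemma rstr_eq_mono:
  assumes U: "U \<in> opens X" "s \<in> S U" and V: "V \<in> opens X" "t \<in> S V"
    and W: "W \<in> opens X" "W \<subseteq> U" "W \<subseteq> V" "rstr F U W s = rstr F V W t" and W': "W' \<in> opens X" "W' \<subseteq> W"
  shows "rstr F U W' s = rstr F V W' t"
  using rstr_rstr[OF U(1) W(1) W'(1,2) W(2) U(2)] rstr_rstr[OF V(1) W(1) W'(1,2) W(3) V(2)] W(4) by simp

lemma germ_eqI:
  assumes U: "U \<in> opens X" "s \<in> S U" and V: "V \<in> opens X" "t \<in> S V"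
    and W: "W \<in> opens X" "y \<in> W" "W \<subseteq> U" "W \<subseteq> V" "rstr F U W s = rstr F V W t"
  shows "germ y U s = germ y V t"
proof -
  have *: "germ y U s \<subseteq> germ y V t"
    if U: "U \<in> opens X" "s \<in> S U" and V: "V \<in> opens X" "t \<in> S V"
      and W: "W \<subseteq> U" "W \<subseteq> V" "rstr F U W s = rstr F V W t" for U V s t
  proof
    fix c assume "c \<in> germ y U s"
    then obtain A r N where c: "c = (A, r)" and A: "A \<in> opens X" "y \<in> A" "r \<in> S A"
      and N: "N \<in> opens X" "y \<in> N" "N \<subseteq> U" "N \<subseteq> A" "rstr F U N s = rstr F A N r"
      unfolding germ_def by auto
    have i: "N \<inter> W \<in> opens X" by (rule opens_Int[OF N(1) \<open>W \<in> opens X\<close>])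
    have "rstr F V (N \<inter> W) t = rstr F A (N \<inter> W) r"
      using rstr_eq_mono[OF U V \<open>W \<in> opens X\<close> W i Int_lower2]
        rstr_eq_mono[OF U A(1,3) N(1,3,4,5) i Int_lower1] by simp
    moreover have "y \<in> N \<inter> W" "N \<inter> W \<subseteq> V" "N \<inter> W \<subseteq> A" using N W \<open>y \<in> W\<close> by auto
    ultimately show "c \<in> germ y V t" unfolding germ_def c using A i by blast
  qed
  show ?thesis using *[OF U V W(3,4,5)] *[OF V U W(4,3) W(5)[symmetric]] by (rule subset_antisym)
qed

lemma germ_self: "U \<in> opens X \<Longrightarrow> y \<in> U \<Longrightarrow> s \<in> S U \<Longrightarrow> (U, s) \<in> germ y U s"
  unfolding germ_def by auto

lemma germ_eqE:
  assumes U: "U \<in> opens X" "s \<in> S U" and V: "V \<in> opens X" "t \<in> S V" "y \<in> V" and e: "germ y U s = germ y V t"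
  obtains W where "W \<in> opens X" "y \<in> W" "W \<subseteq> U" "W \<subseteq> V" "rstr F U W s = rstr F V W t"
proof -
  have "(V, t) \<in> germ y U s" unfolding e by (rule germ_self[OF V(1,3,2)])
  then have "\<exists>W\<in>opens X. y \<in> W \<and> W \<subseteq> U \<and> W \<subseteq> V \<and> rstr F U W s = rstr F V W t" unfolding germ_def by simp
  then show thesis using that by blast
qed

lemma germ_rstr:
  assumes U: "U \<in> opens X" "s \<in> S U" and V: "V \<in> opens X" "V \<subseteq> U" "y \<in> V"
  shows "germ y V (rstr F U V s) = germ y U s"
  by (rule germ_eqI[OF V(1) rstr_closed[OF U(1) V(1,2) U(2)] U V(1,3) order_refl V(2)])
     (rule rstr_id[OF V(1) rstr_closed[OF U(1) V(1,2) U(2)]])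

text \<open>The open sets on which \<open>s\<close> and \<open>t\<close> restrict to the same
  section cover \<open>U\<close>, and both are gluings of the resulting compatible family, so the
  uniqueness half of \<open>glue\<close> applies.\<close>

lemma germ_ext:
  assumes U: "U \<in> opens X" and s: "s \<in> S U" and t: "t \<in> S U" and e: "\<And>y. y \<in> U \<Longrightarrow> germ y U s = germ y U t"
  shows "s = t"
proof -
  define \<U> where "\<U> = {W. W \<in> opens X \<and> W \<subseteq> U \<and> rstr F U W s = rstr F U W t}"
  have o: "\<U> \<subseteq> opens X" unfolding \<U>_def by (rule subsetI) simp
  have UU: "\<Union>\<U> = U"
  proof (rule subset_antisym)
    show "U \<subseteq> \<Union>\<U>"
    proof
      fix y assume y: "y \<in> U"
      obtain W where W: "W \<in> opens X" "y \<in> W" "W \<subseteq> U" "rstr F U W s = rstr F U W t"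
        by (rule germ_eqE[OF U s U t y e[OF y]])
      then have "W \<in> \<U>" unfolding \<U>_def by simp
      then show "y \<in> \<Union>\<U>" using W(2) by blast
    qed
  qed (auto simp: \<U>_def)
  have "\<exists>!r. r \<in> S (\<Union>\<U>) \<and> (\<forall>V\<in>\<U>. rstr F (\<Union>\<U>) V r = rstr F U V s)"
  proof (rule glue[OF o])
    fix V assume V: "V \<in> \<U>"
    then have V': "V \<in> opens X" "V \<subseteq> U" unfolding \<U>_def by simp_all
    then show "rstr F U V s \<in> S V" using rstr_closed[OF U _ _ s] by simp
    fix W assume W: "W \<in> \<U>"
    then have W': "W \<in> opens X" "W \<subseteq> U" unfolding \<U>_def by simp_all
    note i = opens_Int[OF V'(1) W'(1)]
    show "rstr F V (V \<inter> W) (rstr F U V s) = rstr F W (V \<inter> W) (rstr F U W s)"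
      by (simp only: rstr_rstr[OF U V'(1) i Int_lower1 V'(2) s] rstr_rstr[OF U W'(1) i Int_lower2 W'(2) s])
  qed
  moreover have "s \<in> S (\<Union>\<U>) \<and> (\<forall>V\<in>\<U>. rstr F (\<Union>\<U>) V s = rstr F U V s)" unfolding UU using s by simp
  moreover have "t \<in> S (\<Union>\<U>) \<and> (\<forall>V\<in>\<U>. rstr F (\<Union>\<U>) V t = rstr F U V s)" unfolding UU using t
    by (simp add: \<U>_def)
  ultimately show "s = t" by (blast elim: ex1E)
qed

text \<open>This is the form in which transport uses local constancy. It mentions neither a module
  nor an isomorphism with a constant sheaf, so no choice of trivialisation has to be followed from
  one neighbourhood to the next.\<close>

definition triv :: "'a set \<Rightarrow> bool" where
  "triv U \<longleftrightarrow> U \<in> opens X \<and> path_connected U \<and> (\<forall>y\<in>U. bij_betw (germ y U) (S U) (stalk y))"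

lemma trivD: "triv U \<Longrightarrow> U \<in> opens X" "triv U \<Longrightarrow> path_connected U"
  unfolding triv_def by simp_all

lemma triv_inj: "triv U \<Longrightarrow> y \<in> U \<Longrightarrow> s \<in> S U \<Longrightarrow> t \<in> S U \<Longrightarrow> germ y U s = germ y U t \<Longrightarrow> s = t"
  unfolding triv_def bij_betw_def inj_on_def by blast

lemma triv_surj:
  assumes "triv U" "y \<in> U" "a \<in> stalk y" obtains s where "s \<in> S U" "germ y U s = a"
proof -
  have "a \<in> germ y U ` S U" using assms unfolding triv_def bij_betw_def by simp
  then show thesis using that by blast
qed

text \<open>On a path-connected \<open>W\<close> inside a member of the given cover, sections
  correspond to locally constant, hence constant, functions. Such a function is determined by its
  germ at any point, and the value of a germ extends as a constant to all of
  \<open>W\<close>.\<close>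

lemma triv_base:
  assumes U: "U \<in> opens X" and y: "y \<in> U"
  obtains W where "triv W" "y \<in> W" "W \<subseteq> U"
proof -
  obtain \<U> where \<U>: "\<U> \<subseteq> opens X" "\<Union>\<U> = X"
    and iso: "\<forall>U\<in>\<U>. \<exists>M :: ('r, 'u) module. Module.module R M \<and> isomorphic_sheaves U R F (constant_sheaf M)"
    using locally_constant by (elim exE conjE)
  have "y \<in> \<Union>\<U>" using \<U>(2) opens_sub[OF U] y by auto
  then obtain V where V: "V \<in> \<U>" "y \<in> V" by (rule UnionE)
  then obtain M :: "('r, 'u) module" where M: "Module.module R M" and i: "isomorphic_sheaves V R F (constant_sheaf M)"
    using iso by blast
  let ?C = "constant_sheaf M :: ('a, 'r, 'a \<Rightarrow> 'u) presheaf"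
  obtain \<phi> \<psi> where phi: "\<phi> \<in> sheaf_homs V R F ?C" and psi: "\<psi> \<in> sheaf_homs V R ?C F"
    and c: "sheaf_comp V F \<psi> \<phi> = sheaf_id V F" "sheaf_comp V ?C \<phi> \<psi> = sheaf_id V ?C"
    using i unfolding isomorphic_sheaves_def by (elim bexE conjE)
  have Vo: "V \<in> opens X" using V(1) \<U>(1) by blast
  have pp: "\<psi> W (\<phi> W s) = s" if "W \<in> opens V" "s \<in> S W" for W s
    using sheaf_comp_apply[OF that, of \<psi> \<phi>] sheaf_id_apply[OF that] c(1) by simp
  have pp': "\<phi> W (\<psi> W s) = s" if "W \<in> opens V" "s \<in> carrier (sect ?C W)" for W s
    using sheaf_comp_apply[OF that, of \<phi> \<psi>] sheaf_id_apply[OF that] c(2) by simp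
  have cC: "carrier (sect ?C W) = loc_const_functions W (carrier M)" for W
    by (simp add: constant_sheaf_def)
  have rC: "rstr ?C W W' s = restrict s W'" if "s \<in> loc_const_functions W (carrier M)" for W W' s
    using that by (simp add: constant_sheaf_def)
  obtain W where W: "openin (top_of_set X) W" "path_connected W" "y \<in> W" "W \<subseteq> U \<inter> V"
    using lpc[unfolded locally_path_connected, rule_format, of "U \<inter> V" y] U Vo y V(2) by auto
  have Wo: "W \<in> opens X" using W(1) by simp
  have WV: "W \<in> opens V" by (rule opens_restrict[OF Wo _ opens_sub[OF Vo]]) (use W(4) in simp)
  have sub_V: "N \<in> opens V" if "N \<in> opens X" "N \<subseteq> W" for N
    by (rule opens_restrict[OF that(1) _ opens_sub[OF Vo]]) (use that(2) W(4) in blast)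
  have const: "u z = u z'" if u: "u \<in> loc_const_functions W (carrier M)" and z: "z \<in> W" "z' \<in> W" for u z z'
  proof -
    have "u constant_on W"
    proof (rule locally_constant_imp_constant[OF path_connected_imp_connected[OF W(2)]])
      fix a assume a: "a \<in> W"
      obtain N where N: "N \<in> opens W" "a \<in> N" "u constant_on N" by (rule loc_constD[OF u a])
      obtain k where k: "\<And>b. b \<in> N \<Longrightarrow> u b = k" using N(3) unfolding constant_on_def by blast
      show "\<exists>T. openin (top_of_set W) T \<and> a \<in> T \<and> (\<forall>x\<in>T. u x = u a)"
        using N(1,2) k by (intro exI[of _ N]) simp
    qed
    then show ?thesis using z unfolding constant_on_def by (elim exE) simp
  qed
  have "bij_betw (germ z W) (S W) (stalk z)" if z: "z \<in> W" for z
    unfolding bij_betw_def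
  proof (intro conjI inj_onI subset_antisym image_subsetI subsetI)
    fix s t assume s: "s \<in> S W" and t: "t \<in> S W" and e: "germ z W s = germ z W t"
    obtain N where N: "N \<in> opens X" "z \<in> N" "N \<subseteq> W" "rstr F W N s = rstr F W N t"
      by (rule germ_eqE[OF Wo s Wo t z e])
    note NV = sub_V[OF N(1,3)]
    have ls: "\<phi> W s \<in> loc_const_functions W (carrier M)" "\<phi> W t \<in> loc_const_functions W (carrier M)"
      using sheaf_homs_closed[OF phi WV s] sheaf_homs_closed[OF phi WV t] unfolding cC by simp_all
    have "restrict (\<phi> W s) N = restrict (\<phi> W t) N"
      using sheaf_homs_rstr[OF phi WV NV N(3) s] sheaf_homs_rstr[OF phi WV NV N(3) t] N(4) rC[OF ls(1)] rC[OF ls(2)]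
      by simp
    then have ez: "\<phi> W s z = \<phi> W t z" using N(2) by (metis restrict_apply')
    have "\<phi> W s = \<phi> W t"
    proof (rule PiE_ext)
      show "\<phi> W s \<in> W \<rightarrow>\<^sub>E carrier M" "\<phi> W t \<in> W \<rightarrow>\<^sub>E carrier M" using ls unfolding loc_const_functions_def by simp_all
      fix w assume w: "w \<in> W"
      show "\<phi> W s w = \<phi> W t w" using const[OF ls(1) w z] const[OF ls(2) w z] ez by simp
    qed
    then have "\<psi> W (\<phi> W s) = \<psi> W (\<phi> W t)" by (rule arg_cong)
    then show "s = t" unfolding pp[OF WV s] pp[OF WV t] .
  next
    fix s assume "s \<in> S W" then show "germ z W s \<in> stalk z" by (rule germ_in_stalk[OF Wo z])
  next
    fix a assume "a \<in> stalk z"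
    then obtain N t where N: "N \<in> opens X" "z \<in> N" and t: "t \<in> S N" and a: "a = germ z N t" by (rule stalkE)
    let ?N = "N \<inter> W"
    have No: "?N \<in> opens X" by (rule opens_Int[OF N(1) Wo])
    note NV = sub_V[OF No Int_lower2]
    let ?t = "rstr F N ?N t"
    have t': "?t \<in> S ?N" by (rule rstr_closed[OF N(1) No Int_lower1 t])
    have l: "\<phi> ?N ?t \<in> loc_const_functions ?N (carrier M)" using sheaf_homs_closed[OF phi NV t'] unfolding cC .
    have zN: "z \<in> ?N" using z N by simp
    \<comment> \<open>The function representing the germ may be non-constant on \<open>?N\<close>;
      its value \<open>k\<close> on the smaller set \<open>D\<close> is the one spread over
      \<open>W\<close>.\<close>
    obtain D where D: "D \<in> opens ?N" "z \<in> D" "\<phi> ?N ?t constant_on D" by (rule loc_constD[OF l zN])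
    obtain k where k: "\<And>w. w \<in> D \<Longrightarrow> \<phi> ?N ?t w = k" using D(3) unfolding constant_on_def by blast
    have "\<phi> ?N ?t z \<in> carrier M" using l zN unfolding loc_const_functions_def by auto
    then have kM: "k \<in> carrier M" using k[OF D(2)] by simp
    note Do = opens_trans[OF D(1) No] and DN = opens_sub[OF D(1)]
    have DW: "D \<subseteq> W" and DN': "D \<subseteq> N" using DN by auto
    note DV = sub_V[OF Do DW]
    let ?k = "\<lambda>w\<in>W. k"
    have lk: "?k \<in> loc_const_functions W (carrier M)"
      unfolding loc_const_functions_def constant_on_def using kM by force
    define s where "s = \<psi> W ?k"
    have s: "s \<in> S W" unfolding s_def using sheaf_homs_closed[OF psi WV] lk unfolding cC by simp
    have ps: "\<phi> W s = ?k" unfolding s_def using pp'[OF WV] lk unfolding cC by simp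
    have e1: "\<phi> D (rstr F W D s) = restrict ?k D"
      using sheaf_homs_rstr[OF phi WV DV DW s] rC[OF lk] ps by simp
    have e2: "\<phi> D (rstr F ?N D ?t) = restrict (\<phi> ?N ?t) D"
      using sheaf_homs_rstr[OF phi NV DV DN t'] rC[OF l] by simp
    have "restrict ?k D = restrict (\<phi> ?N ?t) D" using k DW by (intro restrict_ext) auto
    then have "\<phi> D (rstr F W D s) = \<phi> D (rstr F ?N D ?t)" using e1 e2 by simp
    then have "\<psi> D (\<phi> D (rstr F W D s)) = \<psi> D (\<phi> D (rstr F ?N D ?t))" by (rule arg_cong)
    then have "rstr F W D s = rstr F ?N D ?t"
      unfolding pp[OF DV rstr_closed[OF Wo Do DW s]] pp[OF DV rstr_closed[OF No Do DN t']] .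
    also have "\<dots> = rstr F N D t" by (rule rstr_rstr[OF N(1) No Do DN Int_lower1 t])
    finally have "germ z W s = a" unfolding a by (rule germ_eqI[OF Wo s N(1) t Do D(2) DW DN'])
    then show "a \<in> germ z W ` S W" by (rule image_eqI[OF sym s])
  qed
  then have "triv W" unfolding triv_def using Wo W(2) by simp
  then show thesis using W(3,4) that by simp
qed

text \<open>A lift of \<open>h\<close> to the espace etale of \<open>F\<close>, phrased without a
  topology on the set of germs. A general parameter set \<open>K\<close> lets the same notion serve
  whole intervals, initial pieces and segments.\<close>

definition par :: "'b::topological_space set \<Rightarrow> ('b \<Rightarrow> 'a) \<Rightarrow> ('b \<Rightarrow> ('a set \<times> 'u) set) \<Rightarrow> bool" where
  "par K h g \<longleftrightarrow> (\<forall>k\<in>K. \<exists>U s N. U \<in> opens X \<and> s \<in> S U \<and> N \<in> opens K \<and> k \<in> N \<and>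
      (\<forall>k'\<in>N. h k' \<in> U \<and> g k' = germ (h k') U s))"

lemma parE:
  assumes "par K h g" "k \<in> K"
  obtains U s N where "U \<in> opens X" "s \<in> S U" "N \<in> opens K" "k \<in> N"
    "\<forall>k'\<in>N. h k' \<in> U \<and> g k' = germ (h k') U s"
proof -
  have "\<exists>U s N. U \<in> opens X \<and> s \<in> S U \<and> N \<in> opens K \<and> k \<in> N \<and>
      (\<forall>k'\<in>N. h k' \<in> U \<and> g k' = germ (h k') U s)"
    using assms unfolding par_def by (rule bspec)
  then show thesis using that by (elim exE conjE)
qed

lemma parI:
  assumes "\<And>k. k \<in> K \<Longrightarrow> \<exists>U s N. U \<in> opens X \<and> s \<in> S U \<and> N \<in> opens K \<and> k \<in> N \<and>
      (\<forall>k'\<in>N. h k' \<in> U \<and> g k' = germ (h k') U s)"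
  shows "par K h g"
  unfolding par_def by (rule ballI) (rule assms)

lemma par_stalk: "par K h g \<Longrightarrow> k \<in> K \<Longrightarrow> g k \<in> stalk (h k)"
  by (erule parE, assumption) (simp add: germ_in_stalk)

lemma par_comp:
  assumes g: "par K h g" and u: "continuous_on K' u" "u ` K' \<subseteq> K"
    and h': "\<And>k. k \<in> K' \<Longrightarrow> h' k = h (u k)" and g': "\<And>k. k \<in> K' \<Longrightarrow> g' k = g (u k)"
  shows "par K' h' g'"
proof (rule parI)
  fix k assume k: "k \<in> K'"
  then have uk: "u k \<in> K" using u(2) by blast
  obtain U s N where U: "U \<in> opens X" "s \<in> S U" and N: "N \<in> opens K" "u k \<in> N"
    and c0: "\<forall>k'\<in>N. h k' \<in> U \<and> g k' = germ (h k') U s"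
    by (rule parE[OF g uk])
  have c: "\<And>k'. k' \<in> N \<Longrightarrow> h k' \<in> U" "\<And>k'. k' \<in> N \<Longrightarrow> g k' = germ (h k') U s"
    using c0 by simp_all
  have "K' \<inter> u -` N \<in> opens K'"
    using continuous_openin_preimage[OF u(1), of K N] u(2) N(1) by (simp add: image_subset_iff_funcset)
  then show "\<exists>U s N. U \<in> opens X \<and> s \<in> S U \<and> N \<in> opens K' \<and> k \<in> N \<and> (\<forall>k'\<in>N. h' k' \<in> U \<and> g' k' = germ (h' k') U s)"
    using U k N(2) c by (intro exI[of _ U] exI[of _ s] exI[of _ "K' \<inter> u -` N"]) (simp add: h' g')
qed

lemma par_subset: "par K h g \<Longrightarrow> K' \<subseteq> K \<Longrightarrow> par K' h g"
  by (rule par_comp[where u = "\<lambda>k. k"]) auto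

text \<open>The representing section provided by \<open>par\<close> may be exchanged for any section
  with the same germ at \<open>k\<close>: the two agree on some \<open>W\<close>, and the preimage
  of \<open>W\<close> under \<open>h\<close> cuts out the neighbourhood.\<close>

lemma par_germ_local:
  assumes g: "par K h g" and h: "continuous_on K h" and k: "k \<in> K"
    and U: "U \<in> opens X" "s \<in> S U" "h k \<in> U" "g k = germ (h k) U s" and hX: "h ` K \<subseteq> X"
  obtains N where "N \<in> opens K" "k \<in> N" "\<forall>k'\<in>N. h k' \<in> U \<and> g k' = germ (h k') U s"
proof -
  obtain V t N where V: "V \<in> opens X" "t \<in> S V" and N: "N \<in> opens K" "k \<in> N"
    and c0: "\<forall>k'\<in>N. h k' \<in> V \<and> g k' = germ (h k') V t"
    by (rule parE[OF g k])
  have c: "\<And>k'. k' \<in> N \<Longrightarrow> h k' \<in> V" "\<And>k'. k' \<in> N \<Longrightarrow> g k' = germ (h k') V t"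
    using c0 by simp_all
  have "germ (h k) V t = germ (h k) U s" using c(2)[OF N(2)] U(4) by simp
  then obtain W where W: "W \<in> opens X" "h k \<in> W" "W \<subseteq> V" "W \<subseteq> U" "rstr F V W t = rstr F U W s"
    by (rule germ_eqE[OF V U(1,2,3)])
  have "K \<inter> h -` W \<in> opens K"
    using continuous_openin_preimage[OF h, of X W] hX W(1) by (simp add: image_subset_iff_funcset)
  then have o: "N \<inter> (K \<inter> h -` W) \<in> opens K" by (rule opens_Int[OF N(1)])
  show thesis
  proof (rule that[OF o _ ballI])
    show "k \<in> N \<inter> (K \<inter> h -` W)" using N(2) k W(2) by simp
    fix k' assume k': "k' \<in> N \<inter> (K \<inter> h -` W)"
    then have w: "h k' \<in> W" "k' \<in> N" by auto
    show "h k' \<in> U \<and> g k' = germ (h k') U s"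
      using w(1) W(4) c(2)[OF w(2)] germ_eqI[OF V U(1,2) W(1) w(1) W(3-5)] by auto
  qed
qed

text \<open>Near a parameter both families come from sections over one trivial \<open>U\<close>; if
  they agree at a single parameter there, the sections are equal. So agreement is open and closed,
  as for lifts to a covering space.\<close>

lemma par_unique:
  assumes K: "connected K" and g: "par K h g" and g': "par K h g'" and h: "continuous_on K h" "h ` K \<subseteq> X"
    and k: "k \<in> K" "g k = g' k" and l: "l \<in> K"
  shows "g l = g' l"
proof (rule connected_induction_simple[OF K k(1) l, where P = "\<lambda>k. g k = g' k", OF k(2)])
  fix a assume a: "a \<in> K"
  have hX: "h a \<in> X" using h(2) a by blast
  obtain U where U: "triv U" "h a \<in> U" by (rule triv_base[of X "h a"]) (use hX in auto)
  obtain s where s: "s \<in> S U" "germ (h a) U s = g a" by (rule triv_surj[OF U par_stalk[OF g a]])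
  obtain t where t: "t \<in> S U" "germ (h a) U t = g' a" by (rule triv_surj[OF U par_stalk[OF g' a]])
  obtain N where N: "N \<in> opens K" "a \<in> N" "\<forall>k'\<in>N. h k' \<in> U \<and> g k' = germ (h k') U s"
    by (rule par_germ_local[OF g h(1) a trivD(1)[OF U(1)] s(1) U(2) s(2)[symmetric] h(2)]) 
  obtain N' where N': "N' \<in> opens K" "a \<in> N'" "\<forall>k'\<in>N'. h k' \<in> U \<and> g' k' = germ (h k') U t"
    by (rule par_germ_local[OF g' h(1) a trivD(1)[OF U(1)] t(1) U(2) t(2)[symmetric] h(2)])
  have eq: "g y = g' y" if x: "x \<in> N \<inter> N'" and y: "y \<in> N \<inter> N'" and e: "g x = g' x" for x y
  proof -
    have "germ (h x) U s = germ (h x) U t" and hx: "h x \<in> U" using x N(3)[THEN bspec, of x] N'(3)[THEN bspec, of x] e by auto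
    then have "s = t" using triv_inj[OF U(1) _ s(1) t(1)] by simp
    then show ?thesis using y N(3)[THEN bspec, of y] N'(3)[THEN bspec, of y] by simp
  qed
  have "openin (top_of_set K) (N \<inter> N')" "a \<in> N \<inter> N'" using opens_Int[OF N(1) N'(1)] N(2) N'(2) by simp_all
  then show "\<exists>T. openin (top_of_set K) T \<and> a \<in> T \<and> (\<forall>x\<in>T. \<forall>y\<in>T. g x = g' x \<longrightarrow> g y = g' y)"
    by (intro exI[of _ "N \<inter> N'"] conjI ballI impI) (assumption | erule (2) eq)+
qed

lemma par_germ:
  assumes "U \<in> opens X" "s \<in> S U" "h ` K \<subseteq> U"
  shows "par K h (\<lambda>k. germ (h k) U s)"
  using assms by (intro parI exI[of _ U] exI[of _ s] exI[of _ K]) auto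

lemma par_exists:
  assumes p: "continuous_on {0..1} p" "p ` {0..1} \<subseteq> X" and a: "a \<in> stalk (p (0::real))"
  obtains g where "par {0..1} p g" "g 0 = a"
proof -
  \<comment> \<open>The parameters up to which the transport exists form an open and closed set.\<close>
  define E where "E t \<longleftrightarrow> (\<exists>g. par {0..t} p g \<and> g 0 = a)" for t :: real
  have "E 1"
  proof (rule connected_induction_simple[of "{0..1::real}" 0 1 E])
    obtain U s where U: "U \<in> opens X" "p 0 \<in> U" "s \<in> S U" "a = germ (p 0) U s" by (rule stalkE[OF a])
    have "par {0..0} p (\<lambda>r. germ (p r) U s)" by (rule par_germ[OF U(1,3)]) (use U(2) in simp)
    then show "E 0" unfolding E_def using U(4) by (intro exI[of _ "\<lambda>r. germ (p r) U s"]) simp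
  next
    fix b :: real assume b: "b \<in> {0..1}"
    have bX: "p b \<in> X" using p(2) b by blast
    obtain U where U: "triv U" "p b \<in> U" by (rule triv_base[of X "p b"]) (use bX in auto)
    obtain d where d: "d > 0" "\<And>r. r \<in> {0..1} \<Longrightarrow> r \<in> ball b d \<Longrightarrow> p r \<in> U"
      by (rule interval_nbhd[OF p trivD(1)[OF U(1)] b U(2)]) blast
    let ?T = "{0..1} \<inter> ball b d"
    \<comment> \<open>Over the trivial set \<open>U\<close> the germ at \<open>x\<close> extends to
      a section \<open>s\<close>, which continues the transport to every parameter of
      \<open>?T\<close>. If \<open>y < x\<close>, the old family is merely cut down.\<close>
    have step: "E y" if x: "x \<in> ?T" and y: "y \<in> ?T" and E: "E x" for x y
    proof -
      obtain g where g: "par {0..x} p g" "g 0 = a" using E unfolding E_def by blast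
      have x0: "x \<in> {0..x}" using x by simp
      have px: "p x \<in> U" using d(2)[of x] x by simp
      obtain s where s: "s \<in> S U" "germ (p x) U s = g x" by (rule triv_surj[OF U(1) px par_stalk[OF g(1) x0]])
      let ?g = "\<lambda>r. if r \<le> x then g r else germ (p r) U s"
      have cv: "convex ({0..x} \<inter> ball b d)" by (intro convex_Int convex_ball convex_closed_interval)
      have sub: "{0..x} \<inter> ball b d \<subseteq> {0..1}" using x by auto
      \<comment> \<open>Just before \<open>x\<close> the old family already comes from
        \<open>s\<close>, so a full neighbourhood of the seam is represented by this one
        section.\<close>
      have eq: "g r = germ (p r) U s" if r: "r \<in> {0..x} \<inter> ball b d" for r
      proof (rule par_unique[OF convex_connected[OF cv] par_subset[OF g(1) Int_lower1] par_germ[OF trivD(1)[OF U(1)] s(1)] _ _ _ _ r, where k = x])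
        show "p ` ({0..x} \<inter> ball b d) \<subseteq> U" using d(2) sub by blast
        show "continuous_on ({0..x} \<inter> ball b d) p" by (rule continuous_on_subset[OF p(1) sub])
        show "p ` ({0..x} \<inter> ball b d) \<subseteq> X" using p(2) sub by blast
        show "x \<in> {0..x} \<inter> ball b d" using x by simp
      qed (simp add: s(2))
      have "par {0..y} p ?g"
      proof (rule parI)
        fix k assume k: "k \<in> {0..y}"
        show "\<exists>V t N. V \<in> opens X \<and> t \<in> S V \<and> N \<in> opens {0..y} \<and> k \<in> N \<and> (\<forall>k'\<in>N. p k' \<in> V \<and> ?g k' = germ (p k') V t)"
        proof (cases "k < x")
          case True
          then have kx: "k \<in> {0..x}" using k by simp
          obtain V t N where V: "V \<in> opens X" "t \<in> S V" and N: "N \<in> opens {0..x}" "k \<in> N"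
            and c0: "\<forall>k'\<in>N. p k' \<in> V \<and> g k' = germ (p k') V t"
            by (rule parE[OF g(1) kx])
          have c: "\<And>k'. k' \<in> N \<Longrightarrow> p k' \<in> V" "\<And>k'. k' \<in> N \<Longrightarrow> g k' = germ (p k') V t"
            using c0 by simp_all
          obtain O' where O': "open O'" "N = {0..x} \<inter> O'" using N(1) unfolding openin_open by auto
          have "{0..y} \<inter> (O' \<inter> {..<x}) \<in> opens {0..y}"
            using openin_open_Int[OF open_Int[OF O'(1) open_lessThan[of x]], of "{0..y}"] by simp
          moreover have "k \<in> {0..y} \<inter> (O' \<inter> {..<x})" using k True N(2) O'(2) by simp
          moreover have "p k' \<in> V \<and> ?g k' = germ (p k') V t" if "k' \<in> {0..y} \<inter> (O' \<inter> {..<x})" for k'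
            using that c[of k'] O'(2) by auto
          ultimately show ?thesis using V by (intro exI[of _ V] exI[of _ t] exI[of _ "{0..y} \<inter> (O' \<inter> {..<x})"]) simp
        next
          case False
          then have kT: "k \<in> ball b d"
            using k x y by (auto simp: dist_real_def)
          have "p k' \<in> U \<and> ?g k' = germ (p k') U s" if k': "k' \<in> {0..y} \<inter> ball b d" for k'
            using k' eq[of k'] d(2)[of k'] y by auto
          moreover have "{0..y} \<inter> ball b d \<in> opens {0..y}" using openin_open_Int[OF open_ball] by simp
          ultimately show ?thesis using k kT s(1) trivD(1)[OF U(1)]
            by (intro exI[of _ U] exI[of _ s] exI[of _ "{0..y} \<inter> ball b d"]) simp
        qed
      qed
      moreover have "?g 0 = a" using g(2) x by simp
      ultimately show "E y" unfolding E_def by (intro exI[of _ ?g] conjI)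
    qed
    have "openin (top_of_set {0..1}) ?T" "b \<in> ?T" using openin_open_Int[OF open_ball] b d(1) by simp_all
    then show "\<exists>T. openin (top_of_set {0..1}) T \<and> b \<in> T \<and> (\<forall>x\<in>T. \<forall>y\<in>T. E x \<longrightarrow> E y)"
      by (intro exI[of _ ?T] conjI ballI impI) (assumption | erule (2) step)+
  qed auto
  then show thesis using that unfolding E_def by blast
qed

end

section \<open>Transport along paths and its homotopy invariance\<close>

context lc_sheaf
begin

text \<open>As a relation, transport is reversed by swapping its arguments; \<open>Tr_exists\<close>
  and \<open>Tr_unique\<close> show that the final germ is a function of the initial one.\<close>

definition Tr :: "(real \<Rightarrow> 'a) \<Rightarrow> ('a set \<times> 'u) set \<Rightarrow> ('a set \<times> 'u) set \<Rightarrow> bool" where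
  "Tr p a b \<longleftrightarrow> (\<exists>g. par {0..1} p g \<and> g 0 = a \<and> g 1 = b)"

lemma TrI: "par {0..1} p g \<Longrightarrow> Tr p (g 0) (g 1)"
  unfolding Tr_def by (intro exI[of _ g]) simp

lemma TrE:
  assumes "Tr p a b" obtains g where "par {0..1} p g" "g 0 = a" "g 1 = b"
  using assms unfolding Tr_def by (elim exE conjE)

lemma is_path_image: "is_path X y z p \<Longrightarrow> p ` {0..1} \<subseteq> X"
  unfolding is_path_def path_image_def by simp

lemma Tr_exists:
  assumes p: "is_path X y z p" and a: "a \<in> stalk y"
  shows "\<exists>b. Tr p a b"
proof -
  have a': "a \<in> stalk (p 0)" using a by (simp add: is_path_ends(1)[OF p])
  obtain g where "par {0..1} p g" "g 0 = a"
    by (rule par_exists[OF is_path_eq_comp(1)[OF p] is_path_image[OF p] a'])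
  then show ?thesis using TrI by blast
qed

lemma Tr_unique:
  assumes p: "is_path X y z p" and b: "Tr p a b" "Tr p a b'"
  shows "b = b'"
proof -
  obtain g where g: "par {0..1} p g" "g 0 = a" "g 1 = b" by (rule TrE[OF b(1)])
  obtain g' where g': "par {0..1} p g'" "g' 0 = a" "g' 1 = b'" by (rule TrE[OF b(2)])
  have "g 1 = g' 1"
    by (rule par_unique[OF connected_Icc g(1) g'(1) is_path_eq_comp(1)[OF p] is_path_image[OF p], where k = 0])
       (simp_all add: g(2) g'(2))
  then show ?thesis using g g' by simp
qed

lemma Tr_stalk:
  assumes p: "is_path X y z p" and "Tr p a b"
  shows "a \<in> stalk y" "b \<in> stalk z"
proof -
  obtain g where g: "par {0..1} p g" "g 0 = a" "g 1 = b" by (rule TrE[OF assms(2)])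
  show "a \<in> stalk y" "b \<in> stalk z"
    using par_stalk[OF g(1), of 0] par_stalk[OF g(1), of 1] g(2,3) by (simp_all add: is_path_ends[OF p])
qed

lemma Tr_reverse:
  assumes "Tr p a b" shows "Tr (reversepath p) b a"
proof -
  obtain g where g: "par {0..1} p g" "g 0 = a" "g 1 = b" by (rule TrE[OF assms])
  have "par {0..1} (reversepath p) (\<lambda>t. g (1 - t))"
    by (rule par_comp[OF g(1), where u = "\<lambda>t. 1 - t"]) (auto intro: continuous_intros simp: reversepath_def)
  from TrI[OF this] show ?thesis using g(2,3) by simp
qed

lemma Tr_inj:
  assumes p: "is_path X y z p" and "Tr p a b" "Tr p a' b" shows "a = a'"
  by (rule Tr_unique[OF is_path_reverse[OF p] Tr_reverse[OF assms(2)] Tr_reverse[OF assms(3)]])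

text \<open>Instead of gluing two parallel families, a transport along the joined path is restricted
  to its halves, where uniqueness identifies it with the given ones.\<close>

lemma Tr_join:
  assumes p: "is_path X y z p" and q: "is_path X z w q" and b: "Tr p a b" and c: "Tr q b c"
  shows "Tr (p +++ q) a c"
proof -
  note pq = is_path_join[OF p q]
  obtain d where d: "Tr (p +++ q) a d" using Tr_exists[OF pq Tr_stalk(1)[OF p b]] by blast
  obtain g where g: "par {0..1} (p +++ q) g" "g 0 = a" "g 1 = d" by (rule TrE[OF d])
  have "par {0..1} p (\<lambda>t. g (t / 2))"
    by (rule par_comp[OF g(1), where u = "\<lambda>t. t / 2"]) (auto intro!: continuous_intros simp: joinpaths_def)
  from TrI[OF this] have "g (1 / 2) = b" using Tr_unique[OF p _ b] g(2) by simp
  have "par {0..1} q (\<lambda>t. g ((t + 1) / 2))"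
  proof (rule par_comp[OF g(1), where u = "\<lambda>t. (t + 1) / 2"])
    fix k :: real assume k: "k \<in> {0..1}"
    show "q k = (p +++ q) ((k + 1) / 2)"
    proof (cases "k = 0")
      case True
      then show ?thesis using is_path_ends(2)[OF p] is_path_ends(1)[OF q] by (simp add: joinpaths_def)
    qed (use k in \<open>simp add: joinpaths_def field_simps\<close>)
  qed (auto intro!: continuous_intros)
  from TrI[OF this] have "Tr q b d" using \<open>g (1 / 2) = b\<close> g(3) by simp
  then have "d = c" using Tr_unique[OF q _ c] by simp
  then show ?thesis using d by simp
qed

lemma Tr_section:
  assumes p: "is_path U y z p" and U: "U \<in> opens X" and s: "s \<in> S U"
  shows "Tr p (germ y U s) (germ z U s)"
proof -
  have "par {0..1} p (\<lambda>k. germ (p k) U s)"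
    by (rule par_germ[OF U s]) (use p in \<open>simp add: is_path_def path_image_def\<close>)
  from TrI[OF this] show ?thesis by (simp add: is_path_ends[OF p])
qed

text \<open>Transport along every row of the homotopy starts at \<open>a\<close> and ends in the
  same stalk, because the ends of the rows stay fixed. The final germ \<open>G s 1\<close> is shown
  to be locally constant in \<open>s\<close>, hence constant.\<close>

lemma Tr_homotopic:
  assumes H: "homotopic_paths X p q" and T: "Tr p a b"
  shows "Tr q a b"
proof -
  let ?I = "{0..1::real}"
  obtain h where h: "continuous_on (?I \<times> ?I) h" "h \<in> ?I \<times> ?I \<rightarrow> X"
    and h0: "\<And>t. t \<in> ?I \<Longrightarrow> h (0, t) = p t" and h1: "\<And>t. t \<in> ?I \<Longrightarrow> h (1, t) = q t"
    and he: "\<And>s. s \<in> ?I \<Longrightarrow> h (s, 0) = p 0" "\<And>s. s \<in> ?I \<Longrightarrow> h (s, 1) = p 1"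
    using H unfolding homotopic_paths pathstart_def pathfinish_def o_def by blast
  have hX: "h (s, t) \<in> X" if "s \<in> ?I" "t \<in> ?I" for s t
    using funcset_mem[OF h(2), of "(s, t)"] that by simp
  have row: "continuous_on ?I (\<lambda>t. h (s, t))" if "s \<in> ?I" for s
    by (rule continuous_on_compose2[OF h(1)]) (use that in \<open>auto intro!: continuous_intros\<close>)
  have col: "continuous_on ?I (\<lambda>s. h (s, t))" if "t \<in> ?I" for t
    by (rule continuous_on_compose2[OF h(1)]) (use that in \<open>auto intro!: continuous_intros\<close>)
  obtain g where g: "par ?I p g" "g 0 = a" "g 1 = b" by (rule TrE[OF T])
  have a: "a \<in> stalk (p 0)" using par_stalk[OF g(1), of 0] g(2) by simp
  have "\<exists>g. par ?I (\<lambda>t. h (s, t)) g \<and> g 0 = a" if s: "s \<in> ?I" for s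
  proof -
    have "a \<in> stalk (h (s, 0))" using a he(1)[OF s] by simp
    moreover have "(\<lambda>t. h (s, t)) ` ?I \<subseteq> X" using hX[OF s] by blast
    ultimately obtain g where "par ?I (\<lambda>t. h (s, t)) g" "g 0 = a" using par_exists[OF row[OF s]] by blast
    then show ?thesis by blast
  qed
  then have "\<forall>s\<in>?I. \<exists>g. par ?I (\<lambda>t. h (s, t)) g \<and> g 0 = a" by (rule ballI)
  from bchoice[OF this] obtain G where G0: "\<forall>s\<in>?I. par ?I (\<lambda>t. h (s, t)) (G s) \<and> G s 0 = a"
    by (elim exE)
  have G: "\<And>s. s \<in> ?I \<Longrightarrow> par ?I (\<lambda>t. h (s, t)) (G s)" "\<And>s. s \<in> ?I \<Longrightarrow> G s 0 = a"
    using G0 by simp_all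
  have "(\<lambda>s. G s 1) constant_on ?I"
  proof (rule locally_constant_imp_constant[OF connected_Icc])
    fix s0 :: real assume s0: "s0 \<in> ?I"
    \<comment> \<open>Near row \<open>s0\<close> the transports along the rows, evaluated in column \<open>t\<close>, come from one section;
      this condition on \<open>t\<close> is open and closed.\<close>
    define A where "A t \<longleftrightarrow> (\<exists>U \<sigma> I. U \<in> opens X \<and> \<sigma> \<in> S U \<and> I \<in> opens ?I \<and> s0 \<in> I \<and>
      (\<forall>s\<in>I. h (s, t) \<in> U \<and> G s t = germ (h (s, t)) U \<sigma>))" for t
    have "A 1"
    proof (rule connected_induction_simple[of ?I 0 1 A])
      obtain U \<sigma> where U: "U \<in> opens X" "p 0 \<in> U" "\<sigma> \<in> S U" "a = germ (p 0) U \<sigma>" by (rule stalkE[OF a])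
      have "\<forall>s\<in>?I. h (s, 0) \<in> U \<and> G s 0 = germ (h (s, 0)) U \<sigma>"
        using U(2,4) he(1) G(2) by simp
      moreover have "?I \<in> opens ?I" by simp
      ultimately show "A 0" unfolding A_def using U s0
        by (intro exI[of _ U] exI[of _ \<sigma>] exI[of _ ?I] conjI)
    next
      fix t0 :: real assume t0: "t0 \<in> ?I"
      obtain U where U: "triv U" "h (s0, t0) \<in> U" by (rule triv_base[of X "h (s0, t0)"]) (use hX[OF s0 t0] in auto)
      note Uo = trivD(1)[OF U(1)]
      have "openin (top_of_set (?I \<times> ?I)) ((?I \<times> ?I) \<inter> h -` U)"
        using continuous_openin_preimage[OF h(1), of X U] h(2) Uo by simp
      moreover have "(s0, t0) \<in> (?I \<times> ?I) \<inter> h -` U" using s0 t0 U(2) by simp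
      \<comment> \<open>On a product neighbourhood of \<open>(s0, t0)\<close> the homotopy stays in
        one trivial set, so rows near \<open>s0\<close> can be compared over a common
        \<open>U\<close>.\<close>
      ultimately obtain I J where I: "openin (top_of_set ?I) I" "s0 \<in> I" and J: "openin (top_of_set ?I) J" "t0 \<in> J"
        and IJ: "I \<times> J \<subseteq> (?I \<times> ?I) \<inter> h -` U"
        by (metis Times_in_interior_subtopology fst_conv snd_conv)
      have II: "I \<subseteq> ?I" using openin_imp_subset[OF I(1)] .
      obtain d where d: "d > 0" "\<forall>t\<in>?I. dist t t0 < d \<longrightarrow> t \<in> J"
        using J unfolding openin_euclidean_subtopology_iff by blast
      let ?J = "?I \<inter> ball t0 d"
      have JJ: "t \<in> J" "t \<in> ?I" if "t \<in> ?J" for t using d(2) that by (auto simp: dist_commute)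
      have inU: "h (s, t) \<in> U" if "s \<in> I" "t \<in> ?J" for s t
        using IJ that(1) JJ(1)[OF that(2)] by auto
      have cJ: "connected ?J" by (intro convex_connected convex_Int convex_ball convex_closed_interval)
      \<comment> \<open>In column \<open>t\<close> the representing section is exchanged for one
        over \<open>U\<close>, at the cost of shrinking the set of rows to \<open>?I2\<close>. Along
        each of these rows uniqueness carries the representation over to column
        \<open>t'\<close>.\<close>
      have step: "A t'" if t: "t \<in> ?J" and t': "t' \<in> ?J" and At: "A t" for t t'
      proof -
        obtain V \<tau> I1 where V: "V \<in> opens X" "\<tau> \<in> S V" and I1: "I1 \<in> opens ?I" "s0 \<in> I1"
          and c: "\<forall>s\<in>I1. h (s, t) \<in> V \<and> G s t = germ (h (s, t)) V \<tau>" using At unfolding A_def by (elim exE conjE)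
        note tI = JJ(2)[OF t]
        obtain \<sigma> where \<sigma>: "\<sigma> \<in> S U" "germ (h (s0, t)) U \<sigma> = G s0 t"
          by (rule triv_surj[OF U(1) inU[OF I(2) t] par_stalk[OF G(1)[OF s0] tI]])
        have "germ (h (s0, t)) V \<tau> = germ (h (s0, t)) U \<sigma>" using c I1(2) \<sigma>(2) by simp
        then obtain W where W: "W \<in> opens X" "h (s0, t) \<in> W" "W \<subseteq> V" "W \<subseteq> U" "rstr F V W \<tau> = rstr F U W \<sigma>"
          by (rule germ_eqE[OF V Uo \<sigma>(1) inU[OF I(2) t]])
        have "?I \<inter> (\<lambda>s. h (s, t)) -` W \<in> opens ?I"
          using continuous_openin_preimage[OF col[OF tI], of X W] hX tI W(1) by simp
        moreover have "I \<in> opens ?I" using I(1) by simp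
        ultimately have o: "I \<inter> (I1 \<inter> (?I \<inter> (\<lambda>s. h (s, t)) -` W)) \<in> opens ?I" (is "?I2 \<in> _")
          using I1(1) by (meson opens_Int)
        have "h (s, t') \<in> U \<and> G s t' = germ (h (s, t')) U \<sigma>" if s: "s \<in> ?I2" for s
        proof
          have sI: "s \<in> I" "s \<in> I1" "s \<in> ?I" "h (s, t) \<in> W" using s by auto
          show "h (s, t') \<in> U" by (rule inU[OF sI(1) t'])
          have e: "G s t = germ (h (s, t)) U \<sigma>"
            using c sI(2) germ_eqI[OF V Uo \<sigma>(1) W(1) sI(4) W(3-5)] by simp
          show "G s t' = germ (h (s, t')) U \<sigma>"
          proof (rule par_unique[OF cJ par_subset[OF G(1)[OF sI(3)] Int_lower1] par_germ[OF Uo \<sigma>(1)] _ _ t e t'])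
            show "(\<lambda>t. h (s, t)) ` ?J \<subseteq> U" using inU[OF sI(1)] by blast
            show "continuous_on ?J (\<lambda>t. h (s, t))" by (rule continuous_on_subset[OF row[OF sI(3)] Int_lower1])
            show "(\<lambda>t. h (s, t)) ` ?J \<subseteq> X" using hX[OF sI(3)] by blast
          qed
        qed
        then have "\<forall>s\<in>?I2. h (s, t') \<in> U \<and> G s t' = germ (h (s, t')) U \<sigma>" by (rule ballI)
        moreover have "s0 \<in> ?I2" using I(2) I1(2) s0 W(2) by simp
        ultimately show "A t'" unfolding A_def using Uo \<sigma>(1) o
          by (intro exI[of _ U] exI[of _ \<sigma>] exI[of _ ?I2] conjI)
      qed
      have "openin (top_of_set ?I) ?J" "t0 \<in> ?J" using openin_open_Int[OF open_ball] t0 d(1) by simp_all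
      then show "\<exists>T. openin (top_of_set ?I) T \<and> t0 \<in> T \<and> (\<forall>x\<in>T. \<forall>y\<in>T. A x \<longrightarrow> A y)"
        by (intro exI[of _ ?J] conjI ballI impI) (assumption | erule (2) step)+
    qed auto
    then obtain U \<sigma> I where I: "I \<in> opens ?I" "s0 \<in> I" and c: "\<forall>s\<in>I. h (s, 1) \<in> U \<and> G s 1 = germ (h (s, 1)) U \<sigma>"
      unfolding A_def by (elim exE conjE)
    \<comment> \<open>All rows end at the point \<open>p 1\<close>, where one section has one
      germ.\<close>
    have "G s 1 = G s0 1" if s: "s \<in> I" for s
      using c[THEN bspec, OF s] c[THEN bspec, OF I(2)] he(2)[OF s0] he(2)[OF subsetD[OF opens_sub[OF I(1)] s]] by simp
    then have "\<forall>s\<in>I. G s 1 = G s0 1" by (rule ballI)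
    moreover have "openin (top_of_set ?I) I" using I(1) by simp
    ultimately show "\<exists>T. openin (top_of_set ?I) T \<and> s0 \<in> T \<and> (\<forall>x\<in>T. G x 1 = G s0 1)"
      using I(2) by (intro exI[of _ I] conjI)
  qed
  then have e: "G 0 1 = G 1 1" unfolding constant_on_def by auto
  have "par ?I p (G 0)" by (rule par_comp[OF G(1)[of 0], where u = "\<lambda>t. t"]) (auto simp: h0)
  moreover have "is_path X (p 0) (p 1) p"
    using homotopic_paths_imp_path[OF H] homotopic_paths_imp_subset[OF H]
    by (simp add: is_path_def pathstart_def pathfinish_def)
  ultimately have "G 0 1 = b" using Tr_unique[OF _ _ T] TrI[of p "G 0"] G(2)[of 0] by auto
  moreover have "par ?I q (G 1)" by (rule par_comp[OF G(1)[of 1], where u = "\<lambda>t. t"]) (auto simp: h1)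
  ultimately show "Tr q a b" using TrI[of q "G 1"] G(2)[of 1] e by simp
qed

text \<open>One binary scheme covers addition and multiplication by a scalar, where the second
  argument is a dummy. For operations compatible with restriction, \<open>germ_op_eq\<close> shows
  that the representatives do not matter.\<close>

definition germ_op :: "('a set \<Rightarrow> 'u \<Rightarrow> 'u \<Rightarrow> 'u) \<Rightarrow> 'a \<Rightarrow> ('a set \<times> 'u) set \<Rightarrow> ('a set \<times> 'u) set \<Rightarrow> ('a set \<times> 'u) set" where
  "germ_op f y a b = (SOME c. \<exists>U s t. U \<in> opens X \<and> y \<in> U \<and> s \<in> S U \<and> t \<in> S U \<and>
      a = germ y U s \<and> b = germ y U t \<and> c = germ y U (f U s t))"

definition natural_op :: "('a set \<Rightarrow> 'u \<Rightarrow> 'u \<Rightarrow> 'u) \<Rightarrow> bool" where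
  "natural_op f \<longleftrightarrow> (\<forall>U\<in>opens X. \<forall>s\<in>S U. \<forall>t\<in>S U. f U s t \<in> S U \<and>
     (\<forall>V\<in>opens X. V \<subseteq> U \<longrightarrow> rstr F U V (f U s t) = f V (rstr F U V s) (rstr F U V t)))"

lemma natural_opD:
  assumes "natural_op f" "U \<in> opens X" "s \<in> S U" "t \<in> S U"
  shows "f U s t \<in> S U"
    "V \<in> opens X \<Longrightarrow> V \<subseteq> U \<Longrightarrow> rstr F U V (f U s t) = f V (rstr F U V s) (rstr F U V t)"
  using assms unfolding natural_op_def by blast+

lemma natural_op_germ:
  assumes f: "natural_op f" and U: "U \<in> opens X" "s \<in> S U" "t \<in> S U" and V: "V \<in> opens X" "V \<subseteq> U" "y \<in> V"
  shows "germ y U (f U s t) = germ y V (f V (rstr F U V s) (rstr F U V t))"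
  using germ_rstr[OF U(1) natural_opD(1)[OF f U] V] by (simp only: natural_opD(2)[OF f U V(1,2)])

lemma germ_op_eq:
  assumes f: "natural_op f" and U: "U \<in> opens X" "y \<in> U" "s \<in> S U" "t \<in> S U"
  shows "germ_op f y (germ y U s) (germ y U t) = germ y U (f U s t)"
proof -
  have "\<exists>c V s' t'. V \<in> opens X \<and> y \<in> V \<and> s' \<in> S V \<and> t' \<in> S V \<and>
      germ y U s = germ y V s' \<and> germ y U t = germ y V t' \<and> c = germ y V (f V s' t')"
    by (intro exI[of _ "germ y U (f U s t)"] exI[of _ U] exI[of _ s] exI[of _ t] conjI U refl)
  from someI_ex[OF this] obtain V s' t' where V: "V \<in> opens X" "y \<in> V" "s' \<in> S V" "t' \<in> S V"
    and e: "germ y U s = germ y V s'" "germ y U t = germ y V t'"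
    and c: "germ_op f y (germ y U s) (germ y U t) = germ y V (f V s' t')"
    unfolding germ_op_def[symmetric] by (elim exE conjE)
  obtain A where A: "A \<in> opens X" "y \<in> A" "A \<subseteq> U" "A \<subseteq> V" "rstr F U A s = rstr F V A s'"
    by (rule germ_eqE[OF U(1,3) V(1,3,2) e(1)])
  obtain B where B: "B \<in> opens X" "y \<in> B" "B \<subseteq> U" "B \<subseteq> V" "rstr F U B t = rstr F V B t'"
    by (rule germ_eqE[OF U(1,4) V(1,4,2) e(2)])
  let ?W = "A \<inter> B"
  have W: "?W \<in> opens X" "?W \<subseteq> U" "?W \<subseteq> V" "y \<in> ?W" using opens_Int[OF A(1) B(1)] A B by auto
  have "rstr F U ?W s = rstr F V ?W s'" "rstr F U ?W t = rstr F V ?W t'"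
    by (rule rstr_eq_mono[OF U(1,3) V(1,3) A(1,3-5) W(1) Int_lower1],
        rule rstr_eq_mono[OF U(1,4) V(1,4) B(1,3-5) W(1) Int_lower2])
  then show ?thesis
    unfolding c natural_op_germ[OF f U(1,3,4) W(1,2,4)] natural_op_germ[OF f V(1,3,4) W(1,3,4)] by simp
qed

lemma par_op:
  assumes f: "natural_op f" and g: "par K h g" and g': "par K h g'"
  shows "par K h (\<lambda>k. germ_op f (h k) (g k) (g' k))"
proof (rule parI)
  fix k assume k: "k \<in> K"
  obtain U s N where U: "U \<in> opens X" "s \<in> S U" and N: "N \<in> opens K" "k \<in> N"
    and c: "\<forall>k'\<in>N. h k' \<in> U \<and> g k' = germ (h k') U s" by (rule parE[OF g k])
  obtain V t N' where V: "V \<in> opens X" "t \<in> S V" and N': "N' \<in> opens K" "k \<in> N'"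
    and c': "\<forall>k'\<in>N'. h k' \<in> V \<and> g' k' = germ (h k') V t" by (rule parE[OF g' k])
  let ?W = "U \<inter> V"
  note W = opens_Int[OF U(1) V(1)]
  let ?s = "rstr F U ?W s" and ?t = "rstr F V ?W t"
  have st: "?s \<in> S ?W" "?t \<in> S ?W"
    using rstr_closed[OF U(1) W Int_lower1 U(2)] rstr_closed[OF V(1) W Int_lower2 V(2)] .
  have "h k' \<in> ?W \<and> germ_op f (h k') (g k') (g' k') = germ (h k') ?W (f ?W ?s ?t)" if "k' \<in> N \<inter> N'" for k'
  proof -
    have w: "h k' \<in> ?W" using that c c' by simp
    have "g k' = germ (h k') ?W ?s" "g' k' = germ (h k') ?W ?t"
      using that c c' germ_rstr[OF U W Int_lower1 w] germ_rstr[OF V W Int_lower2 w] by simp_all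
    then show ?thesis using w germ_op_eq[OF f W w st] by simp
  qed
  then have "\<forall>k'\<in>N \<inter> N'. h k' \<in> ?W \<and> germ_op f (h k') (g k') (g' k') = germ (h k') ?W (f ?W ?s ?t)"
    by (rule ballI)
  then show "\<exists>U s N. U \<in> opens X \<and> s \<in> S U \<and> N \<in> opens K \<and> k \<in> N \<and>
      (\<forall>k'\<in>N. h k' \<in> U \<and> germ_op f (h k') (g k') (g' k') = germ (h k') U s)"
    using W natural_opD(1)[OF f W st] opens_Int[OF N(1) N'(1)] IntI[OF N(2) N'(2)]
    by (intro exI[of _ ?W] exI[of _ "f ?W ?s ?t"] exI[of _ "N \<inter> N'"] conjI)
qed

text \<open>Applying the operation at every parameter to two parallel families gives a parallel
  family (\<open>par_op\<close>). With addition and scalar multiplication for \<open>f\<close>, this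
  is the linearity of transport.\<close>

lemma Tr_op:
  assumes f: "natural_op f" and p: "is_path X y z p"
    and U: "U \<in> opens X" "y \<in> U" "s \<in> S U" "s' \<in> S U" and V: "V \<in> opens X" "z \<in> V" "t \<in> S V" "t' \<in> S V"
    and T: "Tr p (germ y U s) (germ z V t)" "Tr p (germ y U s') (germ z V t')"
  shows "Tr p (germ y U (f U s s')) (germ z V (f V t t'))"
proof -
  obtain g where g: "par {0..1} p g" "g 0 = germ y U s" "g 1 = germ z V t" by (rule TrE[OF T(1)])
  obtain g' where g': "par {0..1} p g'" "g' 0 = germ y U s'" "g' 1 = germ z V t'" by (rule TrE[OF T(2)])
  from TrI[OF par_op[OF f g(1) g'(1)]] show ?thesis
    by (simp only: g(2,3) g'(2,3) is_path_ends[OF p] germ_op_eq[OF f U] germ_op_eq[OF f V])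
qed

lemma natural_op_add: "natural_op (\<lambda>U s t. s \<oplus>\<^bsub>sect F U\<^esub> t)"
  unfolding natural_op_def
  by (intro ballI conjI impI sect_closed(1) lin_maps_add[OF rstr_linear])

lemma natural_op_smult: "a \<in> carrier R \<Longrightarrow> natural_op (\<lambda>U s t. a \<odot>\<^bsub>sect F U\<^esub> s)"
  unfolding natural_op_def
  by (intro ballI conjI impI sect_closed(2) lin_maps_smult[OF rstr_linear])

end

section \<open>The monodromy representation\<close>

locale monodromy = rep_setup X x R enc + sh: lc_sheaf X R F
  for X :: "'a::topological_space set" and x :: 'a and R :: "('r, 'e) ring_scheme" (structure)
    and enc :: "('a \<Rightarrow> 'u) \<Rightarrow> 'u" and F :: "('a, 'r, 'u) presheaf"
begin

abbreviation "S U \<equiv> carrier (sect F U)"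

text \<open>The sections over this set stand for the germs at \<open>x\<close>: \<open>fib\<close>
  is a bijection onto the stalk, and they already form an \<open>R\<close>-module with elements of
  type \<open>'u\<close>.\<close>

definition base :: "'a set" where
  "base = (SOME U. sh.triv U \<and> x \<in> U)"

lemma base: "sh.triv base" "x \<in> base"
proof -
  obtain U where "sh.triv U" "x \<in> U" by (rule sh.triv_base[of X x]) (use x_in in auto)
  then have "\<exists>U. sh.triv U \<and> x \<in> U" by blast
  from someI_ex[OF this] show "sh.triv base" "x \<in> base" unfolding base_def by simp_all
qed

lemma base_open: "base \<in> opens X" by (rule sh.trivD(1)[OF base(1)])

definition fib :: "'u \<Rightarrow> ('a set \<times> 'u) set" where
  "fib m = sh.germ x base m"

lemma fib_in: "m \<in> S base \<Longrightarrow> fib m \<in> sh.stalk x"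
  unfolding fib_def by (rule sh.germ_in_stalk[OF base_open base(2)])

lemma fib_inj: "m \<in> S base \<Longrightarrow> n \<in> S base \<Longrightarrow> fib m = fib n \<Longrightarrow> m = n"
  unfolding fib_def by (rule sh.triv_inj[OF base])

lemma fibE:
  assumes "a \<in> sh.stalk x" obtains m where "m \<in> S base" "fib m = a"
  using sh.triv_surj[OF base assms] unfolding fib_def by metis

text \<open>The coordinate of a germ at \<open>y\<close>, that is, its image under the inverse of
  transport along the chosen path. It becomes the value at \<open>y\<close> of the corresponding
  flat function.\<close>

definition pull :: "'a \<Rightarrow> ('a set \<times> 'u) set \<Rightarrow> 'u" where
  "pull y a = (THE m. m \<in> S base \<and> sh.Tr (base_path y) (fib m) a)"

lemma pull_eqI:
  assumes y: "y \<in> X" and m: "m \<in> S base" "sh.Tr (base_path y) (fib m) a"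
  shows "pull y a = m"
  unfolding pull_def
proof (rule the_equality)
  fix n assume n: "n \<in> S base \<and> sh.Tr (base_path y) (fib n) a"
  have "fib n = fib m" by (rule sh.Tr_inj[OF base_path[OF y] conjunct2[OF n] m(2)])
  then show "n = m" by (rule fib_inj[OF conjunct1[OF n] m(1)])
qed (use m in simp)

lemma pull:
  assumes y: "y \<in> X" and a: "a \<in> sh.stalk y"
  shows "pull y a \<in> S base" "sh.Tr (base_path y) (fib (pull y a)) a"
proof -
  obtain b where b: "sh.Tr (reversepath (base_path y)) a b"
    using sh.Tr_exists[OF reverse_base_path[OF y] a] by blast
  obtain m where m: "m \<in> S base" "fib m = b"
    by (rule fibE[OF sh.Tr_stalk(2)[OF reverse_base_path[OF y] b]])
  have t: "sh.Tr (base_path y) (fib m) a" using sh.Tr_reverse[OF b] m(2) by simp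
  have e: "pull y a = m" by (rule pull_eqI[OF y m(1) t])
  show "pull y a \<in> S base" "sh.Tr (base_path y) (fib (pull y a)) a" unfolding e using m(1) t .
qed

lemma pull_inj:
  assumes y: "y \<in> X" and a: "a \<in> sh.stalk y" "b \<in> sh.stalk y" and e: "pull y a = pull y b"
  shows "a = b"
  using pull(2)[OF y a(1)] pull(2)[OF y a(2)] sh.Tr_unique[OF base_path[OF y]] e by metis

lemma pull_surj:
  assumes y: "y \<in> X" and m: "m \<in> S base"
  obtains a where "a \<in> sh.stalk y" "pull y a = m"
proof -
  obtain a where a: "sh.Tr (base_path y) (fib m) a" using sh.Tr_exists[OF base_path[OF y] fib_in[OF m]] by blast
  show thesis by (rule that[OF sh.Tr_stalk(2)[OF base_path[OF y] a] pull_eqI[OF y m a]])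
qed

text \<open>A loop acts by the inverse of the transport along it, which makes this a left action.\<close>

definition mon :: "(real \<Rightarrow> 'a) set \<Rightarrow> 'u \<Rightarrow> 'u" where
  "mon g m = (THE n. n \<in> S base \<and> (\<exists>p. is_path X x x p \<and> hol p = g \<and> sh.Tr p (fib n) (fib m)))"

text \<open>Loops at \<open>x\<close> with equal holonomy are homotopic, so homotopy invariance of
  transport makes the result independent of the loop. Uniqueness is the injectivity of transport and
  of \<open>fib\<close>.\<close>

lemma mon_eqI:
  assumes p: "is_path X x x p" and m: "m \<in> S base" and n: "n \<in> S base" "sh.Tr p (fib n) (fib m)"
  shows "mon (hol p) m = n"
  unfolding mon_def
proof (rule the_equality)
  fix k assume k: "k \<in> S base \<and> (\<exists>q. is_path X x x q \<and> hol q = hol p \<and> sh.Tr q (fib k) (fib m))"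
  then obtain q where q: "is_path X x x q" "hol q = hol p" "sh.Tr q (fib k) (fib m)" by blast
  have "path_class X q = path_class X p" using q(2) by (simp add: hol_loop[OF q(1)] hol_loop[OF p])
  then have "homotopic_paths X q p" using path_class_eq_iff[OF q(1)] by simp
  then have "sh.Tr p (fib k) (fib m)" by (rule sh.Tr_homotopic[OF _ q(3)])
  then have "fib k = fib n" by (rule sh.Tr_inj[OF p _ n(2)])
  then show "k = n" by (rule fib_inj[OF conjunct1[OF k] n(1)])
qed (use p n in blast)

lemma mon_Tr:
  assumes p: "is_path X x x p" and m: "m \<in> S base"
  shows "mon (hol p) m \<in> S base" "sh.Tr p (fib (mon (hol p) m)) (fib m)"
proof -
  obtain b where b: "sh.Tr (reversepath p) (fib m) b" using sh.Tr_exists[OF is_path_reverse[OF p] fib_in[OF m]] by blast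
  obtain n where n: "n \<in> S base" "fib n = b" by (rule fibE[OF sh.Tr_stalk(2)[OF is_path_reverse[OF p] b]])
  have t: "sh.Tr p (fib n) (fib m)" using sh.Tr_reverse[OF b] n(2) by simp
  have e: "mon (hol p) m = n" by (rule mon_eqI[OF p m n(1) t])
  show "mon (hol p) m \<in> S base" "sh.Tr p (fib (mon (hol p) m)) (fib m)" unfolding e using n(1) t .
qed

text \<open>Closing \<open>p\<close> up with the chosen paths gives a loop at \<open>x\<close> with
  class \<open>hol p\<close>, and transport along it relates the two coordinates. Applied to the
  germs of one section, this is the flatness of their coordinates.\<close>

lemma pull_Tr:
  assumes p: "is_path X y z p" and T: "sh.Tr p a b"
  shows "pull y a = mon (hol p) (pull z b)"
proof -
  note yz = is_pathD(5,6)[OF p] and st = sh.Tr_stalk[OF p T]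
  let ?q = "base_path y +++ (p +++ reversepath (base_path z))"
  have q: "is_path X x x ?q" by (rule hol_loop_path[OF p])
  have "sh.Tr ?q (fib (pull y a)) (fib (pull z b))"
    by (rule sh.Tr_join[OF base_path[OF yz(1)] is_path_join[OF p reverse_base_path[OF yz(2)]] pull(2)[OF yz(1) st(1)]
          sh.Tr_join[OF p reverse_base_path[OF yz(2)] T sh.Tr_reverse[OF pull(2)[OF yz(2) st(2)]]]])
  then have "mon (hol ?q) (pull z b) = pull y a"
    by (rule mon_eqI[OF q pull(1)[OF yz(2) st(2)] pull(1)[OF yz(1) st(1)]])
  moreover have "hol ?q = hol p" using hol_loop[OF q] hol_eq[OF p] by simp
  ultimately show ?thesis by simp
qed

text \<open>Linearity is \<open>Tr_op\<close> along a loop. For a product, the path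
  \<open>p +++ q\<close> carries the germ of \<open>mon g (mon h m)\<close> first to that of
  \<open>mon h m\<close> and then to that of \<open>m\<close>.\<close>

lemma group_rep_mon: "group_rep R \<pi> (sect F base) mon"
proof (intro group_rep.intro group_rep_axioms.intro group_ring_setup_axioms)
  interpret P: Module.module R "sect F base" by (rule sh.sect_module[OF base_open])
  show "Module.module R (sect F base)" by (rule P.module_axioms)
  fix g assume g: "g \<in> carrier \<pi>"
  obtain p where p: "is_path X x x p" "hol p = g" by (rule hol_surj[OF g])
  note mp = mon_Tr[OF p(1), unfolded p(2)] and me = mon_eqI[OF p(1), unfolded p(2)]
  fix m assume m: "m \<in> S base"
  show "mon g m \<in> S base" by (rule mp(1)[OF m])
  { fix n assume n: "n \<in> S base"
    show "mon g (m \<oplus>\<^bsub>sect F base\<^esub> n) = mon g m \<oplus>\<^bsub>sect F base\<^esub> mon g n"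
      by (rule me[OF P.add.m_closed[OF m n] P.add.m_closed[OF mp(1)[OF m] mp(1)[OF n]]], unfold fib_def,
          rule sh.Tr_op[OF sh.natural_op_add p(1) base_open base(2) mp(1)[OF m] mp(1)[OF n] base_open base(2) m n
            mp(2)[OF m, unfolded fib_def] mp(2)[OF n, unfolded fib_def]]) }
  { fix a assume a: "a \<in> carrier R"
    show "mon g (a \<odot>\<^bsub>sect F base\<^esub> m) = a \<odot>\<^bsub>sect F base\<^esub> mon g m"
      by (rule me[OF P.smult_closed[OF a m] P.smult_closed[OF a mp(1)[OF m]]], unfold fib_def,
          rule sh.Tr_op[OF sh.natural_op_smult[OF a] p(1) base_open base(2) mp(1)[OF m] mp(1)[OF m] base_open base(2) m m
            mp(2)[OF m, unfolded fib_def] mp(2)[OF m, unfolded fib_def]]) }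
next
  fix m assume m: "m \<in> S base"
  have c: "is_path base x x (\<lambda>t. x)" by (rule is_path_const[OF base(2)])
  have "sh.Tr (\<lambda>t. x) (fib m) (fib m)" unfolding fib_def by (rule sh.Tr_section[OF c base_open m])
  then have "mon (hol (\<lambda>t. x)) m = m" by (rule mon_eqI[OF is_path_const[OF x_in] m m])
  then show "mon \<one>\<^bsub>\<pi>\<^esub> m = m" by (simp only: hol_const[OF x_in])
next
  fix g h m assume g: "g \<in> carrier \<pi>" and h: "h \<in> carrier \<pi>" and m: "m \<in> S base"
  obtain p where p: "is_path X x x p" "hol p = g" by (rule hol_surj[OF g])
  obtain q where q: "is_path X x x q" "hol q = h" by (rule hol_surj[OF h])
  note mq = mon_Tr[OF q(1) m, unfolded q(2)]
  note mp = mon_Tr[OF p(1) mq(1), unfolded p(2)]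
  have "sh.Tr (p +++ q) (fib (mon g (mon h m))) (fib m)" by (rule sh.Tr_join[OF p(1) q(1) mp(2) mq(2)])
  then have "mon (hol (p +++ q)) m = mon g (mon h m)"
    by (rule mon_eqI[OF is_path_join[OF p(1) q(1)] m mp(1)])
  then show "mon (g \<otimes>\<^bsub>\<pi>\<^esub> h) m = mon g (mon h m)" by (simp only: hol_join[OF p(1) q(1)] p(2) q(2))
qed

text \<open>
  The representation is only required to agree with the monodromy on the carrier, because the
  \<open>R\<close>-module underlying a module over the group ring has different junk values outside of it.
\<close>

lemma iso_rep_sheaf:
  assumes Q: "pi_rep X x R enc Q act"
    and carrier_Q: "carrier Q = S base"
    and add_Q: "\<And>m n. m \<in> S base \<Longrightarrow> n \<in> S base \<Longrightarrow> m \<oplus>\<^bsub>Q\<^esub> n = m \<oplus>\<^bsub>sect F base\<^esub> n"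
    and smult_Q: "\<And>a m. a \<in> carrier R \<Longrightarrow> m \<in> S base \<Longrightarrow> a \<odot>\<^bsub>Q\<^esub> m = a \<odot>\<^bsub>sect F base\<^esub> m"
    and act_Q: "\<And>g m. g \<in> carrier \<pi> \<Longrightarrow> m \<in> S base \<Longrightarrow> act g m = mon g m"
  shows "\<exists>\<phi>\<in>sheaf_homs X R F (pi_rep.rep_sheaf X x enc Q act).
    \<forall>U\<in>opens X. bij_betw (\<phi> U) (S U) (carrier (sect (pi_rep.rep_sheaf X x enc Q act) U))"
proof -
  interpret Q: pi_rep X x R enc Q act by (rule Q)
  define \<beta> where "\<beta> U s = (\<lambda>y\<in>U. pull y (sh.germ y U s))" for U s
  have pP: "pull y (sh.germ y U s) \<in> S base" if "U \<in> opens X" "s \<in> S U" "y \<in> U" for U s y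
    by (rule pull(1)[OF subsetD[OF opens_sub[OF that(1)] that(3)] sh.germ_in_stalk[OF that(1,3,2)]])
  have flat: "\<beta> U s \<in> Q.flat U" if U: "U \<in> opens X" and s: "s \<in> S U" for U s
    unfolding Q.flat_def
  proof (intro CollectI conjI allI impI PiE_I)
    fix y assume y: "y \<in> U"
    show "\<beta> U s y \<in> carrier Q" unfolding \<beta>_def carrier_Q using y pP[OF U s y] by simp
  next
    fix y z p assume p: "is_path U y z p"
    note pX = is_path_mono[OF p opens_sub[OF U]] and yz = is_pathD(5,6)[OF p]
    have "pull y (sh.germ y U s) = act (hol p) (pull z (sh.germ z U s))"
      unfolding act_Q[OF hol_in[OF pX] pP[OF U s yz(2)]] by (rule pull_Tr[OF pX sh.Tr_section[OF p U s]])
    then show "\<beta> U s y = act (hol p) (\<beta> U s z)" unfolding \<beta>_def using yz by simp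
  qed (simp add: \<beta>_def)
  define \<phi> where "\<phi> = (\<lambda>U\<in>opens X. \<lambda>s\<in>S U. enc (\<beta> U s))"
  have phi: "\<phi> U s = enc (\<beta> U s)" if "U \<in> opens X" "s \<in> S U" for U s
    unfolding \<phi>_def using that by simp
  have phi_in: "\<phi> U s \<in> Q.sc U" if "U \<in> opens X" "s \<in> S U" for U s
    unfolding phi[OF that] Q.sc_eq by (rule imageI[OF flat[OF that]])
  have phi_val: "val (\<phi> U s) y = pull y (sh.germ y U s)" if "U \<in> opens X" "s \<in> S U" "y \<in> U" for U s y
    unfolding phi[OF that(1,2)] Q.val_flat[OF opens_sub[OF that(1)] flat[OF that(1,2)]]
    using that(3) by (simp add: \<beta>_def)
  have hom: "\<phi> \<in> sheaf_homs X R F Q.rep_sheaf"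
  proof (rule Q.sheaf_hom_intoI[OF sh.presheaf_of_modules_axioms])
    fix U s assume U: "U \<in> opens X" and s: "s \<in> S U"
    show "\<phi> U s \<in> Q.sc U" by (rule phi_in[OF U s])
    \<comment> \<open>Transport along the chosen path commutes with the operations, so taking
      coordinates is linear.\<close>
    have pull_op: "pull y (sh.germ y U (f U s t)) = f base (pull y (sh.germ y U s)) (pull y (sh.germ y U t))"
      if f: "sh.natural_op f" and t: "t \<in> S U" and y: "y \<in> U" for f t y
    proof -
      have yX: "y \<in> X" using y opens_sub[OF U] by blast
      note bs = pull[OF yX sh.germ_in_stalk[OF U y s]] and bt = pull[OF yX sh.germ_in_stalk[OF U y t]]
      show ?thesis
        by (rule pull_eqI[OF yX sh.natural_opD(1)[OF f base_open bs(1) bt(1)]], unfold fib_def,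
            rule sh.Tr_op[OF f base_path[OF yX] base_open base(2) bs(1) bt(1) U y s t
              bs(2)[unfolded fib_def] bt(2)[unfolded fib_def]])
    qed
    { fix t y assume t: "t \<in> S U" and y: "y \<in> U"
      show "val (\<phi> U (s \<oplus>\<^bsub>sect F U\<^esub> t)) y = val (\<phi> U s) y \<oplus>\<^bsub>Q\<^esub> val (\<phi> U t) y"
        by (simp only: phi_val[OF U sh.sect_closed(1)[OF U s t] y] phi_val[OF U s y] phi_val[OF U t y]
            pull_op[OF sh.natural_op_add t y] add_Q[OF pP[OF U s y] pP[OF U t y]]) }
    { fix a y assume a: "a \<in> carrier R" and y: "y \<in> U"
      show "val (\<phi> U (a \<odot>\<^bsub>sect F U\<^esub> s)) y = a \<odot>\<^bsub>Q\<^esub> val (\<phi> U s) y"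
        by (simp only: phi_val[OF U sh.sect_closed(2)[OF U s s a] y] phi_val[OF U s y]
            pull_op[OF sh.natural_op_smult[OF a] s y] smult_Q[OF a pP[OF U s y]]) }
    { fix V y assume V: "V \<in> opens X" "V \<subseteq> U" and y: "y \<in> V"
      show "val (\<phi> V (rstr F U V s)) y = val (\<phi> U s) y"
        by (simp only: phi_val[OF V(1) sh.rstr_closed[OF U V s] y] phi_val[OF U s subsetD[OF V(2) y]]
            sh.germ_rstr[OF U s V y]) }
  qed (simp_all add: \<phi>_def)
  have inj: "s = t" if U: "U \<in> opens X" and s: "s \<in> S U" and t: "t \<in> S U" and e: "\<phi> U s = \<phi> U t" for U s t
  proof (rule sh.germ_ext[OF U s t])
    fix y assume y: "y \<in> U"
    have yX: "y \<in> X" using y opens_sub[OF U] by blast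
    show "sh.germ y U s = sh.germ y U t"
      by (rule pull_inj[OF yX sh.germ_in_stalk[OF U y s] sh.germ_in_stalk[OF U y t]])
         (simp only: phi_val[OF U s y, symmetric] phi_val[OF U t y, symmetric] e)
  qed
  have surj: "\<exists>s\<in>S U. \<phi> U s = u" if U: "U \<in> opens X" and u: "u \<in> Q.sc U" for U u
  proof -
    have UX: "\<And>y. y \<in> U \<Longrightarrow> y \<in> X" using opens_sub[OF U] by blast
    have ub: "val u y \<in> S base" if "y \<in> U" for y using Q.val_closed[OF U u that] by (simp only: carrier_Q)
    \<comment> \<open>Open sets over which \<open>u\<close> has a preimage. Around \<open>y\<close>,
      the germ with coordinate \<open>val u y\<close> extends over a trivial \<open>W\<close>, and
      flatness of \<open>u\<close> together with \<open>pull_Tr\<close> makes the coordinates agree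
      on all of \<open>W\<close>.\<close>
    define \<U> where "\<U> = {W. W \<in> opens X \<and> W \<subseteq> U \<and> (\<exists>s\<in>S W. \<forall>z\<in>W. pull z (sh.germ z W s) = val u z)}"
    have UU: "W \<in> opens X" "W \<subseteq> U" "\<exists>s\<in>S W. \<forall>z\<in>W. pull z (sh.germ z W s) = val u z" if "W \<in> \<U>" for W
      using that unfolding \<U>_def by simp_all
    have o: "\<U> \<subseteq> opens X" using UU(1) by (rule subsetI)
    have cover: "\<Union>\<U> = U"
    proof (rule subset_antisym)
      show "U \<subseteq> \<Union>\<U>"
      proof
        fix y assume y: "y \<in> U"
        obtain W where W: "sh.triv W" "y \<in> W" "W \<subseteq> U" by (rule sh.triv_base[OF U y])
        note Wo = sh.trivD(1)[OF W(1)]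
        obtain b where b: "b \<in> sh.stalk y" "pull y b = val u y" by (rule pull_surj[OF UX[OF y] ub[OF y]])
        obtain s where s: "s \<in> S W" "sh.germ y W s = b" by (rule sh.triv_surj[OF W(1,2) b(1)])
        have "pull z (sh.germ z W s) = val u z" if z: "z \<in> W" for z
        proof -
          have p: "is_path W z y (seg W z y)" by (rule seg[OF sh.trivD(2)[OF W(1)] z W(2)])
          note pU = is_path_mono[OF p W(3)] and pX = is_path_mono[OF p opens_sub[OF Wo]]
          have "pull z (sh.germ z W s) = mon (hol (seg W z y)) (val u y)"
            using pull_Tr[OF pX sh.Tr_section[OF p Wo s(1)]] by (simp only: s(2) b(2))
          also have "\<dots> = val u z"
            by (simp only: Q.flatD(2)[OF Q.val_in[OF U u] pU] act_Q[OF hol_in[OF pX] ub[OF y]])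
          finally show ?thesis .
        qed
        then have "W \<in> \<U>" unfolding \<U>_def using Wo W(3) s(1) by blast
        then show "y \<in> \<Union>\<U>" using W(2) by (rule UnionI)
      qed
    qed (use UU(2) in blast)
    have "\<forall>W\<in>\<U>. \<exists>s. s \<in> S W \<and> (\<forall>z\<in>W. pull z (sh.germ z W s) = val u z)" using UU(3) by blast
    from bchoice[OF this] obtain \<sigma> where \<sigma>0: "\<forall>W\<in>\<U>. \<sigma> W \<in> S W \<and> (\<forall>z\<in>W. pull z (sh.germ z W (\<sigma> W)) = val u z)"
      by (elim exE)
    have \<sigma>: "\<sigma> W \<in> S W" if "W \<in> \<U>" for W using \<sigma>0 that by simp
    have \<sigma>b: "pull z (sh.germ z W (\<sigma> W)) = val u z" if "W \<in> \<U>" "z \<in> W" for W z using \<sigma>0 that by simp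
    have "\<exists>!t. t \<in> S (\<Union>\<U>) \<and> (\<forall>V\<in>\<U>. rstr F (\<Union>\<U>) V t = \<sigma> V)"
    proof (rule sh.glue[OF o \<sigma>])
      fix V W assume V: "V \<in> \<U>" and W: "W \<in> \<U>"
      note i = opens_Int[OF UU(1)[OF V] UU(1)[OF W]]
      note rv = sh.rstr_closed[OF UU(1)[OF V] i Int_lower1 \<sigma>[OF V]] and rw = sh.rstr_closed[OF UU(1)[OF W] i Int_lower2 \<sigma>[OF W]]
      \<comment> \<open>Coordinates determine germs and germs determine sections, so the local
        preimages agree on overlaps.\<close>
      show "rstr F V (V \<inter> W) (\<sigma> V) = rstr F W (V \<inter> W) (\<sigma> W)"
      proof (rule sh.germ_ext[OF i rv rw])
        fix z assume z: "z \<in> V \<inter> W"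
        have zz: "z \<in> V" "z \<in> W" "z \<in> X" using z UX UU(2)[OF V] by auto
        have "sh.germ z V (\<sigma> V) = sh.germ z W (\<sigma> W)"
          by (rule pull_inj[OF zz(3) sh.germ_in_stalk[OF UU(1)[OF V] zz(1) \<sigma>[OF V]] sh.germ_in_stalk[OF UU(1)[OF W] zz(2) \<sigma>[OF W]]])
             (simp only: \<sigma>b[OF V zz(1)] \<sigma>b[OF W zz(2)])
        then show "sh.germ z (V \<inter> W) (rstr F V (V \<inter> W) (\<sigma> V)) = sh.germ z (V \<inter> W) (rstr F W (V \<inter> W) (\<sigma> W))"
          by (simp only: sh.germ_rstr[OF UU(1)[OF V] \<sigma>[OF V] i Int_lower1 z] sh.germ_rstr[OF UU(1)[OF W] \<sigma>[OF W] i Int_lower2 z])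
      qed
    qed
    then obtain t where t: "t \<in> S U" "\<forall>V\<in>\<U>. rstr F U V t = \<sigma> V" unfolding cover by blast
    have "\<phi> U t = u"
    proof (rule Q.sc_eqI[OF U phi_in[OF U t(1)] u])
      fix y assume y: "y \<in> U"
      then obtain V where V: "V \<in> \<U>" "y \<in> V" unfolding cover[symmetric] by (rule UnionE)
      have "sh.germ y U t = sh.germ y V (\<sigma> V)"
        using sh.germ_rstr[OF U t(1) UU(1,2)[OF V(1)] V(2)] t(2) V(1) by simp
      then show "val (\<phi> U t) y = val u y" by (simp only: phi_val[OF U t(1) y] \<sigma>b[OF V])
    qed
    then show ?thesis using t(1) by blast
  qed
  have "bij_betw (\<phi> U) (S U) (Q.sc U)" if U: "U \<in> opens X" for U
    unfolding bij_betw_def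
  proof (intro conjI inj_onI subset_antisym image_subsetI subsetI)
    fix u assume "u \<in> Q.sc U"
    from surj[OF U this] show "u \<in> \<phi> U ` S U" by blast
  qed (use inj[OF U] phi_in[OF U] in simp_all)
  then show ?thesis using hom by blast
qed

end

theorem theorem1p6p8:
  fixes X :: "'a::topological_space set" and x :: 'a
    and R :: "('r, 'e) ring_scheme"
  assumes "connected X"
    and "locally path_connected X"
    and "locally simply_connected X"
    and "x \<in> X"
    and "cring R"
    and "closed_under_families X TYPE('u)"
  shows "equivalent_categories
           (locally_constant_sheaf_category X R
              :: (('a, 'r, 'u) presheaf, 'a set \<Rightarrow> 'u \<Rightarrow> 'u) category)
           (left_module_category (group_ring R (fundamental_group X x))
              :: ((((real \<Rightarrow> 'a) set \<Rightarrow> 'r), 'u) module, 'u \<Rightarrow> 'u) category)"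
proof -
  \<comment> \<open>Path components and connected components coincide in a locally path-connected
    space.\<close>
  have pc: "path_connected X"
    using path_connected_path_component[of X x]
    by (simp only: path_component_eq_connected_component_set[OF assms(2)]
        connected_component_eq_self[OF assms(1,4)])
  obtain enc :: "('a \<Rightarrow> 'u) \<Rightarrow> 'u" where enc: "inj_on enc (X \<rightarrow>\<^sub>E UNIV)"
    using assms(6) unfolding closed_under_families_def by (elim exE)
  interpret rep_setup X x R enc
    by (intro rep_setup.intro based_space.intro rep_setup_axioms.intro pc assms(2-5) enc)
  let ?C = "locally_constant_sheaf_category X R :: (('a, 'r, 'u) presheaf, 'a set \<Rightarrow> 'u \<Rightarrow> 'u) category"
  let ?D = "left_module_category RG :: ((((real \<Rightarrow> 'a) set \<Rightarrow> 'r), 'u) module, 'u \<Rightarrow> 'u) category"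
  have pr: "pi_rep X x R enc (restr M) (gact M)" if "left_module RG M" for M :: "((real \<Rightarrow> 'a) set \<Rightarrow> 'r, 'u) module"
    by (intro pi_rep.intro rep_setup_axioms group_rep_restr that)
  have two: "two_reps X x R enc (restr M) (gact M) (restr N) (gact N)"
    if "left_module RG M" "left_module RG N" for M N :: "((real \<Rightarrow> 'a) set \<Rightarrow> 'r, 'u) module"
    by (intro two_reps.intro rep_setup_axioms pr that)
  define Go where "Go M = pi_rep.rep_sheaf X x enc (restr M) (gact M)"
    for M :: "((real \<Rightarrow> 'a) set \<Rightarrow> 'r, 'u) module"
  define Gm where "Gm M N f = two_reps.gmap X x enc (restr M) (gact M) f"
    for M N :: "((real \<Rightarrow> 'a) set \<Rightarrow> 'r, 'u) module" and f
  \<comment> \<open>Linear maps over the group ring are the equivariant maps of the underlying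
    representations, which turns \<open>gmap_bij\<close> into full faithfulness of
    \<open>Go\<close>.\<close>
  have eqv: "two_reps.equivariant_maps X x R (restr M) (gact M) (restr N) (gact N) = lin_maps RG M N"
    if M: "left_module RG M" and N: "left_module RG N" for M N :: "((real \<Rightarrow> 'a) set \<Rightarrow> 'r, 'u) module"
    unfolding two_reps.equivariant_maps_def[OF two[OF M N]] restr_simps(1)
    by (rule Set.set_eqI) (simp only: lin_maps_RG_iff[OF M N] mem_Collect_eq)
  have bij: "bij_betw (Gm M N) (lin_maps RG M N) (sheaf_homs X R (Go M) (Go N))"
    if M: "left_module RG M" and N: "left_module RG N" for M N
    using two_reps.gmap_bij[OF two[OF M N]] unfolding eqv[OF M N] Gm_def[abs_def] Go_def .
  have hom: "Gm M N f \<in> sheaf_homs X R (Go M) (Go N)"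
    if M: "left_module RG M" and N: "left_module RG N" and f: "f \<in> lin_maps RG M N" for M N f
    using bij_betwE[OF bij[OF M N]] f by blast
  have val_Gm: "val (Gm M N f U t) y = f (val t y)"
    if M: "left_module RG M" and N: "left_module RG N" and f: "f \<in> lin_maps RG M N"
      and U: "U \<in> opens X" and t: "t \<in> carrier (sect (Go M) U)" and y: "y \<in> U" for M N f U t y
    unfolding Gm_def
    by (rule two_reps.gmap_apply(2)[OF two[OF M N] f[folded eqv[OF M N]] U t[unfolded Go_def] y])
  have val_in: "val t y \<in> carrier M"
    if M: "left_module RG M" and U: "U \<in> opens X" and t: "t \<in> carrier (sect (Go M) U)" and y: "y \<in> U" for M U t y
    using pi_rep.val_closed[OF pr[OF M] U t[unfolded Go_def] y] by simp
  have eqI: "s = t"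
    if M: "left_module RG M" and U: "U \<in> opens X" and st: "s \<in> carrier (sect (Go M) U)" "t \<in> carrier (sect (Go M) U)"
      and e: "\<And>y. y \<in> U \<Longrightarrow> val s y = val t y" for M U s t
    by (rule pi_rep.sc_eqI[OF pr[OF M] U st[unfolded Go_def] e])
  have lc: "locally_constant_sheaf X R (Go M)" if M: "left_module RG M" for M
    unfolding Go_def by (rule pi_rep.locally_constant_rep_sheaf[OF pr[OF M]])
  have psh: "presheaf_of_modules X R (Go M)" if M: "left_module RG M" for M
    unfolding Go_def by (rule pi_rep.presheaf_rep_sheaf[OF pr[OF M]])
  note cat = category_left_modules[of RG] category_locally_constant_sheaves[of X R]
  have D_simps: "Obj ?D = {M. left_module RG M}" "Hom ?D = lin_maps RG" "Idt ?D M = (\<lambda>s\<in>carrier M. s)"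
    "Cmp ?D L M N g f = compose (carrier L) g f" for L M N g f
    by (simp_all add: left_module_category_def)
  have C_simps: "Obj ?C = {F. locally_constant_sheaf X R F}" "Hom ?C = sheaf_homs X R" "Idt ?C F = sheaf_id X F"
    "Cmp ?C F F' F'' \<psi> \<phi> = sheaf_comp X F \<psi> \<phi>" for F F' F'' \<phi> \<psi>
    by (simp_all add: locally_constant_sheaf_category_def)
  have idt: "(\<lambda>s\<in>carrier M. s) \<in> lin_maps RG M M" if "left_module RG M" for M :: "((real \<Rightarrow> 'a) set \<Rightarrow> 'r, 'u) module"
    using category.Idt_in[OF cat(1), of M] that unfolding D_simps by simp
  have cmp: "compose (carrier L) g f \<in> lin_maps RG L N"
    if "left_module RG L" "left_module RG M" "left_module RG N" "f \<in> lin_maps RG L M" "g \<in> lin_maps RG M N"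
    for L M N :: "((real \<Rightarrow> 'a) set \<Rightarrow> 'r, 'u) module" and f g
    using category.Cmp_in[OF cat(1), of L M N f g] that unfolding D_simps by simp
  have G: "is_functor ?D ?C Go Gm"
    unfolding is_functor_def D_simps C_simps
  proof (intro conjI ballI; (unfold mem_Collect_eq)?)
    fix M :: "((real \<Rightarrow> 'a) set \<Rightarrow> 'r, 'u) module" assume M: "left_module RG M"
    show "locally_constant_sheaf X R (Go M)" by (rule lc[OF M])
  next
    fix M N :: "((real \<Rightarrow> 'a) set \<Rightarrow> 'r, 'u) module" and f assume M: "left_module RG M" and N: "left_module RG N" and f: "f \<in> lin_maps RG M N"
    show "Gm M N f \<in> sheaf_homs X R (Go M) (Go N)" by (rule hom[OF M N f])
  next
    fix M :: "((real \<Rightarrow> 'a) set \<Rightarrow> 'r, 'u) module" assume M: "left_module RG M"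
    note i = hom[OF M M idt[OF M]]
    show "Gm M M (\<lambda>s\<in>carrier M. s) = sheaf_id X (Go M)"
    proof (rule sheaf_homs_eqI[OF i presheaf_of_modules.sheaf_id_in[OF psh[OF M]]])
      fix U s assume U: "U \<in> opens X" and s: "s \<in> carrier (sect (Go M) U)"
      show "Gm M M (\<lambda>s\<in>carrier M. s) U s = sheaf_id X (Go M) U s"
        unfolding sheaf_id_apply[OF U s]
        by (rule eqI[OF M U sheaf_homs_closed[OF i U s] s])
           (simp add: val_Gm[OF M M idt[OF M] U s] val_in[OF M U s])
    qed
  next
    fix L M N :: "((real \<Rightarrow> 'a) set \<Rightarrow> 'r, 'u) module" and f g assume L: "left_module RG L" and M: "left_module RG M" and N: "left_module RG N"
      and f: "f \<in> lin_maps RG L M" and g: "g \<in> lin_maps RG M N"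
    note gf = cmp[OF L M N f g]
    note hf = hom[OF L M f] and hg = hom[OF M N g] and hgf = hom[OF L N gf]
    note hc = presheaf_of_modules.sheaf_comp_in[OF psh[OF L] hf hg]
    show "Gm L N (compose (carrier L) g f) = sheaf_comp X (Go L) (Gm M N g) (Gm L M f)"
    proof (rule sheaf_homs_eqI[OF hgf hc])
      fix U s assume U: "U \<in> opens X" and s: "s \<in> carrier (sect (Go L) U)"
      note fs = sheaf_homs_closed[OF hf U s]
      show "Gm L N (compose (carrier L) g f) U s = sheaf_comp X (Go L) (Gm M N g) (Gm L M f) U s"
        unfolding sheaf_comp_apply[OF U s]
      proof (rule eqI[OF N U sheaf_homs_closed[OF hgf U s] sheaf_homs_closed[OF hg U fs]])
        fix y assume y: "y \<in> U"
        show "val (Gm L N (compose (carrier L) g f) U s) y = val (Gm M N g U (Gm L M f U s)) y"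
          by (simp only: val_Gm[OF L N gf U s y] val_Gm[OF M N g U fs y] val_Gm[OF L M f U s y]
              compose_eq[OF val_in[OF L U s y]])
      qed
    qed
  qed
  have es: "\<exists>M\<in>Obj ?D. \<exists>i. is_iso ?C F (Go M) i" if "F \<in> Obj ?C" for F
  proof -
    have F: "locally_constant_sheaf X R F" using that unfolding C_simps by simp
    then have sh: "sheaf_of_modules X R F" unfolding locally_constant_sheaf_def by (rule conjunct1)
    interpret monodromy X x R enc F
      by (intro monodromy.intro lc_sheaf.intro lc_sheaf_axioms.intro rep_setup_axioms sh assms(2)
          conjunct2[OF F[unfolded locally_constant_sheaf_def]])
    interpret P: group_rep R \<pi> "sect F base" mon by (rule group_rep_mon)
    \<comment> \<open>The monodromy representation as a module over the group ring. Passing back to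
      scalars and action recovers it on the carrier: a scalar acts through the unit of the group,
      and a group element with coefficient one.\<close>
    define M where "M = P.extend"
    have M: "left_module RG M" unfolding M_def by (rule P.left_module_extend)
    have "\<exists>\<phi>\<in>sheaf_homs X R F (Go M). \<forall>U\<in>opens X. bij_betw (\<phi> U) (carrier (sect F U)) (carrier (sect (Go M) U))"
      unfolding Go_def
    proof (rule iso_rep_sheaf[OF pr[OF M]])
      fix a m assume "a \<in> carrier R" "m \<in> carrier (sect F base)"
      then show "a \<odot>\<^bsub>restr M\<^esub> m = a \<odot>\<^bsub>sect F base\<^esub> m"
        by (simp add: M_def P.extend_monom P.act_one)
    next
      fix g m assume "g \<in> carrier \<pi>" "m \<in> carrier (sect F base)"
      then show "gact M g m = mon g m"
        by (simp add: M_def gact_def P.extend_monom P.act_closed)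
    qed (simp_all add: M_def)
    then obtain \<phi> where phi: "\<phi> \<in> sheaf_homs X R F (Go M)"
      and b: "\<And>U. U \<in> opens X \<Longrightarrow> bij_betw (\<phi> U) (carrier (sect F U)) (carrier (sect (Go M) U))" by blast
    have "is_iso ?C F (Go M) \<phi>"
      unfolding is_iso_def C_simps
      using phi sheaf_iso_of_bij[OF sheaf_of_modules.axioms(1)[OF sh] phi b] by blast
    then show ?thesis unfolding D_simps using M by blast
  qed
  show ?thesis
    by (rule equivalent_categories_fully_faithful[OF cat(2,1) G _ es])
       (simp add: D_simps C_simps bij)
qed

end
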